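(* If a finite thick irreducible spherical building of rank at least $2$ admits an anisotropic automorphism, then the building is a generalised quadrangle with coprime parameters.
   Context: An automorphism of a spherical building (not necessarily type preserving) is anisotropic if it maps every chamber to an opposite chamber, where two chambers are opposite if they are at maximal distance (their Weyl distance is the longest element of the Weyl group). Irreducible thick spherical buildings of rank $2$ correspond to thick generalised $n$-gons with $n\geq 3$ (chambers being incident point-line pairs); a generalised quadrangle is a generalised $4$-gon, i.e. a point-line geometry whose incidence graph has diameter $4$ and girth $8$. A finite thick generalised quadrangle has parameters $(s,t)$, where every line contains exactly $s+1$ points and every point is on exactly $t+1$ lines; the parameters are coprime if $\gcd(s,t)=1$. *)

theory Defs
  imports
    "HOL-Algebra.Algebra"
    "HOL-Library.Extended_Nat"
begin

section \<open>Coxeter systems\<close>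

definition word_prod :: "('w, 'b) monoid_scheme \<Rightarrow> 'w list \<Rightarrow> 'w" where
  "word_prod W xs = foldr (\<lambda>x y. x \<otimes>\<^bsub>W\<^esub> y) xs \<one>\<^bsub>W\<^esub>"

text \<open>
  The congruence on words over \<open>S\<close> generated by the relators \<open>(s t)\<^sup>m\<close> with \<open>m = m(s,t)\<close> the
  order of \<open>s t\<close> in \<open>W\<close>. As \<open>group.ord\<close> is \<open>0\<close> for elements of infinite order, such pairs
  contribute only a trivial relator; the case \<open>s = t\<close> gives the relator \<open>s s\<close>.
\<close>
inductive coxeter_equiv :: "('w, 'b) monoid_scheme \<Rightarrow> 'w set \<Rightarrow> 'w list \<Rightarrow> 'w list \<Rightarrow> bool"
  for W :: "('w, 'b) monoid_scheme" and S :: "'w set" where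
  relator: "\<lbrakk>s \<in> S; t \<in> S; set xs \<subseteq> S; set ys \<subseteq> S\<rbrakk> \<Longrightarrow>
     coxeter_equiv W S
       (xs @ concat (replicate (group.ord W (s \<otimes>\<^bsub>W\<^esub> t)) [s, t]) @ ys) (xs @ ys)"
| refl: "set xs \<subseteq> S \<Longrightarrow> coxeter_equiv W S xs xs"
| sym: "coxeter_equiv W S xs ys \<Longrightarrow> coxeter_equiv W S ys xs"
| trans: "\<lbrakk>coxeter_equiv W S xs ys; coxeter_equiv W S ys zs\<rbrakk> \<Longrightarrow> coxeter_equiv W S xs zs"

text \<open>
  The axiom \<open>presentation\<close> says that \<open>W\<close> is presented by the involutory generators \<open>S\<close> with
  defining relations \<open>(s t)\<^bsup>m(s,t)\<^esup> = 1\<close>.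
\<close>
locale coxeter_system = group W for W :: "('w, 'b) monoid_scheme" (structure) +
  fixes S :: "'w set"
  assumes generators_closed: "S \<subseteq> carrier W"
    and generate_carrier: "generate W S = carrier W"
    and generator_ord: "s \<in> S \<Longrightarrow> ord s = 2"
    and presentation:
      "\<lbrakk>set xs \<subseteq> S; word_prod W xs = \<one>\<rbrakk> \<Longrightarrow> coxeter_equiv W S xs []"

definition word_length :: "('w, 'b) monoid_scheme \<Rightarrow> 'w set \<Rightarrow> 'w \<Rightarrow> nat" where
  "word_length W S w = (LEAST n. \<exists>xs. set xs \<subseteq> S \<and> length xs = n \<and> word_prod W xs = w)"

definition longest_element :: "('w, 'b) monoid_scheme \<Rightarrow> 'w set \<Rightarrow> 'w \<Rightarrow> bool" where
  "longest_element W S w \<longleftrightarrow>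
     w \<in> carrier W \<and> (\<forall>v\<in>carrier W. word_length W S v \<le> word_length W S w)"

definition coxeter_diagram :: "('w, 'b) monoid_scheme \<Rightarrow> 'w set \<Rightarrow> 'w rel" where
  "coxeter_diagram W S =
     {(s, t). s \<in> S \<and> t \<in> S \<and> s \<noteq> t \<and> group.ord W (s \<otimes>\<^bsub>W\<^esub> t) \<noteq> 2}"

definition irreducible_coxeter :: "('w, 'b) monoid_scheme \<Rightarrow> 'w set \<Rightarrow> bool" where
  "irreducible_coxeter W S \<longleftrightarrow> S \<noteq> {} \<and> (\<forall>s\<in>S. \<forall>t\<in>S. (s, t) \<in> (coxeter_diagram W S)\<^sup>*)"

section \<open>Buildings as Weyl metric spaces\<close>

text \<open>
  A building of type \<open>(W,S)\<close> is a nonempty set of chambers with a Weyl distance in \<open>W\<close>.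
  The rank is \<open>card S\<close>, and the building is spherical if \<open>W\<close> is finite.
\<close>
locale building = coxeter_system W S for W :: "('w, 'b) monoid_scheme" (structure) and S +
  fixes Ch :: "'c set" and \<delta> :: "'c \<Rightarrow> 'c \<Rightarrow> 'w"
  assumes chambers_nonempty: "Ch \<noteq> {}"
    and dist_closed: "\<lbrakk>C \<in> Ch; D \<in> Ch\<rbrakk> \<Longrightarrow> \<delta> C D \<in> carrier W"
    and dist_one_iff: "\<lbrakk>C \<in> Ch; D \<in> Ch\<rbrakk> \<Longrightarrow> \<delta> C D = \<one> \<longleftrightarrow> C = D"
    and dist_step: "\<lbrakk>C \<in> Ch; D \<in> Ch; C' \<in> Ch; s \<in> S; \<delta> C' C = s\<rbrakk> \<Longrightarrow>
      \<delta> C' D = s \<otimes> \<delta> C D \<or> \<delta> C' D = \<delta> C D"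
    and dist_step_up: "\<lbrakk>C \<in> Ch; D \<in> Ch; C' \<in> Ch; s \<in> S; \<delta> C' C = s;
       word_length W S (s \<otimes> \<delta> C D) = word_length W S (\<delta> C D) + 1\<rbrakk> \<Longrightarrow>
      \<delta> C' D = s \<otimes> \<delta> C D"
    and dist_step_ex: "\<lbrakk>C \<in> Ch; D \<in> Ch; s \<in> S\<rbrakk> \<Longrightarrow>
      \<exists>C'\<in>Ch. \<delta> C' C = s \<and> \<delta> C' D = s \<otimes> \<delta> C D"

definition panel ::
  "('w, 'b) monoid_scheme \<Rightarrow> 'c set \<Rightarrow> ('c \<Rightarrow> 'c \<Rightarrow> 'w) \<Rightarrow> 'w \<Rightarrow> 'c \<Rightarrow> 'c set" where
  "panel W Ch \<delta> s C = {D \<in> Ch. \<delta> C D = \<one>\<^bsub>W\<^esub> \<or> \<delta> C D = s}"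

text \<open>Every panel has at least three chambers (panels may be infinite).\<close>
definition thick_building ::
  "('w, 'b) monoid_scheme \<Rightarrow> 'w set \<Rightarrow> 'c set \<Rightarrow> ('c \<Rightarrow> 'c \<Rightarrow> 'w) \<Rightarrow> bool" where
  "thick_building W S Ch \<delta> \<longleftrightarrow>
     (\<forall>C\<in>Ch. \<forall>s\<in>S. \<exists>T \<subseteq> panel W Ch \<delta> s C. card T = 3)"

definition opposite ::
  "('w, 'b) monoid_scheme \<Rightarrow> 'w set \<Rightarrow> ('c \<Rightarrow> 'c \<Rightarrow> 'w) \<Rightarrow> 'c \<Rightarrow> 'c \<Rightarrow> bool" where
  "opposite W S \<delta> C D \<longleftrightarrow> longest_element W S (\<delta> C D)"

text \<open>
  Automorphisms need not preserve types: \<open>\<sigma>\<close> is the induced permutation of the types.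
  That \<open>\<sigma>\<close> preserves the Coxeter diagram and that the full Weyl distance is transported by the
  extension of \<open>\<sigma>\<close> to \<open>W\<close> are consequences.
\<close>
definition building_automorphism ::
  "'w set \<Rightarrow> 'c set \<Rightarrow> ('c \<Rightarrow> 'c \<Rightarrow> 'w) \<Rightarrow> ('c \<Rightarrow> 'c) \<Rightarrow> bool" where
  "building_automorphism S Ch \<delta> \<theta> \<longleftrightarrow>
     bij_betw \<theta> Ch Ch \<and>
     (\<exists>\<sigma>. bij_betw \<sigma> S S \<and>
        (\<forall>C\<in>Ch. \<forall>D\<in>Ch. \<forall>s\<in>S. \<delta> C D = s \<longleftrightarrow> \<delta> (\<theta> C) (\<theta> D) = \<sigma> s))"

definition anisotropic ::
  "('w, 'b) monoid_scheme \<Rightarrow> 'w set \<Rightarrow> 'c set \<Rightarrow> ('c \<Rightarrow> 'c \<Rightarrow> 'w) \<Rightarrow> ('c \<Rightarrow> 'c) \<Rightarrow> bool" where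
  "anisotropic W S Ch \<delta> \<theta> \<longleftrightarrow> (\<forall>C\<in>Ch. opposite W S \<delta> C (\<theta> C))"

section \<open>Generalised polygons\<close>

text \<open>Simple graphs are given by a vertex set and a symmetric irreflexive adjacency relation.\<close>

definition graph_walk :: "'v set \<Rightarrow> 'v rel \<Rightarrow> 'v list \<Rightarrow> bool" where
  "graph_walk V E p \<longleftrightarrow> p \<noteq> [] \<and> set p \<subseteq> V \<and> successively (\<lambda>u v. (u, v) \<in> E) p"

definition graph_dist :: "'v set \<Rightarrow> 'v rel \<Rightarrow> 'v \<Rightarrow> 'v \<Rightarrow> enat" where
  "graph_dist V E u v =
     (INF p \<in> {p. graph_walk V E p \<and> hd p = u \<and> last p = v}. enat (length p - 1))"

definition graph_diameter :: "'v set \<Rightarrow> 'v rel \<Rightarrow> enat" where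
  "graph_diameter V E = (SUP u\<in>V. SUP v\<in>V. graph_dist V E u v)"

definition graph_cycle :: "'v set \<Rightarrow> 'v rel \<Rightarrow> 'v list \<Rightarrow> bool" where
  "graph_cycle V E p \<longleftrightarrow>
     graph_walk V E p \<and> distinct p \<and> 3 \<le> length p \<and> (last p, hd p) \<in> E"

definition graph_girth :: "'v set \<Rightarrow> 'v rel \<Rightarrow> enat" where
  "graph_girth V E = (INF p \<in> {p. graph_cycle V E p}. enat (length p))"

definition incidence_edges :: "('p \<times> 'l) set \<Rightarrow> ('p + 'l) rel" where
  "incidence_edges I = {(Inl x, Inr y) |x y. (x, y) \<in> I} \<union> {(Inr y, Inl x) |x y. (x, y) \<in> I}"

definition generalised_polygon ::
  "nat \<Rightarrow> 'p set \<Rightarrow> 'l set \<Rightarrow> ('p \<times> 'l) set \<Rightarrow> bool" where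
  "generalised_polygon n P L I \<longleftrightarrow>
     I \<subseteq> P \<times> L \<and>
     graph_diameter (P <+> L) (incidence_edges I) = enat n \<and>
     graph_girth (P <+> L) (incidence_edges I) = enat (2 * n)"

abbreviation generalised_quadrangle :: "'p set \<Rightarrow> 'l set \<Rightarrow> ('p \<times> 'l) set \<Rightarrow> bool" where
  "generalised_quadrangle \<equiv> generalised_polygon 4"

definition has_parameters ::
  "'p set \<Rightarrow> 'l set \<Rightarrow> ('p \<times> 'l) set \<Rightarrow> nat \<Rightarrow> nat \<Rightarrow> bool" where
  "has_parameters P L I s t \<longleftrightarrow>
     (\<forall>y\<in>L. card {x \<in> P. (x, y) \<in> I} = s + 1) \<and>
     (\<forall>x\<in>P. card {y \<in> L. (x, y) \<in> I} = t + 1)"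

text \<open>
  The building with chambers \<open>Ch\<close> is, up to isomorphism, the one of the geometry \<open>(P,L,I)\<close>:
  its chambers are the flags, and the two types of adjacency are changing the point on a fixed
  line, respectively changing the line through a fixed point. These adjacencies determine \<open>\<delta>\<close>.
\<close>
definition is_flag_building ::
  "'w set \<Rightarrow> 'c set \<Rightarrow> ('c \<Rightarrow> 'c \<Rightarrow> 'w) \<Rightarrow> 'p set \<Rightarrow> 'l set \<Rightarrow> ('p \<times> 'l) set \<Rightarrow> bool" where
  "is_flag_building S Ch \<delta> P L I \<longleftrightarrow>
     (\<exists>a b \<phi>. S = {a, b} \<and> a \<noteq> b \<and> bij_betw \<phi> Ch {(x, y) \<in> P \<times> L. (x, y) \<in> I} \<and>
        (\<forall>C\<in>Ch. \<forall>D\<in>Ch.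
           (\<delta> C D = a \<longleftrightarrow> fst (\<phi> C) \<noteq> fst (\<phi> D) \<and> snd (\<phi> C) = snd (\<phi> D)) \<and>
           (\<delta> C D = b \<longleftrightarrow> fst (\<phi> C) = fst (\<phi> D) \<and> snd (\<phi> C) \<noteq> snd (\<phi> D))))"

end

theory Submission
  imports Defs "HOL-Computational_Algebra.Computational_Algebra" "HOL-Library.Function_Algebras"
    "Jordan_Normal_Form.Schur_Decomposition"
begin

text \<open>Let \<open>\<theta>\<close> be anisotropic. Projecting \<open>\<theta>\<close> to a residue of rank two gives a permutation of its
  chambers that maps every chamber to an opposite one, so it suffices to understand the residues,
  which are generalised \<open>n\<close>-gons with parameters \<open>a, b\<close>. The permutation \<open>P\<close> acts on functions on chambers,
  normalises the Hecke algebra generated by the adjacency operators \<open>A\<close> and \<open>B\<close>, and \<open>P\<close> times any word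
  in \<open>A, B\<close> of length less than \<open>n\<close> has trace zero. For \<open>M = (1 + A) (1 + B)\<close>, with trivial eigenvalue
  \<open>(a + 1) (b + 1)\<close>, the other nonzero eigenvalues are \<open>a + b + y \<surd>(a b)\<close> with \<open>y\<close> an algebraic
  integer. As \<open>P\<close> has finite order, the eigenvalues of \<open>P g(M)\<close> differ from those of \<open>g(M)\<close> by roots of unity,
  so the vanishing of the trace for suitable \<open>g\<close> of small degree turns into a divisibility in the ring of
  algebraic integers. It excludes odd \<open>n\<close> and \<open>n \<ge> 10\<close>, forces \<open>a, b\<close> to be coprime, and excludes hexagons
  (by Vieta jumping, \<open>a b\<close> being a square) and octagons.

  Hence all entries of the Coxeter matrix outside the diagonal are \<open>2\<close> or \<open>4\<close>. If the rank were at least three, a path of two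
  edges in the diagram would yield a homomorphism onto an infinite affine reflection group.\<close>

section \<open>Algebraic integers and traces\<close>

text \<open>A residue of rank two need not be mapped to itself by the automorphism. Composing with
  the projection back to it works because \<open>w0\<close> is the longest element of the residue
  times \<open>v\<close>, with lengths adding. A word of length less than \<open>n\<close> joins
  only chambers at distance less than \<open>n\<close>, so its product with \<open>P\<close> has
  zero diagonal. Each factor \<open>M\<close> costs two letters. For even \<open>n\<close> the
  usable polynomials are \<open>X * g\<close> with \<open>g\<close> of degree at most
  \<open>n/2 - 2\<close>, one less than the number of possible nontrivial nonzero eigenvalues. So
  \<open>g\<close> can vanish at all of them but one (hexagon, octagon) or be a high power of
  \<open>X - a - b\<close> (\<open>n >= 10\<close>). For \<open>n = 4\<close> only constants are
  left; they yield coprimality and no contradiction. \<open>P\<close> and \<open>M\<close> are never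
  diagonalised together: if they commute, the \<open>k\<close>-th power of \<open>P p(M)\<close> is
  \<open>p(M)^k\<close>, which compares eigenvalues up to roots of unity. For odd \<open>n\<close>,
  \<open>P\<close> exchanges \<open>A\<close> and \<open>B\<close>, and a square root of
  \<open>M P^2\<close> replaces \<open>P M\<close>. Of Coxeter group theory only the presentation is
  given; the exchange condition is extracted from the thick building.\<close>

lemma algebraic_int_eigenvalue_nat:
  fixes x :: complex and n :: nat
  assumes "i0 < n" "v i0 \<noteq> 0"
    and eig: "\<And>i. i < n \<Longrightarrow> x * v i = (\<Sum>j<n. of_int (A i j) * v j)"
  shows "algebraic_int x"
proof -
  define M :: "int mat" where "M = mat n n (\<lambda>(i,j). A i j)"
  define Mc :: "complex mat" where "Mc = map_mat of_int M"
  have M: "M \<in> carrier_mat n n" and Mc: "Mc \<in> carrier_mat n n"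
    by (auto simp: M_def Mc_def)
  have "eigenvector Mc (vec n v) x"
    unfolding eigenvector_def
  proof (intro conjI)
    show "vec n v \<in> carrier_vec (dim_row Mc)" using Mc by auto
    show "vec n v \<noteq> 0\<^sub>v (dim_row Mc)"
      using assms(1,2) Mc by (metis carrier_matD(1) index_vec index_zero_vec(1))
    show "Mc *\<^sub>v vec n v = x \<cdot>\<^sub>v vec n v"
      using Mc eig by (intro eq_vecI) (auto simp: Mc_def M_def scalar_prod_def lessThan_atLeast0)
  qed
  then have "eigenvalue Mc x" unfolding eigenvalue_def by blast
  then have "poly (char_poly Mc) x = 0" using eigenvalue_root_char_poly[OF Mc] by simp
  moreover have "char_poly Mc = of_int_poly (char_poly M)"
    unfolding Mc_def by (rule of_int_hom.char_poly_hom[OF M])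
  moreover have "lead_coeff (char_poly M) = 1"
    using degree_monic_char_poly[OF M] by simp
  ultimately show ?thesis
    unfolding algebraic_int_altdef_ipoly by metis
qed

lemma algebraic_int_eigenvalue:
  fixes x :: complex
  assumes I: "finite I" "i0 \<in> I" "v i0 \<noteq> 0"
    and eig: "\<And>i. i \<in> I \<Longrightarrow> x * v i = (\<Sum>j\<in>I. of_int (A i j) * v j)"
  shows "algebraic_int x"
proof -
  obtain h where h: "bij_betw h {..<card I} I"
    using ex_bij_betw_nat_finite[OF I(1)] by (auto simp: lessThan_atLeast0)
  obtain k where k: "k < card I" "h k = i0"
    using h I(2) by (metis bij_betw_iff_bijections lessThan_iff)
  show ?thesis
  proof (rule algebraic_int_eigenvalue_nat)
    show "k < card I" "(\<lambda>i. v (h i)) k \<noteq> 0" using k I(3) by auto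
    fix i assume "i < card I"
    then have "h i \<in> I" using h bij_betwE by blast
    then have "x * v (h i) = (\<Sum>j\<in>I. of_int (A (h i) j) * v j)" by (rule eig)
    also have "\<dots> = (\<Sum>j<card I. of_int (A (h i) (h j)) * v (h j))"
      using sum.reindex_bij_betw[OF h, of "\<lambda>j. of_int (A (h i) j) * v j"] by simp
    finally show "x * v (h i) = (\<Sum>j<card I. of_int ((\<lambda>i j. A (h i) (h j)) i j) * v (h j))" .
  qed
qed

text \<open>The powers of \<open>x\<close> below the degree form an eigenvector of the companion
  matrix of a monic integer polynomial. Integrality thus becomes a statement about integer matrices,
  which can be combined.\<close>

lemma algebraic_int_power_module:
  fixes x :: complex
  assumes "algebraic_int x"
  obtains n A where "0 < n" "\<And>i. i < n \<Longrightarrow> x * x ^ i = (\<Sum>j<n. of_int (A i j) * x ^ j)"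
proof -
  obtain p :: "int poly" where p: "poly (of_int_poly p) x = 0" "lead_coeff p = 1"
    using assms unfolding algebraic_int_altdef_ipoly by blast
  define n where "n = Polynomial.degree p"
  have n: "0 < n"
  proof (rule ccontr)
    assume "\<not> 0 < n"
    then obtain a where "p = [:a:]" unfolding n_def using degree_0_id by (metis gr0I)
    then show False using p by auto
  qed
  have top: "x ^ n = (\<Sum>j<n. of_int (- poly.coeff p j) * x ^ j)"
  proof -
    have "(\<Sum>j\<le>n. of_int (poly.coeff p j) * x ^ j) = 0"
      using p(1) by (simp add: poly_altdef n_def)
    then have "(\<Sum>j<n. of_int (poly.coeff p j) * x ^ j) + x ^ n = 0"
      using p(2) by (simp add: n_def lessThan_Suc_atMost[symmetric])
    then show ?thesis by (simp add: sum_negf add_eq_0_iff)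
  qed
  define A where "A i j = (if Suc i = n then - poly.coeff p j else if j = Suc i then 1 else 0)" for i j
  have "x * x ^ i = (\<Sum>j<n. of_int (A i j) * x ^ j)" if i: "i < n" for i
  proof (cases "Suc i = n")
    case True
    then show ?thesis using top by (auto simp: A_def)
  next
    case False
    then have "(\<Sum>j<n. of_int (A i j) * x ^ j) = (\<Sum>j<n. if j = Suc i then x ^ j else 0)"
      by (intro sum.cong) (auto simp: A_def)
    also have "\<dots> = x ^ Suc i" using False i by simp
    finally show ?thesis by simp
  qed
  then show ?thesis using that n by blast
qed

text \<open>The products \<open>x ^ i * y ^ j\<close> form a common eigenvector of the Kronecker
  product and of the Kronecker sum of the two companion matrices, with eigenvalues
  \<open>x * y\<close> and \<open>x + y\<close>.\<close>

lemma algebraic_int_add_mult: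
  fixes x y :: complex
  assumes "algebraic_int x" "algebraic_int y"
  shows algebraic_int_add: "algebraic_int (x + y)"
    and algebraic_int_mult: "algebraic_int (x * y)"
proof -
  obtain n A where A: "0 < n" "\<And>i. i < n \<Longrightarrow> x * x ^ i = (\<Sum>j<n. of_int (A i j) * x ^ j)"
    using algebraic_int_power_module[OF assms(1)] by blast
  obtain m B where B: "0 < m" "\<And>i. i < m \<Longrightarrow> y * y ^ i = (\<Sum>j<m. of_int (B i j) * y ^ j)"
    using algebraic_int_power_module[OF assms(2)] by blast
  let ?I = "{..<n} \<times> {..<m}"
  define v where "v = (\<lambda>(i,j). x ^ i * y ^ j)"
  have fin: "finite ?I" "(0,0) \<in> ?I" "v (0,0) \<noteq> 0" using A(1) B(1) by (auto simp: v_def)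
  show "algebraic_int (x * y)"
  proof (rule algebraic_int_eigenvalue[where v = v, OF fin, where A = "\<lambda>(i,j) (k,l). A i k * B j l"])
    fix ij assume "ij \<in> ?I"
    then obtain i j where ij: "ij = (i,j)" "i < n" "j < m" by auto
    have "x * y * v ij = (x * x ^ i) * (y * y ^ j)" by (simp add: v_def ij)
    also have "\<dots> = (\<Sum>k<n. \<Sum>l<m. of_int (A i k * B j l) * (x ^ k * y ^ l))"
      by (simp only: A(2)[OF ij(2)] B(2)[OF ij(3)] sum_product) (simp add: mult_ac)
    also have "\<dots> = (\<Sum>kl\<in>?I. of_int ((\<lambda>(i,j) (k,l). A i k * B j l) ij kl) * v kl)"
      by (simp add: sum.cartesian_product ij v_def case_prod_unfold)
    finally show "x * y * v ij = \<dots>" .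
  qed
  show "algebraic_int (x + y)"
  proof (rule algebraic_int_eigenvalue[where v = v, OF fin, where A = "\<lambda>(i,j) (k,l).
        (if l = j then A i k else 0) + (if k = i then B j l else 0)"])
    fix ij assume "ij \<in> ?I"
    then obtain i j where ij: "ij = (i,j)" "i < n" "j < m" by auto
    have 1: "(\<Sum>k<n. \<Sum>l<m. of_int (if l = j then A i k else 0) * (x ^ k * y ^ l))
        = (x * x ^ i) * y ^ j"
    proof -
      have "(\<Sum>k<n. \<Sum>l<m. of_int (if l = j then A i k else 0) * (x ^ k * y ^ l))
         = (\<Sum>k<n. \<Sum>l<m. if l = j then of_int (A i k) * (x ^ k * y ^ l) else 0)"
        by (intro sum.cong) auto
      also have "\<dots> = (\<Sum>k<n. of_int (A i k) * x ^ k * y ^ j)" using ij by (simp add: mult_ac)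
      finally show ?thesis using A(2)[OF ij(2)] by (simp add: sum_distrib_right)
    qed
    have 2: "(\<Sum>k<n. \<Sum>l<m. of_int (if k = i then B j l else 0) * (x ^ k * y ^ l))
        = x ^ i * (y * y ^ j)"
    proof -
      have "(\<Sum>k<n. \<Sum>l<m. of_int (if k = i then B j l else 0) * (x ^ k * y ^ l))
         = (\<Sum>k<n. if k = i then (\<Sum>l<m. of_int (B j l) * (x ^ k * y ^ l)) else 0)"
        by (intro sum.cong) auto
      also have "\<dots> = (\<Sum>l<m. of_int (B j l) * (x ^ i * y ^ l))" using ij by simp
      finally show ?thesis using B(2)[OF ij(3)] by (simp add: sum_distrib_left mult_ac)
    qed
    have "(x + y) * v ij = (x * x ^ i) * y ^ j + x ^ i * (y * y ^ j)"
      by (simp add: v_def ij algebra_simps)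
    also have "\<dots> = (\<Sum>k<n. \<Sum>l<m. of_int ((if l = j then A i k else 0)
        + (if k = i then B j l else 0)) * (x ^ k * y ^ l))"
      by (simp only: 1[symmetric] 2[symmetric] of_int_add distrib_right sum.distrib)
    also have "\<dots> = (\<Sum>kl\<in>?I. of_int ((\<lambda>(i,j) (k,l). (if l = j then A i k else 0)
        + (if k = i then B j l else 0)) ij kl) * v kl)"
      unfolding sum.cartesian_product by (rule sum.cong) (auto simp: ij v_def)
    finally show "(x + y) * v ij = \<dots>" .
  qed
qed

lemma algebraic_int_power: "algebraic_int (x::complex) \<Longrightarrow> algebraic_int (x ^ n)"
  by (induction n) (auto intro: algebraic_int_mult)

lemma algebraic_int_of_power:
  fixes x :: complex
  assumes "algebraic_int (x ^ n)" "0 < n"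
  shows "algebraic_int x"
  by (rule algebraic_int_root[OF assms(1), where p = "monom 1 n"])
    (use assms(2) in \<open>auto simp: poly_monom degree_monom_eq\<close>)

text \<open>Integrality of \<open>u\<close> in \<open>m = d u\<close> turns an identity between complex numbers into a divisibility.\<close>
lemma dvd_of_algebraic_int:
  fixes u :: complex and d m :: int
  assumes "algebraic_int u" "of_int m = of_int d * u"
  shows "d dvd m"
proof (cases "d = 0")
  case True
  then show ?thesis using assms(2) by simp
next
  case False
  then have "u = of_int m / of_int d" using assms(2) by (simp add: field_simps)
  then have "u \<in> \<rat>" by simp
  then obtain i where "u = of_int i"
    using rational_algebraic_int_is_int[OF assms(1)] by (auto elim: Ints_cases)
  then have "(of_int m :: complex) = of_int (d * i)" using assms(2) by simp
  then show ?thesis unfolding of_int_eq_iff by simp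
qed

text \<open>A triangular Schur form carries the roots of the characteristic polynomial on its
  diagonal, and similar matrices have equal trace. The list accounts for multiplicities; each entry
  comes with some eigenvector.\<close>

lemma trace_eq_sum_eigenvalues:
  fixes A :: "'c \<Rightarrow> 'c \<Rightarrow> complex"
  assumes R: "finite R"
  shows "\<exists>zs. (\<Sum>x\<in>R. A x x) = sum_list zs \<and>
    (\<forall>z\<in>set zs. \<exists>v. (\<exists>x\<in>R. v x \<noteq> 0) \<and> (\<forall>x\<in>R. (\<Sum>y\<in>R. A x y * v y) = z * v x))"
proof -
  define n where "n = card R"
  obtain h where h: "bij_betw h {..<n} R"
    using ex_bij_betw_nat_finite[OF R] by (auto simp: lessThan_atLeast0 n_def)
  define M where "M = mat n n (\<lambda>(i,j). A (h i) (h j))"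
  have M: "M \<in> carrier_mat n n" by (simp add: M_def)
  obtain zs where zs: "char_poly M = (\<Prod>a\<leftarrow>zs. [:- a, 1:])" "length zs = n"
    using char_poly_factorized[OF M] by blast
  obtain B P Q where BPQ: "schur_decomposition M zs = (B,P,Q)" by (metis prod_cases3)
  have sim: "similar_mat_wit M B P Q" and diag: "diag_mat B = zs"
    using schur_decomposition[OF M zs(1) BPQ] by auto
  from similar_mat_witD2[OF M sim]
  have PQ: "P \<in> carrier_mat n n" "Q \<in> carrier_mat n n" "B \<in> carrier_mat n n"
    "Q * P = 1\<^sub>m n" "M = P * B * Q" by auto
  have trace_comm: "(\<Sum>i<n. (C * D) $$ (i,i)) = (\<Sum>i<n. (D * C) $$ (i,i))"
    if "C \<in> carrier_mat n n" "D \<in> carrier_mat n n" for C D :: "complex mat"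
  proof -
    have "(\<Sum>i<n. (C * D) $$ (i,i)) = (\<Sum>i<n. \<Sum>j<n. C $$ (i,j) * D $$ (j,i))"
      using that by (auto simp: scalar_prod_def lessThan_atLeast0 intro!: sum.cong)
    also have "\<dots> = (\<Sum>j<n. \<Sum>i<n. D $$ (j,i) * C $$ (i,j))"
      by (subst sum.swap) (simp add: mult.commute)
    also have "\<dots> = (\<Sum>i<n. (D * C) $$ (i,i))"
      using that by (auto simp: scalar_prod_def lessThan_atLeast0 intro!: sum.cong)
    finally show ?thesis .
  qed
  have "(\<Sum>x\<in>R. A x x) = (\<Sum>i<n. A (h i) (h i))"
    using sum.reindex_bij_betw[OF h, of "\<lambda>x. A x x"] by simp
  also have "\<dots> = (\<Sum>i<n. M $$ (i,i))" by (simp add: M_def)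
  also have "\<dots> = (\<Sum>i<n. (Q * (P * B)) $$ (i,i))"
    using PQ trace_comm[of "P * B" Q] by simp
  also have "Q * (P * B) = B" using PQ assoc_mult_mat[of Q n n P n B n] left_mult_one_mat[of B n n] by simp
  also have "(\<Sum>i<n. B $$ (i,i)) = sum_list zs"
    using diag PQ(3) unfolding diag_mat_def
    by (metis carrier_matD(1) interv_sum_list_conv_sum_set_nat lessThan_atLeast0 set_upt)
  finally have tr: "(\<Sum>x\<in>R. A x x) = sum_list zs" .
  have "\<exists>v. (\<exists>x\<in>R. v x \<noteq> 0) \<and> (\<forall>x\<in>R. (\<Sum>y\<in>R. A x y * v y) = z * v x)" if z: "z \<in> set zs" for z
  proof -
    have "poly (char_poly M) z = 0"
      unfolding zs(1) poly_prod_list using z by (auto simp: prod_list_zero_iff image_iff)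
    then have "eigenvalue M z" using eigenvalue_root_char_poly[OF M] by simp
    then obtain w where w: "w \<in> carrier_vec n" "w \<noteq> 0\<^sub>v n" "M *\<^sub>v w = z \<cdot>\<^sub>v w"
      using M unfolding eigenvalue_def eigenvector_def by auto
    define g where "g = the_inv_into {..<n} h"
    have g: "g (h i) = i" if "i < n" for i
      unfolding g_def using the_inv_into_f_f[of h "{..<n}" i] h that by (auto simp: bij_betw_def)
    have hR: "h i \<in> R" if "i < n" for i using h that bij_betwE by blast
    have gR: "g x < n" "h (g x) = x" if "x \<in> R" for x
      using that h g unfolding bij_betw_def by auto
    show ?thesis
    proof (intro exI[of _ "\<lambda>x. w $ g x"] conjI ballI)
      obtain i where i: "i < n" "w $ i \<noteq> 0"
        using w(1,2) by (metis carrier_vecD eq_vecI index_zero_vec)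
      then show "\<exists>x\<in>R. w $ g x \<noteq> 0" using hR g by (intro bexI[of _ "h i"]) auto
      fix x assume x: "x \<in> R"
      have "(\<Sum>y\<in>R. A x y * w $ g y) = (\<Sum>j<n. A x (h j) * w $ g (h j))"
        using sum.reindex_bij_betw[OF h, of "\<lambda>y. A x y * w $ g y"] by simp
      also have "\<dots> = (\<Sum>j<n. M $$ (g x, j) * w $ j)"
        using gR[OF x] by (intro sum.cong) (auto simp: M_def g)
      also have "\<dots> = (M *\<^sub>v w) $ g x"
        using gR[OF x] M w(1) by (auto simp: scalar_prod_def lessThan_atLeast0 intro!: sum.cong)
      also have "\<dots> = z * w $ g x" using gR[OF x] w by simp
      finally show "(\<Sum>y\<in>R. A x y * w $ g y) = z * w $ g x" .
    qed
  qed
  then show ?thesis using tr by (intro exI[of _ zs] conjI ballI)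
qed

section \<open>Divisibility conditions without coprime solutions\<close>

text \<open>The quotient \<open>(x + 1)^2 / x^3\<close> is at most \<open>9/8\<close> for
  \<open>x >= 2\<close> and at most \<open>16/27\<close> for \<open>x >= 3\<close>. Coprimality
  excludes \<open>a = b = 2\<close>, and the product of the two bounds is \<open>2/3\<close>, so the
  divisor would exceed the dividend.\<close>

lemma no_dvd_power_large:
  fixes a b j :: nat
  assumes ab: "2 \<le> a" "2 \<le> b" "coprime a b" and j: "3 \<le> j"
  shows "\<not> (a * b) ^ j dvd ((a + 1) * (b + 1))\<^sup>2"
proof
  assume d: "(a * b) ^ j dvd ((a + 1) * (b + 1))\<^sup>2"
  have "(a * b) ^ 3 dvd ((a + 1) * (b + 1))\<^sup>2"
    using d j dvd_trans[OF le_imp_power_dvd] by blast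
  then have le: "(a * b) ^ 3 \<le> ((a + 1) * (b + 1))\<^sup>2" by (rule dvd_imp_le) simp
  have weak: "8 * (x + 1)\<^sup>2 \<le> 9 * x ^ 3" if "2 \<le> x" for x :: nat
  proof -
    define y where "y = x - 2"
    then have "x = y + 2" using that by simp
    then show ?thesis by (simp add: power2_eq_square power3_eq_cube algebra_simps)
  qed
  have strong: "27 * (x + 1)\<^sup>2 \<le> 16 * x ^ 3" if "3 \<le> x" for x :: nat
  proof -
    define y where "y = x - 3"
    then have "x = y + 3" using that by simp
    then show ?thesis by (simp add: power2_eq_square power3_eq_cube algebra_simps)
  qed
  have main: False
    if "2 \<le> x" "3 \<le> y" "(x * y) ^ 3 \<le> ((x + 1) * (y + 1))\<^sup>2" for x y :: nat
  proof -
    have "(8 * (x + 1)\<^sup>2) * (27 * (y + 1)\<^sup>2) \<le> (9 * x ^ 3) * (16 * y ^ 3)"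
      using weak[OF that(1)] strong[OF that(2)] by (rule mult_le_mono)
    then have "216 * ((x + 1) * (y + 1))\<^sup>2 \<le> 144 * (x * y) ^ 3"
      by (simp only: power_mult_distrib)
    also have "\<dots> \<le> 144 * ((x + 1) * (y + 1))\<^sup>2" using that(3) by simp
    finally show False by simp
  qed
  have "a \<noteq> 2 \<or> b \<noteq> 2" using ab(3) by auto
  then consider "3 \<le> a" | "3 \<le> b" using ab by linarith
  then show False
    using main[of a b] main[of b a] ab le by cases (auto simp: mult.commute)
qed

text \<open>Vieta jumping: \<open>(u, v)\<close> with \<open>u < v\<close> is replaced by \<open>(c u - v, u)\<close>.\<close>
lemma vieta_three:
  fixes u v c :: nat
  assumes "0 < u" "u \<le> v" "u\<^sup>2 + v\<^sup>2 + 1 = c * (u * v)"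
  shows "c = 3"
  using assms
proof (induction v arbitrary: u rule: less_induct)
  case (less v)
  show ?case
  proof (cases "u = v")
    case True
    then have eq: "2 * u\<^sup>2 + 1 = c * u\<^sup>2" using less.prems by (simp add: power2_eq_square)
    then have "u\<^sup>2 dvd 2 * u\<^sup>2 + 1" by simp
    then have "u\<^sup>2 dvd 1" using dvd_add_right_iff[of "u\<^sup>2" "2 * u\<^sup>2" 1] by simp
    then show ?thesis using eq by simp
  next
    case False
    then have uv: "u < v" using less.prems by simp
    define w where "w = c * u - v"
    have "v * v < c * (u * v)"
      unfolding less.prems(3)[symmetric] by (simp add: power2_eq_square)
    then have "v * v < (c * u) * v" by (simp only: mult.assoc)
    then have "v < c * u" by (simp only: mult_less_cancel2)
    then have w: "c * u = v + w" "0 < w" by (auto simp: w_def)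
    have "u\<^sup>2 + v\<^sup>2 + 1 = (v + w) * v"
      unfolding w(1)[symmetric] less.prems(3) by (simp only: mult.assoc)
    then have wv: "w * v = u\<^sup>2 + 1" by (simp add: power2_eq_square algebra_simps)
    have wu: "w \<le> u"
    proof (rule ccontr)
      assume "\<not> w \<le> u"
      then have "(u + 1) * (u + 1) \<le> w * v" using uv by (intro mult_mono) auto
      then show False using wv less.prems(1) by (simp add: power2_eq_square)
    qed
    have "w\<^sup>2 + u\<^sup>2 + 1 = w * (w + v)" using wv by (simp add: power2_eq_square algebra_simps)
    also have "w + v = c * u" using w(1) by simp
    also have "w * (c * u) = c * (w * u)" by (simp only: mult.left_commute)
    finally show ?thesis using less.IH[OF uv w(2) wu] by simp
  qed
qed

lemma vieta_three':
  fixes u v :: nat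
  assumes "0 < u" "0 < v" "u * v dvd u\<^sup>2 + v\<^sup>2 + 1"
  shows "u\<^sup>2 + v\<^sup>2 + 1 = 3 * (u * v)"
proof -
  obtain c where "u\<^sup>2 + v\<^sup>2 + 1 = (u * v) * c" using assms(3) by (elim dvdE)
  then have c: "u\<^sup>2 + v\<^sup>2 + 1 = c * (u * v)" unfolding mult.commute[of c] .
  have c': "v\<^sup>2 + u\<^sup>2 + 1 = c * (v * u)" unfolding mult.commute[of v u] add.commute[of "v\<^sup>2"] by (rule c)
  have "c = 3"
  proof (cases "u \<le> v")
    case True
    then show ?thesis using vieta_three[OF assms(1) _ c] by blast
  next
    case False
    then show ?thesis using vieta_three[OF assms(2) _ c'] by simp
  qed
  then show ?thesis using c by simp
qed

text \<open>Coprime factors of a square are squares, \<open>a = U^2\<close> and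
  \<open>b = V^2\<close>. As \<open>U V\<close> is prime to the last factor, it divides
  \<open>U^2 + V^2 + 1\<close>, and Vieta jumping makes this \<open>3 U V\<close>. Then everything
  is a polynomial in \<open>x = U V\<close>, and the divisibility leaves only \<open>x = 11\<close>,
  which is prime.\<close>

lemma no_dvd_hexagon:
  fixes a b r :: int
  assumes ab: "2 \<le> a" "2 \<le> b" "coprime a b" and r: "0 \<le> r" "r\<^sup>2 = a * b"
  shows "\<not> 2 * r * (a + b - r) dvd (a + 1) * (b + 1) * (1 + a * b - r)"
proof
  assume d: "2 * r * (a + b - r) dvd (a + 1) * (b + 1) * (1 + a * b - r)"
  obtain A B where AB: "a = int A" "b = int B"
    using nonneg_int_cases[of a] nonneg_int_cases[of b] ab(1,2) by force
  obtain q where q: "r = int q" using r(1) nonneg_int_cases by blast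
  have AB0: "0 < A" "0 < B" using ab(1,2) AB by linarith+
  have cop: "coprime A B" using ab(3) unfolding AB coprime_int_iff .
  have "int (q\<^sup>2) = int (A * B)" using r(2) unfolding AB q of_nat_power of_nat_mult .
  then have qq: "q\<^sup>2 = A * B" by (simp only: of_nat_eq_iff)
  have nth: "is_nth_power 2 (A * B)" unfolding is_nth_power_def by (rule exI[where x = q], rule qq[symmetric])
  have "is_nth_power 2 A" by (rule is_nth_power_mult_coprime_natD(1)[OF cop nth AB0])
  moreover have "is_nth_power 2 B" by (rule is_nth_power_mult_coprime_natD(2)[OF cop nth AB0])
  ultimately obtain u v where uv: "A = u\<^sup>2" "B = v\<^sup>2" unfolding is_nth_power_def by blast
  have uv2: "2 \<le> u" "2 \<le> v"
  proof -
    have "x \<noteq> 0 \<and> x \<noteq> 1" if "2 \<le> int (x\<^sup>2)" for x :: nat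
      using that by (intro conjI notI) simp_all
    then have "u \<noteq> 0 \<and> u \<noteq> 1" "v \<noteq> 0 \<and> v \<noteq> 1" using ab(1,2) unfolding AB uv by blast+
    then show "2 \<le> u" "2 \<le> v" by simp_all
  qed
  have copuv: "coprime u v" using cop uv by (simp add: coprime_power_left_iff coprime_power_right_iff)
  have "q = u * v"
    using qq uv power_eq_iff_eq_base[of 2 q "u * v"] by (simp add: power_mult_distrib)
  then have r': "r = int u * int v" using q by simp
  define U V where "U = int u" and "V = int v"
  have aUV: "a = U\<^sup>2" "b = V\<^sup>2" "r = U * V"
    using AB uv r' by (auto simp: U_def V_def)
  define D where "D = U\<^sup>2 + V\<^sup>2 - U * V"
  define N where "N = (U\<^sup>2 + 1) * (V\<^sup>2 + 1)"
  define F where "F = 1 + U\<^sup>2 * V\<^sup>2 - U * V"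
  have dv: "2 * (U * V) * D dvd N * F"
    using d unfolding aUV D_def N_def F_def .
  have copU: "coprime U V" using copuv by (simp add: U_def V_def)
  have "coprime (U * V) F"
  proof -
    have 1: "1 = F - (U * V) * (U * V - 1)" by (simp add: F_def power2_eq_square algebra_simps)
    show ?thesis
    proof (rule coprimeI)
      fix c assume "c dvd U * V" "c dvd F"
      then show "is_unit c" by (subst 1) (rule dvd_diff[OF _ dvd_mult2])
    qed
  qed
  moreover have "U * V dvd N * F" by (rule dvd_trans[OF _ dv]) simp
  ultimately have "U * V dvd N" using coprime_dvd_mult_left_iff by blast
  moreover have "N = (U\<^sup>2 + V\<^sup>2 + 1) + U * V * (U * V)"
    by (simp add: N_def power2_eq_square algebra_simps)
  ultimately have "U * V dvd U\<^sup>2 + V\<^sup>2 + 1"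
    using dvd_add_left_iff[of "U * V" "U * V * (U * V)"] by simp
  then have "int (u * v) dvd int (u\<^sup>2 + v\<^sup>2 + 1)" by (simp add: U_def V_def add_ac)
  then have "u * v dvd u\<^sup>2 + v\<^sup>2 + 1" by (simp only: int_dvd_int_iff)
  then have "u\<^sup>2 + v\<^sup>2 + 1 = 3 * (u * v)" using vieta_three' uv2 by simp
  then have "int (u\<^sup>2 + v\<^sup>2 + 1) = int (3 * (u * v))" by (rule arg_cong)
  then have vi: "U\<^sup>2 + V\<^sup>2 + 1 = 3 * (U * V)" by (simp add: U_def V_def)
  define x where "x = U * V"
  have Dx: "D = 2 * x - 1" using vi by (simp add: D_def x_def)
  have Nx: "N = x * (x + 3)"
    using vi by (simp add: N_def x_def power2_eq_square algebra_simps)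
  have Fx: "F = x * x - x + 1" by (simp add: F_def x_def power2_eq_square algebra_simps)
  have x0: "x \<noteq> 0" using uv2 by (auto simp: x_def U_def V_def)
  have dvx: "2 * x * (2 * x - 1) dvd x * (x + 3) * (x * x - x + 1)"
    using dv unfolding Dx Nx Fx x_def[symmetric] .
  have "x * 2 dvd 2 * x * (2 * x - 1)" by simp
  from dvd_trans[OF this dvx] have "x * 2 dvd x * ((x + 3) * (x * x - x + 1))"
    by (simp only: mult.assoc)
  then have "2 dvd (x + 3) * (x * x - x + 1)" using x0 by simp
  then have odd: "odd x" by auto
  \<comment> \<open>At the root \<open>x = 1/2\<close> of \<open>2 * x - 1\<close> the quartic has
    the value \<open>21/16\<close>; the factor \<open>16\<close> clears denominators and
    \<open>21\<close> is the remainder.\<close>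
  have "2 * x - 1 dvd 16 * (x * (x + 3) * (x * x - x + 1))"
    by (rule dvd_mult, rule dvd_trans[OF _ dvx]) simp
  moreover have "16 * (x * (x + 3) * (x * x - x + 1)) =
      (2 * x - 1) * (8 * (x * x * x) + 20 * (x * x) - 6 * x + 21) + 21"
    by (simp add: algebra_simps)
  ultimately have d21: "2 * x - 1 dvd 21" using dvd_add_right_iff[of "2 * x - 1"] by (metis dvd_triv_left)
  have "U * V \<ge> 2 * 2" unfolding U_def V_def using uv2 by (intro mult_mono) auto
  then have x4: "4 \<le> x" by (simp add: x_def)
  have "2 * x - 1 \<le> 21" using d21 by (rule zdvd_imp_le) simp
  then have "x \<in> {4..11}" using x4 by simp
  also have "{4..11} = {4,5,6,7,8,9,10,11::int}" by auto
  finally have "x = 11" using d21 odd by auto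
  then have "int (u * v) = int 11" by (simp add: x_def U_def V_def)
  then have uv11: "u * v = 11" by (simp only: of_nat_eq_iff)
  then have "u dvd 11" by (metis dvd_triv_left)
  then have "u \<le> 11" by (rule dvd_imp_le) simp
  then have "u = 2 \<or> u = 3 \<or> u = 4 \<or> u = 5 \<or> u = 6 \<or> u = 7 \<or> u = 8 \<or> u = 9 \<or> u = 10 \<or> u = 11"
    using uv2 by presburger
  then have "u = 11" using \<open>u dvd 11\<close> by auto
  then show False using uv11 uv2 by simp
qed

text \<open>Reduction modulo \<open>a b\<close> gives \<open>a b\<close> dividing
  \<open>a + b + 1\<close>, which is too small unless the pair is \<open>{2, 3}\<close>; there
  \<open>60\<close> would have to divide \<open>444\<close>.\<close>

lemma no_dvd_octagon:
  fixes a b :: nat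
  assumes ab: "2 \<le> a" "2 \<le> b" "coprime a b"
  shows "\<not> 2 * a * b * (a + b) dvd (a + 1) * (b + 1) * (1 + a\<^sup>2 * b\<^sup>2)"
proof
  assume d: "2 * a * b * (a + b) dvd (a + 1) * (b + 1) * (1 + a\<^sup>2 * b\<^sup>2)"
  have "a * b dvd 2 * a * b * (a + b)" by simp
  from dvd_trans[OF this d] have d2: "a * b dvd (a + 1) * (b + 1) * (1 + a\<^sup>2 * b\<^sup>2)" .
  have cop: "coprime (a * b) (1 + a\<^sup>2 * b\<^sup>2)"
  proof (rule coprimeI)
    fix c assume c: "c dvd a * b" "c dvd 1 + a\<^sup>2 * b\<^sup>2"
    have "a\<^sup>2 * b\<^sup>2 = (a * b) * (a * b)" by (simp add: power2_eq_square mult_ac)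
    then have "c dvd a\<^sup>2 * b\<^sup>2" using c(1) by (metis dvd_mult2)
    then show "is_unit c" using c(2) dvd_add_left_iff[of c "a\<^sup>2 * b\<^sup>2" 1] by simp
  qed
  have "a * b dvd (a + 1) * (b + 1)" using d2 unfolding coprime_dvd_mult_left_iff[OF cop] .
  then have "a * b dvd a * b + (a + b + 1)" by (simp add: algebra_simps)
  then have dv: "a * b dvd a + b + 1" using dvd_add_right_iff[of "a * b" "a * b" "a + b + 1"] by simp
  then have le: "a * b \<le> a + b + 1" by (rule dvd_imp_le) simp
  have main: "x = 2 \<and> y = 3" if "2 \<le> x" "x < y" "x * y \<le> x + y + 1" for x y :: nat
  proof -
    define u v where "u = x - 2" and "v = y - 3"
    then have "x = u + 2" "y = v + 3" using that by simp_all
    have "(u + 2) * (v + 3) \<le> (u + 2) + (v + 3) + 1"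
      using that(3) by (simp only: \<open>x = u + 2\<close> \<open>y = v + 3\<close>)
    then have "u * v + 2 * u + v = 0" by (simp add: algebra_simps)
    then show ?thesis using \<open>x = u + 2\<close> \<open>y = v + 3\<close> by simp
  qed
  have "a \<noteq> b" using ab(1,3) by (metis coprime_self nat_dvd_1_iff_1 numeral_le_one_iff semiring_norm(69))
  then consider "a < b" | "b < a" by linarith
  then have "(a = 2 \<and> b = 3) \<or> (a = 3 \<and> b = 2)"
  proof cases
    case 1
    then show ?thesis using main[OF ab(1) 1 le] by simp
  next
    case 2
    have "b * a \<le> b + a + 1" using le unfolding mult.commute[of b] add.commute[of b] .
    then show ?thesis using main[OF ab(2) 2] by simp
  qed
  then show False
  proof (elim disjE conjE)
    assume "a = 2" "b = 3"
    have "2 * a * b * (a + b) = 60" by (simp add: \<open>a = 2\<close> \<open>b = 3\<close>)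
    moreover have "(a + 1) * (b + 1) * (1 + a\<^sup>2 * b\<^sup>2) = 444" by (simp add: \<open>a = 2\<close> \<open>b = 3\<close>)
    ultimately obtain k :: nat where "444 = 60 * k" using d unfolding dvd_def by metis
    moreover have "k \<le> 7 \<or> 8 \<le> k" by linarith
    ultimately show False by linarith
  next
    assume "a = 3" "b = 2"
    have "2 * a * b * (a + b) = 60" by (simp add: \<open>a = 3\<close> \<open>b = 2\<close>)
    moreover have "(a + 1) * (b + 1) * (1 + a\<^sup>2 * b\<^sup>2) = 444" by (simp add: \<open>a = 3\<close> \<open>b = 2\<close>)
    ultimately obtain k :: nat where "444 = 60 * k" using d unfolding dvd_def by metis
    moreover have "k \<le> 7 \<or> 8 \<le> k" by linarith
    ultimately show False by linarith
  qed
qed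

section \<open>Linear operators on functions with finite support\<close>

declare zero_fun_def [simp del] plus_fun_def [simp del]

definition scl :: "complex \<Rightarrow> ('c \<Rightarrow> complex) \<Rightarrow> 'c \<Rightarrow> complex" where
  "scl k f = (\<lambda>x. k * f x)"

definition lin :: "(('c \<Rightarrow> complex) \<Rightarrow> ('c \<Rightarrow> complex)) \<Rightarrow> bool" where
  "lin T \<longleftrightarrow> (\<forall>f g. T (f + g) = T f + T g) \<and> (\<forall>k f. T (scl k f) = scl k (T f))"

definition ind :: "'c \<Rightarrow> 'c \<Rightarrow> complex" where
  "ind x = (\<lambda>y. if y = x then 1 else 0)"

text \<open>The finite-dimensional space of functions on \<open>R\<close>, realised by total
  functions vanishing outside \<open>R\<close>; operator identities are asked for on this space
  only.\<close>

definition supp :: "'c set \<Rightarrow> ('c \<Rightarrow> complex) set" where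
  "supp R = {f. \<forall>x. x \<notin> R \<longrightarrow> f x = 0}"

definition tr :: "'c set \<Rightarrow> (('c \<Rightarrow> complex) \<Rightarrow> ('c \<Rightarrow> complex)) \<Rightarrow> complex" where
  "tr R T = (\<Sum>x\<in>R. T (ind x) x)"

text \<open>The all-one matrix \<open>J\<close>. Its kernel on \<open>supp R\<close> consists of the
  functions with sum zero, its image of the constants.\<close>

definition allsum :: "'c set \<Rightarrow> ('c \<Rightarrow> complex) \<Rightarrow> 'c \<Rightarrow> complex" where
  "allsum R f = (\<lambda>x. if x \<in> R then \<Sum>y\<in>R. f y else 0)"

lemma scl_simps:
  "scl k (f + g) = scl k f + scl k g" "scl k (f - g) = scl k f - scl k g"
  "scl (k + l) f = scl k f + scl l f" "scl (k - l) f = scl k f - scl l f"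
  "scl k (scl l f) = scl (k * l) f" "scl 1 f = f" "scl 0 f = 0" "scl k 0 = 0"
  "scl (- k) f = - scl k f" "scl k (- f) = - scl k f"
  by (auto simp: scl_def fun_eq_iff algebra_simps)

lemma scl_eq_0_iff [simp]: "scl k f = 0 \<longleftrightarrow> k = 0 \<or> f = 0"
  by (auto simp: scl_def fun_eq_iff)

lemma linD: "lin T \<Longrightarrow> T (f + g) = T f + T g" "lin T \<Longrightarrow> T (scl k f) = scl k (T f)"
  by (auto simp: lin_def)

lemma lin_0: "lin T \<Longrightarrow> T 0 = 0"
  using linD(2)[of T 0 0] by (simp add: scl_simps)

lemma lin_minus: "lin T \<Longrightarrow> T (- f) = - T f"
  using linD(2)[of T "-1" f] by (simp add: scl_simps)

lemma lin_diff: "lin T \<Longrightarrow> T (f - g) = T f - T g"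
  using linD(1)[of T f "- g"] lin_minus[of T g] by simp

lemma lin_sum: "lin T \<Longrightarrow> T (\<Sum>i\<in>I. f i) = (\<Sum>i\<in>I. T (f i))"
  by (induction I rule: infinite_finite_induct) (simp_all add: lin_0[of T] linD[of T])

lemma lin_intros:
  "lin (\<lambda>f. f)" "lin T \<Longrightarrow> lin U \<Longrightarrow> lin (\<lambda>f. T (U f))"
  "lin T \<Longrightarrow> lin U \<Longrightarrow> lin (\<lambda>f. T f + U f)" "lin T \<Longrightarrow> lin U \<Longrightarrow> lin (\<lambda>f. T f - U f)"
  "lin T \<Longrightarrow> lin (\<lambda>f. scl k (T f))" "lin (\<lambda>f. 0)"
  by (auto simp: lin_def scl_simps algebra_simps)

lemma lin_funpow: "lin T \<Longrightarrow> lin (\<lambda>f. (T ^^ i) f)"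
  by (induction i) (auto simp: lin_def)

lemma lin_allsum: "lin (allsum R)"
  by (auto simp: lin_def allsum_def scl_def fun_eq_iff sum.distrib sum_distrib_left)

lemma supp_intros:
  "0 \<in> supp R" "f \<in> supp R \<Longrightarrow> g \<in> supp R \<Longrightarrow> f + g \<in> supp R"
  "f \<in> supp R \<Longrightarrow> g \<in> supp R \<Longrightarrow> f - g \<in> supp R" "f \<in> supp R \<Longrightarrow> scl k f \<in> supp R"
  "x \<in> R \<Longrightarrow> ind x \<in> supp R" "allsum R f \<in> supp R"
  by (auto simp: supp_def scl_def ind_def allsum_def)

lemma lin_expand:
  assumes "lin T" "finite R" "f \<in> supp R"
  shows "T f x = (\<Sum>y\<in>R. T (ind y) x * f y)"
proof -
  have ev: "(\<Sum>i\<in>I. g i) x = (\<Sum>i\<in>I. g i x)" for g :: "'b \<Rightarrow> 'b \<Rightarrow> complex" and I x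
    by (induction I rule: infinite_finite_induct) auto
  have "f z = (\<Sum>y\<in>R. scl (f y) (ind y)) z" for z
    using assms(2,3) by (auto simp: ev scl_def ind_def supp_def if_distrib[of "\<lambda>t. _ * t"] cong: if_cong)
  then have "f = (\<Sum>y\<in>R. scl (f y) (ind y))" by (rule ext)
  then have "T f = (\<Sum>y\<in>R. T (scl (f y) (ind y)))" using lin_sum[OF assms(1)] by metis
  then show ?thesis using linD(2)[OF assms(1)] by (simp add: ev scl_def mult.commute)
qed

lemma tr_simps:
  "tr R (\<lambda>f. T f + U f) = tr R T + tr R U"
  "tr R (\<lambda>f. T f - U f) = tr R T - tr R U"
  "tr R (\<lambda>f. scl k (T f)) = k * tr R T"
  "tr R (\<lambda>f. 0) = 0"
  by (simp_all add: tr_def sum.distrib sum_subtractf sum_distrib_left scl_def)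

lemma tr_cong: "(\<And>f. f \<in> supp R \<Longrightarrow> T f = U f) \<Longrightarrow> tr R T = tr R U"
  unfolding tr_def by (intro sum.cong) (auto simp: supp_intros)

text \<open>\<open>pop T p\<close> is \<open>p(T)\<close>.\<close>
definition pop :: "(('c \<Rightarrow> complex) \<Rightarrow> ('c \<Rightarrow> complex)) \<Rightarrow> complex poly \<Rightarrow> ('c \<Rightarrow> complex) \<Rightarrow> ('c \<Rightarrow> complex)"
  where "pop T p = fold_coeffs (\<lambda>k g f. scl k f + T (g f)) p (\<lambda>f. 0)"

lemma pop_0 [simp]: "pop T 0 f = 0"
  by (simp add: pop_def)

lemma pop_pCons: "lin T \<Longrightarrow> pop T (pCons k p) f = scl k f + T (pop T p f)"
  by (cases "k = 0 \<and> p = 0") (auto simp: pop_def lin_0[of T] scl_simps)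

lemma lin_pop: "lin T \<Longrightarrow> lin (pop T p)"
  by (induction p) (simp_all add: lin_def pop_pCons[unfolded lin_def] scl_simps add_ac mult.commute)

lemma pop_add: "lin T \<Longrightarrow> pop T (p + q) f = pop T p f + pop T q f"
  by (induction p q rule: poly_induct2) (simp_all add: pop_pCons linD[of T] scl_simps algebra_simps)

lemma pop_smult: "lin T \<Longrightarrow> pop T (smult k p) f = scl k (pop T p f)"
  by (induction p) (simp_all add: pop_pCons linD[of T] scl_simps)

lemma pop_mult: "lin T \<Longrightarrow> pop T (p * q) f = pop T p (pop T q f)"
  by (induction p) (simp_all add: pop_pCons pop_add pop_smult scl_simps)

text \<open>Commutation is available only on the subspace \<open>V\<close>, so the induction has to
  carry the invariance of \<open>V\<close> along. With \<open>U = T\<close> it yields that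
  invariance alone.\<close>

lemma pop_comm:
  assumes "lin T" "lin U" "\<And>f. f \<in> V \<Longrightarrow> U (T f) = T (U f)" "\<And>f. f \<in> V \<Longrightarrow> T f \<in> V"
    "0 \<in> V" "\<And>f g. f \<in> V \<Longrightarrow> g \<in> V \<Longrightarrow> f + g \<in> V" "\<And>k f. f \<in> V \<Longrightarrow> scl k f \<in> V" "f \<in> V"
  shows "pop T p f \<in> V \<and> U (pop T p f) = pop T p (U f)"
  using assms(8) by (induction p) (simp_all add: assms(1,3-8) pop_pCons linD[OF assms(2)] lin_0[OF assms(2)])

lemma pop_power: "lin T \<Longrightarrow> pop T (p ^ i) f = (pop T p ^^ i) f"
  by (induction i arbitrary: f)
    (simp_all add: one_pCons pop_pCons scl_simps lin_0[of T] pop_mult)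

text \<open>Split off linear factors of \<open>q\<close> one at a time: when the remaining cofactor
  no longer annihilates \<open>v\<close>, it turns \<open>v\<close> into an eigenvector for the root
  just removed. The vector stays in the invariant subspace \<open>V\<close>.\<close>

lemma eigenvector_of_annihilating_poly:
  assumes T: "lin T" and V: "\<And>f. f \<in> V \<Longrightarrow> T f \<in> V" "0 \<in> V"
      "\<And>f g. f \<in> V \<Longrightarrow> g \<in> V \<Longrightarrow> f + g \<in> V" "\<And>k f. f \<in> V \<Longrightarrow> scl k f \<in> V"
    and "v \<noteq> 0" "v \<in> V" and "q \<noteq> 0" "pop T q v = 0"
  shows "\<exists>m w. poly q m = 0 \<and> w \<noteq> 0 \<and> w \<in> V \<and> T w = scl m w"
  using assms(8,9)
proof (induction "Polynomial.degree q" arbitrary: q)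
  case 0
  then obtain k where k: "q = [:k:]" using degree_eq_zeroE by metis
  then have "scl k v = 0" using 0(3) by (simp only: k pop_pCons[OF T] pop_0 lin_0[OF T] add_0_right)
  then show ?case using k 0(2) assms(6) by simp
next
  case (Suc d)
  then obtain m where m: "poly q m = 0"
    using fundamental_theorem_of_algebra[of q] constant_degree[of q] by auto
  then obtain q1 where q1: "q = [:-m, 1:] * q1" using poly_eq_0_iff_dvd by (metis dvdE)
  have q10: "q1 \<noteq> 0" using q1 Suc.prems by auto
  have deg: "d = Polynomial.degree q1"
    using Suc.hyps(2) q10 unfolding q1 by (subst (asm) degree_mult_eq) auto
  let ?w = "pop T q1 v"
  show ?case
  proof (cases "?w = 0")
    case True
    then show ?thesis using Suc.hyps(1)[OF deg q10 True] q1 by auto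
  next
    case False
    have "pop T [:-m, 1:] ?w = 0" using Suc.prems(2) unfolding q1 pop_mult[OF T] .
    then have "T ?w = scl m ?w"
      using T by (simp add: pop_pCons scl_simps lin_0[of T] add_eq_0_iff)
    moreover have "?w \<in> V"
      using pop_comm[OF T T HOL.refl V assms(7)] by blast
    ultimately show ?thesis using m False by blast
  qed
qed

section \<open>The Hecke algebra of a generalised polygon\<close>

text \<open>For \<open>f = 1\<close> these are the Chebyshev polynomials of the second kind,
  \<open>U_j(c/2)\<close>; general \<open>f\<close> is the homogeneous form, with \<open>c\<close>
  of weight one and \<open>f\<close> of weight two. The ring is left open so that both numbers and
  integer polynomials can be inserted.\<close>

fun cheb :: "'a::comm_ring_1 \<Rightarrow> 'a \<Rightarrow> nat \<Rightarrow> 'a" where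
  "cheb c f 0 = 1"
| "cheb c f (Suc 0) = c"
| "cheb c f (Suc (Suc j)) = c * cheb c f (Suc j) - f * cheb c f j"

lemma cheb_scale: "cheb (r * c) (r\<^sup>2) j = r ^ j * cheb c 1 j"
  by (induction c "1::'a" j rule: cheb.induct) (simp_all add: power2_eq_square algebra_simps)

lemma degree_monic_cheb:
  "Polynomial.degree (cheb [:0, 1:] 1 j :: int poly) = j \<and> lead_coeff (cheb [:0, 1:] 1 j :: int poly) = 1"
proof (induction "[:0, 1:] :: int poly" "1 :: int poly" j rule: cheb.induct)
  case (3 j)
  let ?p = "cheb [:0, 1:] 1 :: nat \<Rightarrow> int poly"
  have eq: "?p (Suc (Suc j)) = pCons 0 (?p (Suc j)) + (- ?p j)" by simp
  have nz: "?p (Suc j) \<noteq> 0" using 3 by (metis leading_coeff_0_iff zero_neq_one)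
  have deg: "Polynomial.degree (pCons 0 (?p (Suc j))) = Suc (Suc j)" using 3 nz by simp
  then have "Polynomial.degree (- ?p j) < Polynomial.degree (pCons 0 (?p (Suc j)))" using 3 by simp
  then have "Polynomial.degree (?p (Suc (Suc j))) = Suc (Suc j)"
    unfolding eq using deg by (simp only: degree_add_eq_left)
  moreover have "poly.coeff (?p (Suc (Suc j))) (Suc (Suc j)) = 1"
  proof -
    have "poly.coeff (?p (Suc j)) (Suc j) = 1" using 3(1) by metis
    then show ?thesis unfolding eq using 3(2) by (simp add: coeff_eq_0)
  qed
  ultimately show ?case by simp
qed auto

lemma poly_cheb:
  "poly (of_int_poly (cheb [:0, 1:] 1 j)) (z :: complex) = cheb z 1 j"
  by (induction "[:0, 1:] :: int poly" "1 :: int poly" j rule: cheb.induct)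
    (simp_all add: of_int_poly_hom.hom_minus of_int_poly_hom.hom_mult del: mult_pCons_left)

text \<open>Both expressions are monic integer polynomials in \<open>z\<close>. The first
  alternative belongs to even \<open>n\<close>, the second to odd \<open>n\<close>.\<close>

lemma algebraic_int_cheb_root:
  fixes z :: complex
  assumes "cheb z 1 (Suc j) = 0 \<or> cheb z 1 (Suc j) + cheb z 1 j = 0"
  shows "algebraic_int z"
proof -
  let ?p = "cheb [:0, 1:] 1 :: nat \<Rightarrow> int poly"
  have "Polynomial.degree (?p (Suc j) + ?p j) = Suc j"
    using degree_monic_cheb[of j] degree_monic_cheb[of "Suc j"] by (simp only: degree_add_eq_left)
  have sum: "lead_coeff (?p (Suc j) + ?p j) = 1"
  proof -
    have "poly.coeff (?p (Suc j)) (Suc j) = 1" using degree_monic_cheb[of "Suc j"] by metis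
    then show ?thesis
      unfolding \<open>Polynomial.degree (?p (Suc j) + ?p j) = Suc j\<close>
      using degree_monic_cheb[of j] by (simp add: coeff_eq_0)
  qed
  have "poly (of_int_poly (?p (Suc j) + ?p j)) z = cheb z 1 (Suc j) + cheb z 1 j"
    by (simp only: of_int_poly_hom.hom_add poly_add poly_cheb)
  then show ?thesis
    unfolding algebraic_int_altdef_ipoly
    using assms sum degree_monic_cheb[of "Suc j"] poly_cheb[of "Suc j" z] by metis
qed

lemma algebraic_int_cheb_homogeneous:
  fixes r c :: complex
  assumes "r \<noteq> 0" "cheb c (r\<^sup>2) (Suc j) = 0 \<or> cheb c (r\<^sup>2) (Suc j) + r * cheb c (r\<^sup>2) j = 0"
  obtains y where "c = r * y" "algebraic_int y"
proof -
  define y where "y = c / r"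
  have c: "c = r * y" using assms(1) by (simp add: y_def)
  have "cheb y 1 (Suc j) = 0 \<or> r ^ Suc j * (cheb y 1 (Suc j) + cheb y 1 j) = 0"
    using assms unfolding c cheb_scale by (simp add: algebra_simps)
  then have "algebraic_int y" using algebraic_int_cheb_root[of y j] assms(1) by auto
  then show ?thesis using that c by blast
qed

text \<open>The parameter is the last letter, the one that acts first on a function; prepending is
  recovered by \<open>alternating_Cons\<close>.\<close>

fun alternating :: "bool \<Rightarrow> nat \<Rightarrow> bool list" where
  "alternating c 0 = []"
| "alternating c (Suc i) = alternating (\<not> c) i @ [c]"

lemma alternating_Cons:
  "alternating c (Suc i) = (if even i then c else \<not> c) # alternating c i"
proof (induction i arbitrary: c)
  case (Suc i)
  have "alternating c (Suc (Suc i)) = alternating (\<not> c) (Suc i) @ [c]" by (rule alternating.simps)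
  also have "\<dots> = ((if even i then \<not> c else \<not> \<not> c) # alternating (\<not> c) i) @ [c]" by (simp only: Suc.IH)
  also have "\<dots> = (if even (Suc i) then c else \<not> c) # alternating c (Suc i)" by simp
  finally show ?case .
qed simp

lemma length_alternating [simp]: "length (alternating c i) = i"
  by (induction i arbitrary: c) auto

text \<open>The Hecke algebra of a generalised polygon with parameters \<open>a, b\<close>, acting on functions on
  its chambers: \<open>A\<close> and \<open>B\<close> are the two adjacency operators.\<close>
locale hecke_module =
  fixes R :: "'c set" and A B :: "('c \<Rightarrow> complex) \<Rightarrow> ('c \<Rightarrow> complex)" and a b n :: nat
  assumes fin_R: "finite R" and R_ne: "R \<noteq> {}"
    and linA: "lin A" and linB: "lin B"
    and suppA: "f \<in> supp R \<Longrightarrow> A f \<in> supp R" and suppB: "f \<in> supp R \<Longrightarrow> B f \<in> supp R"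
    and quadA: "f \<in> supp R \<Longrightarrow> A (A f) = scl (of_nat a) f + scl (of_nat a - 1) (A f)"
    and quadB: "f \<in> supp R \<Longrightarrow> B (B f) = scl (of_nat b) f + scl (of_nat b - 1) (B f)"
    and A_allsum: "f \<in> supp R \<Longrightarrow> A (allsum R f) = scl (of_nat a) (allsum R f)"
    and allsum_A: "f \<in> supp R \<Longrightarrow> allsum R (A f) = scl (of_nat a) (allsum R f)"
    and B_allsum: "f \<in> supp R \<Longrightarrow> B (allsum R f) = scl (of_nat b) (allsum R f)"
    and allsum_B: "f \<in> supp R \<Longrightarrow> allsum R (B f) = scl (of_nat b) (allsum R f)"
    and thick: "2 \<le> a" "2 \<le> b" and n3: "3 \<le> n"
    and allsum_words: "f \<in> supp R \<Longrightarrow>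
      allsum R f = (\<Sum>i<n. foldr (\<lambda>c. if c then A else B) (alternating False i) (f + A f))"
begin

definition wop :: "bool list \<Rightarrow> ('c \<Rightarrow> complex) \<Rightarrow> ('c \<Rightarrow> complex)" where
  "wop cs = foldr (\<lambda>c. if c then A else B) cs"

text \<open>Since \<open>(1 + A)^2 = (a + 1) (1 + A)\<close>, an eigenvector \<open>v\<close> of
  \<open>M\<close> with nonzero eigenvalue is an eigenvector of \<open>A\<close> for
  \<open>a\<close>. The span of \<open>v\<close> and \<open>(1 + B) v\<close> is then invariant
  under the whole algebra, which makes explicit computation possible.\<close>

definition M :: "('c \<Rightarrow> complex) \<Rightarrow> ('c \<Rightarrow> complex)" where
  "M f = (f + B f) + A (f + B f)"

lemma wop_simps [simp]:
  "wop [] f = f" "wop (True # cs) f = A (wop cs f)" "wop (False # cs) f = B (wop cs f)"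
  by (simp_all add: wop_def)

lemma wop_append: "wop (cs @ ds) f = wop cs (wop ds f)"
  by (simp add: wop_def)

lemma lin_wop: "lin (wop cs)"
proof (induction cs)
  case Nil
  then show ?case by (simp add: lin_def)
next
  case (Cons c cs)
  then show ?case using linA linB by (cases c) (simp_all add: lin_def)
qed

lemma supp_wop: "f \<in> supp R \<Longrightarrow> wop cs f \<in> supp R"
proof (induction cs)
  case (Cons c cs)
  then show ?case by (cases c) (simp_all add: suppA suppB)
qed simp

lemmas AB_lin = linD[OF linA] linD[OF linB] lin_diff[OF linA] lin_diff[OF linB]

lemma linM: "lin M"
  unfolding M_def by (auto simp: lin_def AB_lin scl_simps algebra_simps)

lemma suppM: "f \<in> supp R \<Longrightarrow> M f \<in> supp R"
  unfolding M_def by (intro supp_intros suppA suppB)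

lemma supp_pop: "f \<in> supp R \<Longrightarrow> pop M p f \<in> supp R"
  using pop_comm[OF linM linM HOL.refl, of "supp R"] suppM by (blast intro: supp_intros)

definition \<mu>0 :: complex where "\<mu>0 = (of_nat a + 1) * (of_nat b + 1)"

lemma allsum_M: "f \<in> supp R \<Longrightarrow> allsum R (M f) = scl \<mu>0 (allsum R f)"
  unfolding M_def \<mu>0_def
  by (simp add: linD[OF lin_allsum] allsum_A allsum_B suppB supp_intros scl_simps)
    (simp add: scl_def fun_eq_iff algebra_simps)

lemma allsum_pop: "f \<in> supp R \<Longrightarrow> allsum R (pop M p f) = scl (poly p \<mu>0) (allsum R f)"
  by (induction p)
    (simp_all add: pop_pCons[OF linM] linD[OF lin_allsum] lin_0[OF lin_allsum] allsum_M supp_pop scl_simps mult.commute)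

lemma allsum_allsum: "allsum R (allsum R f) = scl (of_nat (card R)) (allsum R f)"
  by (auto simp: allsum_def scl_def fun_eq_iff)

text \<open>The condition \<open>allsum R v = 0\<close> separates off the constants, which carry the
  trivial eigenvalue \<open>\<mu>0\<close>. The eigenvalue zero is excluded because its eigenvectors
  do not satisfy the Chebyshev condition in general; later polynomials vanish at zero to suppress
  it.\<close>

definition good :: "complex \<Rightarrow> bool" where
  "good m \<longleftrightarrow> m \<noteq> 0 \<and> (\<exists>v\<in>supp R. v \<noteq> 0 \<and> allsum R v = 0 \<and> M v = scl m v)"

text \<open>In the basis \<open>v, u = (1 + B) v\<close> the partial sums of the alternating words applied to \<open>v\<close> are
  Chebyshev-like in \<open>\<mu> - a - b\<close>, and their sum over all words vanishes.\<close>
lemma good_cheb: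
  assumes "good m"
  defines "c \<equiv> m - of_nat a - of_nat b" and "f \<equiv> of_nat (a * b)"
  shows "even n \<Longrightarrow> cheb c f (n div 2 - 1) = 0"
    and "odd n \<Longrightarrow> cheb c f (n div 2) + of_nat b * cheb c f (n div 2 - 1) = 0"
proof -
  obtain v where v: "v \<in> supp R" "v \<noteq> 0" "allsum R v = 0" "M v = scl m v" and m0: "m \<noteq> 0"
    using assms unfolding good_def by blast
  define u where "u = v + B v"
  have u: "u \<in> supp R" unfolding u_def by (intro supp_intros suppB v)
  have Mv: "u + A u = scl m v" using v(4) by (simp add: M_def u_def)
  have u0: "u \<noteq> 0"
  proof
    assume "u = 0"
    then have "scl m v = 0" using Mv lin_0[OF linA] by simp
    then show False using m0 v(2) by simp
  qed
  have Au: "A u = scl m v - u" using Mv by (simp add: algebra_simps)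
  have Bv: "B v = u - v" by (simp add: u_def)
  have Bu: "B u = scl (of_nat b) u"
    unfolding u_def by (simp add: AB_lin quadB v scl_simps algebra_simps)
  \<comment> \<open>The image of \<open>1 + A\<close> is in the eigenspace of \<open>A\<close> for
    \<open>a\<close>, and \<open>u + A u\<close> is a nonzero multiple of \<open>v\<close>.\<close>
  have "A (u + A u) = scl (of_nat a) (u + A u)"
    by (simp add: AB_lin quadA u scl_simps algebra_simps)
  then have "scl m (A v) = scl m (scl (of_nat a) v)"
    unfolding Mv by (simp add: AB_lin scl_simps mult.commute)
  then have Av: "A v = scl (of_nat a) v" using m0 by (auto simp: scl_def fun_eq_iff)
  define w where "w i = wop (alternating False i) v" for i
  have w_Suc: "w (Suc i) = (if even i then B (w i) else A (w i))" for i
    by (simp only: w_def alternating_Cons) simp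
  have "allsum R v = scl (of_nat a + 1) (\<Sum>i<n. w i)"
  proof -
    have "v + A v = scl (of_nat a + 1) v" by (simp add: Av scl_simps add.commute)
    then have "allsum R v = (\<Sum>i<n. scl (of_nat a + 1) (w i))"
      using allsum_words[OF v(1)] by (simp add: w_def wop_def[symmetric] linD[OF lin_wop])
    also have "\<dots> = scl (of_nat a + 1) (\<Sum>i<n. w i)"
      by (rule lin_sum[symmetric], simp add: lin_def scl_def fun_eq_iff algebra_simps)
    finally show ?thesis .
  qed
  moreover have "of_nat a + 1 \<noteq> (0::complex)"
    by (metis of_nat_Suc of_nat_eq_0_iff add.commute nat.distinct(1))
  ultimately have sum0: "(\<Sum>i<n. w i) = 0" using v(3) by simp
  let ?q = "cheb c f"
  have w_even: "w (2 * Suc j) = scl (?q (Suc j) + of_nat b * ?q j) v - scl (?q j) u" for j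
  proof (induction j)
    case 0
    have "w (2 * Suc 0) = A (B v)" using w_Suc[of 1] w_Suc[of 0] by (simp add: w_def numeral_2_eq_2)
    also have "\<dots> = scl m v - u - scl (of_nat a) v" by (simp add: Bv AB_lin Au Av)
    also have "\<dots> = scl (?q (Suc 0) + of_nat b * ?q 0) v - scl (?q 0) u"
      by (simp add: c_def scl_def fun_eq_iff algebra_simps)
    finally show ?case .
  next
    case (Suc j)
    have "w (2 * Suc (Suc j)) = A (B (w (2 * Suc j)))"
      using w_Suc[of "2 * Suc j"] w_Suc[of "Suc (2 * Suc j)"] by simp
    also have "\<dots> = scl ((?q (Suc j) + of_nat b * ?q j) - of_nat b * ?q j) (scl m v - u)
        - scl ((?q (Suc j) + of_nat b * ?q j) * of_nat a) v"
      unfolding Suc by (simp add: AB_lin Au Av Bv Bu scl_simps algebra_simps)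
    also have "\<dots> = scl (?q (Suc (Suc j)) + of_nat b * ?q (Suc j)) v - scl (?q (Suc j)) u"
      by (simp add: c_def f_def scl_def fun_eq_iff algebra_simps)
    finally show ?case .
  qed
  have w_pairs: "(\<Sum>i<2 * Suc j. w i) = scl (?q j) u" for j
  proof (induction j)
    case 0
    have "(\<Sum>i<2 * Suc 0. w i) = w 0 + w 1" by (simp add: numeral_2_eq_2)
    also have "\<dots> = u" using w_Suc[of 0] by (simp add: w_def u_def)
    finally show ?case by (simp add: scl_simps)
  next
    case (Suc j)
    have "(\<Sum>i<2 * Suc (Suc j). w i) = (\<Sum>i<2 * Suc j. w i) + w (2 * Suc j) + B (w (2 * Suc j))"
      using w_Suc[of "2 * Suc j"] by (simp add: add.assoc)
    also have "\<dots> = scl (?q (Suc j)) u"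
      unfolding Suc w_even by (simp add: AB_lin Bv Bu scl_simps algebra_simps)
    finally show ?case .
  qed
  { assume "even n"
    then obtain j where j: "n = 2 * Suc j" using n3
      by (metis One_nat_def Suc_pred dvdE mult_0_right not_numeral_le_zero not_gr_zero)
    then show "cheb c f (n div 2 - 1) = 0" using sum0 w_pairs[of j] u0 by simp }
  { assume "odd n"
    then obtain k where "n = 2 * k + 1" by (elim oddE)
    then obtain j where j: "n = Suc (2 * Suc j)" using n3 by (cases k) auto
    then have "scl (?q j) u + w (2 * Suc j) = 0" using sum0 w_pairs[of j] by simp
    then have "scl (?q (Suc j) + of_nat b * ?q j) v = 0" unfolding w_even by simp
    then show "cheb c f (n div 2) + of_nat b * cheb c f (n div 2 - 1) = 0"
      using v(2) j by simp }
qed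

end

text \<open>Numbers with equal \<open>k\<close>-th powers differ by a root of unity, which does not
  disturb integrality: \<open>(z / d)^k = u^k\<close>. The divisor \<open>d\<close> may be
  irrational, such as a power of the square root of \<open>a b\<close>.\<close>

lemma algebraic_int_factor_of_power_eq:
  fixes z w d u :: complex
  assumes "z ^ k = w ^ k" "0 < k" "w = d * u" "algebraic_int u"
  shows "\<exists>u'. z = d * u' \<and> algebraic_int u'"
proof (cases "d = 0")
  case True
  then show ?thesis using assms by (intro exI[of _ 0]) (auto simp: power_0_left)
next
  case False
  then have "(z / d) ^ k = u ^ k" using assms by (simp add: power_divide power_mult_distrib)
  then have "algebraic_int (z / d)"
    using algebraic_int_of_power[of "z / d" k] algebraic_int_power[OF assms(4)] assms(2) by simp
  then show ?thesis using False by (intro exI[of _ "z / d"]) simp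
qed

lemma algebraic_int_factor_sum_list:
  fixes d :: complex
  assumes "\<And>z. z \<in> set zs \<Longrightarrow> \<exists>u. z = d * u \<and> algebraic_int u"
  shows "\<exists>u. sum_list zs = d * u \<and> algebraic_int u"
  using assms
proof (induction zs)
  case Nil
  then show ?case by (intro exI[of _ 0]) simp
next
  case (Cons z zs)
  obtain u where u: "z = d * u" "algebraic_int u" using Cons.prems by auto
  obtain u' where u': "sum_list zs = d * u'" "algebraic_int u'" using Cons by auto
  show ?case
    by (rule exI[of _ "u + u'"]) (use u u' in \<open>simp add: algebraic_int_add algebra_simps\<close>)
qed

text \<open>The number \<open>c\<close> plays the role of a multiplicity in the Feit-Higman
  argument; its integrality is the point.\<close>

lemma sum_list_two_valued:
  fixes w :: complex
  assumes "\<And>z. z \<in> set zs \<Longrightarrow> z = 0 \<or> z = w"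
  shows "\<exists>c::nat. sum_list zs = of_nat c * w"
  using assms
proof (induction zs)
  case Nil
  then show ?case by (intro exI[of _ 0]) simp
next
  case (Cons z zs)
  then obtain c where c: "sum_list zs = of_nat c * w" by auto
  have "z = 0 \<or> z = w" using Cons.prems by simp
  then show ?case
  proof
    assume "z = 0"
    then show ?thesis using c by (intro exI[of _ c]) simp
  next
    assume "z = w"
    then show ?thesis using c by (intro exI[of _ "Suc c"]) (simp add: algebra_simps)
  qed
qed

lemma not_successively_neqD:
  "\<not> successively (\<noteq>) cs \<Longrightarrow> \<exists>us c ws. cs = us @ [c, c] @ ws"
proof (induction cs rule: induct_list012)
  case (3 x y zs)
  show ?case
  proof (cases "x = y")
    case True
    then show ?thesis by (intro exI[of _ "[]"]) auto
  next
    case False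
    then obtain us c ws where "y # zs = us @ [c, c] @ ws" using 3 by auto
    then show ?thesis by (intro exI[of _ "x # us"]) auto
  qed
qed auto

section \<open>Traces and eigenvalues of operators commuting with \<open>M\<close>\<close>

context hecke_module
begin

lemma card_pos: "of_nat (card R) \<noteq> (0 :: complex)"
  using fin_R R_ne by simp

text \<open>Subtracting \<open>l / card R\<close> times \<open>J\<close> replaces the trivial
  eigenvalue by zero. The deflated operator maps into the kernel of \<open>J\<close>, so each of its
  nonzero eigenvalues has an eigenvector of sum zero, on which it agrees with
  \<open>Z\<close>.\<close>

lemma eigenvalue_decomposition:
  assumes Z: "lin Z" "\<And>f. f \<in> supp R \<Longrightarrow> Z f \<in> supp R"
    and J: "\<And>f. f \<in> supp R \<Longrightarrow> allsum R (Z f) = scl l (allsum R f)"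
  shows "\<exists>zs. sum_list zs = tr R Z - l \<and>
    (\<forall>z\<in>set zs. z = 0 \<or> (\<exists>v\<in>supp R. v \<noteq> 0 \<and> allsum R v = 0 \<and> Z v = scl z v))"
proof -
  define Z' where "Z' f = Z f - scl (l / of_nat (card R)) (allsum R f)" for f
  have linZ': "lin Z'" unfolding Z'_def[abs_def]
    by (rule lin_intros(4)[OF Z(1) lin_intros(5)[OF lin_allsum]])
  have suppZ': "Z' f \<in> supp R" if "f \<in> supp R" for f
    unfolding Z'_def by (intro supp_intros Z(2) that)
  have JZ': "allsum R (Z' f) = 0" if "f \<in> supp R" for f
  proof -
    have "allsum R (Z' f) = scl l (allsum R f)
        - scl (l / of_nat (card R)) (scl (of_nat (card R)) (allsum R f))"
      unfolding Z'_def
      by (simp only: lin_diff[OF lin_allsum] linD(2)[OF lin_allsum] J[OF that] allsum_allsum)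
    also have "\<dots> = 0" unfolding scl_simps(5) using card_pos by simp
    finally show ?thesis .
  qed
  have trJ: "tr R (allsum R) = of_nat (card R)"
    using fin_R by (simp add: tr_def allsum_def ind_def)
  have "tr R Z' = tr R Z - (l / of_nat (card R)) * tr R (allsum R)"
    unfolding Z'_def[abs_def] by (simp only: tr_simps(2,3))
  then have tr': "tr R Z' = tr R Z - l" unfolding trJ using card_pos by simp
  from trace_eq_sum_eigenvalues[OF fin_R, of "\<lambda>x y. Z' (ind y) x"]
  obtain zs where zs: "(\<Sum>x\<in>R. Z' (ind x) x) = sum_list zs"
    "\<forall>z\<in>set zs. \<exists>v. (\<exists>x\<in>R. v x \<noteq> 0) \<and> (\<forall>x\<in>R. (\<Sum>y\<in>R. Z' (ind y) x * v y) = z * v x)"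
    by blast
  show ?thesis
  proof (intro exI[of _ zs] conjI ballI)
    show "sum_list zs = tr R Z - l" using zs(1) tr' by (simp add: tr_def)
    fix z assume "z \<in> set zs"
    from bspec[OF zs(2) this] obtain w where w: "\<exists>x\<in>R. w x \<noteq> 0" "\<forall>x\<in>R. (\<Sum>y\<in>R. Z' (ind y) x * w y) = z * w x"
      by blast
    define v where "v x = (if x \<in> R then w x else 0)" for x
    have v: "v \<in> supp R" by (simp add: v_def supp_def)
    have v0: "v \<noteq> 0"
    proof
      assume "v = 0"
      then have "w x = 0" if "x \<in> R" for x using v_def[of x] that by simp
      then show False using w(1) by simp
    qed
    have Zvx: "Z' v x = z * v x" for x
    proof (cases "x \<in> R")
      case True
      have "Z' v x = (\<Sum>y\<in>R. Z' (ind y) x * w y)"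
        unfolding lin_expand[OF linZ' fin_R v] by (intro sum.cong) (auto simp: v_def)
      then show ?thesis using w(2) True by (simp add: v_def)
    next
      case False
      then show ?thesis using suppZ'[OF v] v by (simp add: supp_def)
    qed
    have Zv: "Z' v = scl z v" unfolding scl_def by (rule ext, rule Zvx)
    show "z = 0 \<or> (\<exists>v\<in>supp R. v \<noteq> 0 \<and> allsum R v = 0 \<and> Z v = scl z v)"
    proof (cases "z = 0")
      case False
      have "scl z (allsum R v) = 0"
        using JZ'[OF v] unfolding Zv linD(2)[OF lin_allsum] .
      then have J0: "allsum R v = 0" using False by simp
      have "Z v = scl z v" using Zv unfolding Z'_def J0 scl_simps diff_0_right .
      then show ?thesis using v v0 J0 by (intro disjI2 bexI[of _ v] conjI)
    qed simp
  qed
qed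

text \<open>Because \<open>P\<close> commutes with \<open>M\<close> and has period \<open>k\<close>,
  the \<open>k\<close>-th power of \<open>P p(M)\<close> is \<open>p(M)^k\<close>. Hence
  \<open>p(M)^k\<close> multiplies \<open>v\<close> by \<open>z^k\<close>, and the polynomial
  \<open>p^k - z^k\<close> of \<open>M\<close> annihilates \<open>v\<close>; one of its roots is an
  eigenvalue of \<open>M\<close>.\<close>

lemma good_of_eigenvector:
  assumes P: "lin P" "\<And>f. f \<in> supp R \<Longrightarrow> P f \<in> supp R" "\<And>f. f \<in> supp R \<Longrightarrow> P (M f) = M (P f)"
    "\<And>f. f \<in> supp R \<Longrightarrow> (P ^^ k) f = f" "0 < k"
    and v: "v \<in> supp R" "v \<noteq> 0" "allsum R v = 0" "P (pop M p v) = scl z v"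
    and "z \<noteq> 0" "poly p 0 = 0"
  shows "\<exists>m. good m \<and> z ^ k = poly p m ^ k"
proof -
  let ?T = "pop M p"
  have linT: "lin ?T" by (rule lin_pop[OF linM])
  have PT: "P (?T f) = ?T (P f)" if "f \<in> supp R" for f
    using pop_comm[OF linM P(1) P(3), of "supp R"] suppM that by (blast intro: supp_intros)
  have suppTi: "(?T ^^ i) f \<in> supp R" if "f \<in> supp R" for i f
    using that by (induction i) (auto intro: supp_pop)
  have PTi: "P ((?T ^^ i) f) = (?T ^^ i) (P f)" if "f \<in> supp R" for i f
    using that by (induction i) (simp_all add: PT suppTi)
  have "(P ^^ i) ((?T ^^ i) v) = scl (z ^ i) v" for i
  proof (induction i)
    case (Suc i)
    have "(P ^^ Suc i) ((?T ^^ Suc i) v) = (P ^^ i) (P ((?T ^^ i) (?T v)))"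
      by (simp only: funpow_Suc_right o_apply)
    also have "P ((?T ^^ i) (?T v)) = (?T ^^ i) (scl z v)"
      by (simp add: PTi supp_pop v)
    also have "\<dots> = scl z ((?T ^^ i) v)" using linD(2)[OF lin_funpow[OF linT]] .
    also have "(P ^^ i) \<dots> = scl z ((P ^^ i) ((?T ^^ i) v))" using linD(2)[OF lin_funpow[OF P(1)]] .
    finally show ?case unfolding Suc by (simp add: scl_simps)
  qed (simp add: scl_simps)
  then have Tk: "(?T ^^ k) v = scl (z ^ k) v" using P(4)[OF suppTi[OF v(1)], of k] by simp
  define q where "q = p ^ k + [:- (z ^ k):]"
  have "pop M q v = pop M (p ^ k) v + pop M [:- (z ^ k):] v"
    unfolding q_def by (rule pop_add[OF linM])
  also have "\<dots> = 0"
    by (simp add: pop_power[OF linM] Tk pop_pCons[OF linM] lin_0[OF linM] scl_simps)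
  finally have qv: "pop M q v = 0" .
  \<comment> \<open>The value at zero shows that \<open>q\<close> is not the zero
    polynomial.\<close>
  have "poly q 0 = - (z ^ k)" using assms(11) P(5) by (simp add: q_def poly_power)
  then have q0: "q \<noteq> 0" using assms(10) by auto
  define V where "V = {f \<in> supp R. allsum R f = 0}"
  have V1: "M f \<in> V" if "f \<in> V" for f
    using that suppM[of f] allsum_M[of f] by (simp add: V_def scl_simps)
  have V2: "0 \<in> V" using lin_0[OF lin_allsum, of R] by (simp add: V_def supp_intros(1))
  have V3: "f + g \<in> V" if fg: "f \<in> V" "g \<in> V" for f g
  proof -
    have "allsum R (f + g) = allsum R f + allsum R g" by (rule linD(1)[OF lin_allsum])
    then show ?thesis using fg supp_intros(2)[of f R g] by (simp add: V_def)
  qed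
  have V4: "scl c f \<in> V" if f: "f \<in> V" for c f
  proof -
    have "allsum R (scl c f) = scl c (allsum R f)" by (rule linD(2)[OF lin_allsum])
    then show ?thesis using f supp_intros(4)[of f R c] by (simp add: V_def scl_simps)
  qed
  have "v \<in> V" using v by (simp add: V_def)
  then have "\<exists>m w. poly q m = 0 \<and> w \<noteq> 0 \<and> w \<in> V \<and> M w = scl m w"
    by (intro eigenvector_of_annihilating_poly[where v = v] linM V1 V2 V3 V4 v(2) q0 qv)
  then obtain m w where m: "poly q m = 0" "w \<noteq> 0" "w \<in> V" "M w = scl m w" by blast
  have eq: "z ^ k = poly p m ^ k" using m(1) by (simp add: q_def poly_power)
  have "m \<noteq> 0"
  proof
    assume "m = 0"
    then have "z ^ k = 0" using eq assms(11) P(5) by simp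
    then show False using assms(10) by simp
  qed
  then show ?thesis using m(2-4) eq unfolding good_def V_def by blast
qed

text \<open>A repeated letter is removed by the quadratic relation, which leaves words shorter by
  one or two; so vanishing on alternating words is enough.\<close>

lemma trace_wop_eq_0:
  assumes P: "lin P"
    and tr0: "\<And>cs. successively (\<noteq>) cs \<Longrightarrow> length cs < n \<Longrightarrow> tr R (\<lambda>f. P (wop cs f)) = 0"
  shows "length cs < n \<Longrightarrow> tr R (\<lambda>f. P (wop cs f)) = 0"
proof (induction "length cs" arbitrary: cs rule: less_induct)
  case less
  show ?case
  proof (cases "successively (\<noteq>) cs")
    case True
    then show ?thesis using tr0 less.prems by blast
  next
    case False
    then obtain us c ws where cs: "cs = us @ [c, c] @ ws" using not_successively_neqD by blast
    define q where "q = (if c then a else b)"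
    have "tr R (\<lambda>f. P (wop cs f)) = tr R (\<lambda>f. scl (of_nat q) (P (wop (us @ ws) f))
        + scl (of_nat q - 1) (P (wop (us @ [c] @ ws) f)))"
    proof (rule tr_cong)
      fix f :: "'c \<Rightarrow> complex" assume f: "f \<in> supp R"
      have "wop [c, c] g = scl (of_nat q) g + scl (of_nat q - 1) (wop [c] g)" if "g \<in> supp R" for g
        using that by (cases c) (simp_all add: q_def quadA quadB)
      then show "P (wop cs f) = scl (of_nat q) (P (wop (us @ ws) f))
          + scl (of_nat q - 1) (P (wop (us @ [c] @ ws) f))"
        unfolding cs wop_append by (simp only: supp_wop[OF f] linD[OF lin_wop] linD[OF P])
    qed
    then show ?thesis
      unfolding tr_simps using less.hyps[of "us @ ws"] less.hyps[of "us @ [c] @ ws"] less.prems cs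
      by simp
  qed
qed

lemma M_eq_wop: "M f = wop [] f + wop [False] f + wop [True] f + wop [True, False] f"
  by (simp add: M_def AB_lin add_ac)

text \<open>Every factor \<open>M\<close> adds at most two letters, so \<open>M ^^ j\<close> is a
  sum of words of length at most \<open>2 * j\<close>. This is the origin of the degree
  bound.\<close>

lemma trace_pop_eq_0:
  assumes P: "lin P"
    and tr0: "\<And>cs. successively (\<noteq>) cs \<Longrightarrow> length cs < n \<Longrightarrow> tr R (\<lambda>f. P (wop cs f)) = 0"
    and deg: "2 * Polynomial.degree p < n"
  shows "tr R (\<lambda>f. P (pop M p f)) = 0"
proof -
  \<comment> \<open>The prefix \<open>cs\<close> is generalised because expanding the outermost
    \<open>M\<close> moves its letters into it.\<close>
  have 1: "length cs + 2 * j < n \<Longrightarrow> tr R (\<lambda>f. P (wop cs ((M ^^ j) f))) = 0" for cs j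
  proof (induction j arbitrary: cs)
    case 0
    then show ?case using trace_wop_eq_0[OF P tr0] by simp
  next
    case (Suc j)
    let ?W = "\<lambda>ds f. P (wop (cs @ ds) ((M ^^ j) f))"
    have "tr R (\<lambda>f. P (wop cs ((M ^^ Suc j) f)))
        = tr R (\<lambda>f. ?W [] f + ?W [False] f + ?W [True] f + ?W [True, False] f)"
    proof (rule tr_cong)
      fix f
      have "(M ^^ Suc j) f = M ((M ^^ j) f)" by simp
      then show "P (wop cs ((M ^^ Suc j) f)) = ?W [] f + ?W [False] f + ?W [True] f + ?W [True, False] f"
        by (simp only: M_eq_wop wop_append linD[OF lin_wop] linD[OF P])
    qed
    also have "\<dots> = tr R (?W []) + tr R (?W [False]) + tr R (?W [True]) + tr R (?W [True, False])"
      by (simp only: tr_simps)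
    also have "\<dots> = 0"
      using Suc.IH[of "cs @ []"] Suc.IH[of "cs @ [False]"] Suc.IH[of "cs @ [True]"]
        Suc.IH[of "cs @ [True, False]"] Suc.prems by simp
    finally show ?case .
  qed
  \<comment> \<open>The power in front counts the coefficients already split off, so that each
    coefficient is met with its own exponent of \<open>M\<close>.\<close>
  have 2: "2 * (j + Polynomial.degree p) < n \<Longrightarrow> tr R (\<lambda>f. P ((M ^^ j) (pop M p f))) = 0" for j
  proof (induction p arbitrary: j)
    case 0
    have M0: "(M ^^ j) 0 = 0" by (rule lin_0[OF lin_funpow[OF linM]])
    show ?case by (simp only: pop_0 M0 lin_0[OF P] tr_simps)
  next
    case (pCons k p)
    have "tr R (\<lambda>f. P ((M ^^ j) (pop M (pCons k p) f))) = tr R (\<lambda>f. scl k (P (wop [] ((M ^^ j) f)))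
        + P ((M ^^ Suc j) (pop M p f)))"
    proof (rule tr_cong)
      fix f
      have "(M ^^ Suc j) (pop M p f) = (M ^^ j) (M (pop M p f))" by (simp only: funpow_Suc_right o_apply)
      then show "P ((M ^^ j) (pop M (pCons k p) f)) = scl k (P (wop [] ((M ^^ j) f)))
          + P ((M ^^ Suc j) (pop M p f))"
        by (simp only: pop_pCons[OF linM] linD[OF lin_funpow[OF linM]] linD[OF P] wop_simps)
    qed
    moreover have "tr R (\<lambda>f. P ((M ^^ Suc j) (pop M p f))) = 0"
    proof (cases "p = 0")
      case True
      have M0: "(M ^^ Suc j) 0 = 0" by (rule lin_0[OF lin_funpow[OF linM]])
      show ?thesis unfolding True by (simp only: pop_0 M0 lin_0[OF P] tr_simps)
    next
      case False
      then have "2 * (Suc j + Polynomial.degree p) < n" using pCons.prems by simp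
      then show ?thesis by (rule pCons.IH)
    qed
    moreover have "tr R (\<lambda>f. P (wop [] ((M ^^ j) f))) = 0" using 1[of "[]" j] pCons.prems by simp
    ultimately show ?case by (simp only: tr_simps mult_zero_right add_0)
  qed
  show ?thesis using 2[of 0] deg by simp
qed

text \<open>Homogeneity of the Chebyshev condition extracts the factor \<open>r\<close>. For odd
  \<open>n\<close> its second term carries the coefficient \<open>b\<close>, so it is homogeneous in
  this sense only for \<open>r = b\<close>, that is, for \<open>a = b\<close>.\<close>

lemma good_form:
  assumes "good m" "r\<^sup>2 = of_nat (a * b)" "even n \<or> r = of_nat b"
  shows "\<exists>y. m = of_nat a + of_nat b + r * y \<and> algebraic_int y"
proof -
  have r0: "r \<noteq> 0" using assms(2) thick by auto
  define c where "c = m - of_nat a - of_nat b"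
  define j where "j = n div 2 - 1"
  have j: "n div 2 - 1 = j" "n div 2 = Suc j" using n3 by (simp_all add: j_def)
  have "\<exists>y. c = r * y \<and> algebraic_int y"
  proof (cases "even n")
    case True
    then have q: "cheb c (r\<^sup>2) j = 0"
      using good_cheb(1)[OF assms(1)] assms(2) j by (simp add: c_def)
    then obtain i where i: "j = Suc i" by (cases j) auto
    show ?thesis
      by (rule algebraic_int_cheb_homogeneous[OF r0 disjI1[OF q[unfolded i]]]) blast
  next
    case False
    then have "cheb c (r\<^sup>2) (Suc j) + r * cheb c (r\<^sup>2) j = 0"
      using good_cheb(2)[OF assms(1)] assms(2,3) j by (simp add: c_def)
    then show ?thesis
      by (rule algebraic_int_cheb_homogeneous[OF r0 disjI2]) blast
  qed
  then obtain y where "c = r * y" "algebraic_int y" by blast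
  then show ?thesis by (intro exI[of _ y]) (simp add: c_def algebra_simps)
qed

lemma trace_pop_decomposition:
  assumes P: "lin P" "\<And>f. f \<in> supp R \<Longrightarrow> P f \<in> supp R" "\<And>f. f \<in> supp R \<Longrightarrow> P (M f) = M (P f)"
    "\<And>f. f \<in> supp R \<Longrightarrow> (P ^^ k) f = f" "0 < k"
    and JP: "\<And>f. f \<in> supp R \<Longrightarrow> allsum R (P f) = allsum R f"
    and p0: "poly p 0 = 0"
  shows "\<exists>zs. sum_list zs = tr R (\<lambda>f. P (pop M p f)) - poly p \<mu>0 \<and>
    (\<forall>z\<in>set zs. z = 0 \<or> (\<exists>m. good m \<and> z ^ k = poly p m ^ k))"
proof -
  have linZ: "lin (\<lambda>f. P (pop M p f))" by (rule lin_intros(2)[OF P(1) lin_pop[OF linM]])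
  have suppZ: "P (pop M p f) \<in> supp R" if "f \<in> supp R" for f
    by (rule P(2)[OF supp_pop[OF that]])
  have JZ: "allsum R (P (pop M p f)) = scl (poly p \<mu>0) (allsum R f)" if "f \<in> supp R" for f
    using JP[OF supp_pop[OF that]] allsum_pop[OF that] by simp
  obtain zs where zs: "sum_list zs = tr R (\<lambda>f. P (pop M p f)) - poly p \<mu>0"
    "\<forall>z\<in>set zs. z = 0 \<or>
       (\<exists>v\<in>supp R. v \<noteq> 0 \<and> allsum R v = 0 \<and> P (pop M p v) = scl z v)"
    using eigenvalue_decomposition[OF linZ suppZ JZ] by blast
  show ?thesis
  proof (intro exI[of _ zs] conjI ballI)
    show "sum_list zs = tr R (\<lambda>f. P (pop M p f)) - poly p \<mu>0" by (rule zs(1))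
    fix z assume "z \<in> set zs"
    show "z = 0 \<or> (\<exists>m. good m \<and> z ^ k = poly p m ^ k)"
    proof (cases "z = 0")
      case False
      then obtain v where v: "v \<in> supp R" "v \<noteq> 0" "allsum R v = 0" "P (pop M p v) = scl z v"
        using bspec[OF zs(2) \<open>z \<in> set zs\<close>] by blast
      show ?thesis using good_of_eigenvector[OF P v False p0] by (rule disjI2)
    qed simp
  qed
qed

end

section \<open>Traces of an opposition-like permutation\<close>

text \<open>\<open>P\<close> stands for the permutation operator of a map sending every chamber to
  an opposite one. Opposite chambers are at distance \<open>n\<close>, out of reach of shorter
  words: hence \<open>trace_P\<close>. Opposition in an \<open>n\<close>-gon preserves the two types
  for even \<open>n\<close> and exchanges them for odd \<open>n\<close>. The condition
  \<open>trace_id\<close> feeds the Feit-Higman count.\<close>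

locale hecke_anisotropic = hecke_module +
  fixes P :: "('a \<Rightarrow> complex) \<Rightarrow> ('a \<Rightarrow> complex)" and k :: nat
  assumes linP: "lin P" and suppP: "f \<in> supp R \<Longrightarrow> P f \<in> supp R"
    and periodP: "f \<in> supp R \<Longrightarrow> (P ^^ k) f = f" "0 < k"
    and allsum_P: "f \<in> supp R \<Longrightarrow> allsum R (P f) = allsum R f"
    and trace_P: "successively (\<noteq>) cs \<Longrightarrow> length cs < n \<Longrightarrow> tr R (\<lambda>f. P (wop cs f)) = 0"
    and trace_id: "successively (\<noteq>) cs \<Longrightarrow> cs \<noteq> [] \<Longrightarrow> length cs < n \<Longrightarrow> tr R (wop cs) = 0"
    and P_even: "even n \<Longrightarrow> f \<in> supp R \<Longrightarrow> P (A f) = A (P f)"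
      "even n \<Longrightarrow> f \<in> supp R \<Longrightarrow> P (B f) = B (P f)"
    and P_odd: "odd n \<Longrightarrow> f \<in> supp R \<Longrightarrow> P (A f) = B (P f)"
      "odd n \<Longrightarrow> f \<in> supp R \<Longrightarrow> P (B f) = A (P f)" "odd n \<Longrightarrow> a = b"
begin

lemma P_M: "even n \<Longrightarrow> f \<in> supp R \<Longrightarrow> P (M f) = M (P f)"
  unfolding M_def by (simp only: linD[OF linP] P_even supp_intros suppB)

text \<open>Take \<open>p = X * g\<close>. The trace of \<open>P p(M)\<close> is zero, so minus the
  trivial eigenvalue of \<open>p(M)\<close> is the sum of the other eigenvalues of
  \<open>P p(M)\<close>; each is zero or agrees up to a root of unity with some
  \<open>m * poly g m\<close>, hence is divisible by \<open>d\<close>. The factor \<open>X\<close>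
  silences the kernel of \<open>M\<close>.\<close>

lemma even_decomposition:
  assumes "even n" and deg: "2 * (Polynomial.degree g + 1) < n"
    and u: "\<And>m. good m \<Longrightarrow> \<exists>u. m * poly g m = d * u \<and> algebraic_int u"
  shows "\<exists>u. - (\<mu>0 * poly g \<mu>0) = d * u \<and> algebraic_int u"
proof -
  define p where "p = [:0, 1:] * g"
  have "Polynomial.degree p \<le> Polynomial.degree g + 1"
    unfolding p_def using degree_mult_le[of "[:0, 1:] :: complex poly" g] by simp
  then have deg': "2 * Polynomial.degree p < n" using deg by simp
  have p: "poly p x = x * poly g x" for x by (simp add: p_def)
  then have p0: "poly p 0 = 0" by simp
  obtain zs where zs: "sum_list zs = tr R (\<lambda>f. P (pop M p f)) - poly p \<mu>0"
    "\<forall>z\<in>set zs. z = 0 \<or> (\<exists>m. good m \<and> z ^ k = poly p m ^ k)"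
    using trace_pop_decomposition[OF linP suppP P_M[OF assms(1)] periodP allsum_P p0] by blast
  have "\<exists>u. z = d * u \<and> algebraic_int u" if zin: "z \<in> set zs" for z
  proof (cases "z = 0")
    case True
    then show ?thesis by (intro exI[of _ 0]) simp
  next
    case False
    then obtain m where m: "good m" "z ^ k = poly p m ^ k" using bspec[OF zs(2) zin] by blast
    obtain u where u': "m * poly g m = d * u" "algebraic_int u" using u[OF m(1)] by blast
    show ?thesis
      by (rule algebraic_int_factor_of_power_eq[OF m(2) periodP(2) _ u'(2)]) (simp only: p u'(1))
  qed
  then have "\<exists>u. sum_list zs = d * u \<and> algebraic_int u" by (rule algebraic_int_factor_sum_list)
  moreover have "tr R (\<lambda>f. P (pop M p f)) = 0" by (rule trace_pop_eq_0[OF linP trace_P deg'])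
  ultimately show ?thesis using zs(1) by (simp only: p diff_0)
qed

lemma even_dvd:
  fixes d N :: int
  assumes "even n" "2 * (Polynomial.degree g + 1) < n"
    and u: "\<And>m. good m \<Longrightarrow> \<exists>u. m * poly g m = of_int d * u \<and> algebraic_int u"
    and N: "\<mu>0 * poly g \<mu>0 = of_int N"
  shows "d dvd N"
proof -
  obtain u where u': "- (\<mu>0 * poly g \<mu>0) = of_int d * u" "algebraic_int u"
    using even_decomposition[OF assms(1,2) u] by blast
  have "of_int (- N) = of_int d * u" using u'(1) unfolding N by simp
  then have "d dvd - N" by (rule dvd_of_algebraic_int[OF u'(2)])
  then show ?thesis by simp
qed

text \<open>Use \<open>g = 1\<close>. A common prime \<open>p\<close> of \<open>a\<close> and
  \<open>b\<close> divides the square root of \<open>a b\<close> in the algebraic integers, hence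
  every good eigenvalue, hence \<open>(a + 1) (b + 1)\<close>, which is \<open>1\<close> modulo
  \<open>p\<close>.\<close>

lemma even_coprime:
  assumes "even n"
  shows "coprime a b"
proof (rule ccontr)
  assume "\<not> coprime a b"
  then obtain p where p: "normalization_semidom_class.prime p" "p dvd a" "p dvd b"
    by (metis coprime_iff_gcd_eq_1 dvd_trans gcd_dvd1 gcd_dvd2 prime_factor_nat)
  obtain a' b' where ab: "a = p * a'" "b = p * b'" using p(2,3) by (elim dvdE)
  define r where "r = csqrt (of_nat (a' * b'))"
  have r2: "(of_nat p * r)\<^sup>2 = of_nat (a * b)"
    unfolding r_def power_mult_distrib power2_csqrt ab by (simp add: power2_eq_square)
  have algr: "algebraic_int r" unfolding r_def by (rule algebraic_int_csqrt[OF algebraic_int_of_nat])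
  have "int p dvd (int a + 1) * (int b + 1)"
  proof (rule even_dvd[OF assms, of 1])
    show "2 * (Polynomial.degree (1 :: complex poly) + 1) < n" using n3 by simp
    show "\<mu>0 * poly 1 \<mu>0 = of_int ((int a + 1) * (int b + 1))" by (simp add: \<mu>0_def)
    fix m assume "good m"
    then obtain y where y: "m = of_nat a + of_nat b + of_nat p * r * y" "algebraic_int y"
      using good_form[OF _ r2 disjI1[OF assms]] by blast
    show "\<exists>u. m * poly 1 m = of_int (int p) * u \<and> algebraic_int u"
    proof (intro exI[of _ "of_nat a' + of_nat b' + r * y"] conjI)
      show "m * poly 1 m = of_int (int p) * (of_nat a' + of_nat b' + r * y)"
        unfolding y(1) ab by (simp add: algebra_simps)
      show "algebraic_int (of_nat a' + of_nat b' + r * y)"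
        by (intro algebraic_int_add algebraic_int_mult algebraic_int_of_nat algr y(2))
    qed
  qed
  moreover have "(int a + 1) * (int b + 1) = int p * (int a' + int b' + int p * int a' * int b') + 1"
    unfolding ab by (simp add: algebra_simps)
  ultimately have "int p dvd 1" by (simp add: dvd_add_right_iff)
  then show False using p(1) by simp
qed

text \<open>Here \<open>P A = B P\<close>, so \<open>Z = (1 + A) P\<close> has square
  \<open>M P^2\<close>, and \<open>P^2\<close> commutes with \<open>M\<close>. Good eigenvalues are
  divisible by \<open>a\<close>, so the eigenvalues of \<open>Z\<close> on functions of sum zero are
  divisible by the square root of \<open>a\<close>. As \<open>Z\<close> has trace zero, so is its
  trivial eigenvalue \<open>a + 1\<close>, and \<open>a\<close> would divide
  \<open>(a + 1)^2\<close>.\<close>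

lemma odd_impossible: "even n"
proof (rule ccontr)
  assume odd: "odd n"
  have ab: "a = b" by (rule P_odd(3)[OF odd])
  define Z where "Z f = P f + A (P f)" for f
  have linZ: "lin Z" unfolding Z_def[abs_def]
    by (rule lin_intros(3)[OF linP lin_intros(2)[OF linA linP]])
  have suppZ: "Z f \<in> supp R" if "f \<in> supp R" for f
    unfolding Z_def by (intro supp_intros(2) suppA suppP that)
  have JZ: "allsum R (Z f) = scl (of_nat a + 1) (allsum R f)" if "f \<in> supp R" for f
    unfolding Z_def
    by (simp add: linD(1)[OF lin_allsum] allsum_A[OF suppP[OF that]] allsum_P[OF that] scl_simps)
  \<comment> \<open>The operator \<open>A P\<close> equals \<open>P B\<close>, a word of length one
    behind \<open>P\<close>, so the trace condition applies.\<close>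
  have "tr R Z = tr R (\<lambda>f. P (wop [] f)) + tr R (\<lambda>f. P (wop [False] f))"
    unfolding tr_simps(1)[symmetric] by (rule tr_cong) (simp add: Z_def P_odd(2)[OF odd])
  also have "\<dots> = 0" using trace_P[of "[]"] trace_P[of "[False]"] n3 by simp
  finally have trZ: "tr R Z = 0" .
  obtain zs where zs: "sum_list zs = tr R Z - (of_nat a + 1)"
    "\<forall>z\<in>set zs. z = 0 \<or> (\<exists>v\<in>supp R. v \<noteq> 0 \<and> allsum R v = 0 \<and> Z v = scl z v)"
    using eigenvalue_decomposition[OF linZ suppZ JZ] by blast
  let ?Q = "\<lambda>f. P (P f)"
  have linQ: "lin ?Q" by (rule lin_intros(2)[OF linP linP])
  have suppQ: "?Q f \<in> supp R" if "f \<in> supp R" for f by (intro suppP that)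
  have QM: "?Q (M f) = M (?Q f)" if "f \<in> supp R" for f
    unfolding M_def by (simp only: linD[OF linP] P_odd(1,2)[OF odd] supp_intros suppA suppB suppP that)
  have "(?Q ^^ i) f = (P ^^ (2 * i)) f" for i f
    by (induction i) simp_all
  then have Qk: "(?Q ^^ k) f = f" if "f \<in> supp R" for f
    using periodP(1)[OF that] that by (simp add: mult_2 funpow_add)
  define r where "r = csqrt (of_nat a)"
  have r2: "r\<^sup>2 = of_nat a" unfolding r_def by (rule power2_csqrt)
  have "\<exists>u. z = r * u \<and> algebraic_int u" if zin: "z \<in> set zs" for z
  proof (cases "z = 0")
    case True
    then show ?thesis by (intro exI[of _ 0]) simp
  next
    case False
    then obtain v where v: "v \<in> supp R" "v \<noteq> 0" "allsum R v = 0" "Z v = scl z v"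
      using bspec[OF zs(2) \<open>z \<in> set zs\<close>] by blast
    have "scl (z\<^sup>2) v = Z (Z v)" unfolding v(4) linD(2)[OF linZ] scl_simps(5) by (simp add: power2_eq_square)
    also have "\<dots> = M (?Q v)"
      unfolding Z_def M_def
      by (simp only: linD[OF linP] linD[OF linA] P_odd(1,2)[OF odd] supp_intros suppA suppB suppP v(1))
    also have "\<dots> = ?Q (pop M [:0, 1:] v)"
      using QM[OF v(1)] by (simp add: pop_pCons[OF linM] lin_0[OF linM] scl_simps)
    finally have ev: "?Q (pop M [:0, 1:] v) = scl (z\<^sup>2) v" by (rule HOL.sym)
    have z2: "z\<^sup>2 \<noteq> 0" using False by simp
    obtain m where m: "good m" "(z\<^sup>2) ^ k = poly [:0, 1:] m ^ k"
      using good_of_eigenvector[OF linQ suppQ QM Qk periodP(2) v(1-3) ev z2] by auto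
    have b2: "(of_nat a)\<^sup>2 = of_nat (a * b)" by (simp add: ab power2_eq_square)
    obtain y where y: "m = of_nat a + of_nat b + of_nat a * y" "algebraic_int y"
      using good_form[OF m(1) b2] ab by auto
    have "m = r\<^sup>2 * (2 + y)" unfolding y(1) r2 using ab by (simp add: algebra_simps)
    moreover have "algebraic_int (2 + y)" by (intro algebraic_int_add algebraic_int_numeral y(2))
    ultimately obtain u where u: "z\<^sup>2 = r\<^sup>2 * u" "algebraic_int u"
      using algebraic_int_factor_of_power_eq[OF m(2) periodP(2), of "r\<^sup>2" "2 + y"] by auto
    have r0: "r \<noteq> 0" using r2 thick by auto
    have "(z / r) ^ 2 = u" using u(1) r0 by (simp add: power_divide)
    then have "algebraic_int (z / r)" using algebraic_int_of_power[of "z / r" 2] u(2) by simp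
    then show ?thesis using r0 by (intro exI[of _ "z / r"]) simp
  qed
  then obtain u where u: "sum_list zs = r * u" "algebraic_int u"
    using algebraic_int_factor_sum_list by blast
  have sum: "sum_list zs = - (of_nat a + 1)" using zs(1) trZ by simp
  have "(of_nat a + 1)\<^sup>2 = (r * u)\<^sup>2" unfolding u(1)[symmetric] sum by (rule power2_minus[symmetric])
  then have "of_int ((int a + 1)\<^sup>2) = of_int (int a) * u\<^sup>2"
    unfolding power_mult_distrib r2 by simp
  then have "int a dvd (int a + 1)\<^sup>2"
    by (rule dvd_of_algebraic_int[OF algebraic_int_power[OF u(2)]])
  moreover have "(int a + 1)\<^sup>2 = int a * (int a + 2) + 1" by (simp add: power2_eq_square algebra_simps)
  ultimately have "int a dvd 1" by (simp add: dvd_add_right_iff)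
  then show False using thick by simp
qed

section \<open>Excluding hexagons, octagons and larger polygons\<close>

text \<open>Apply the expansion of \<open>J\<close> into words to a constant function:
  \<open>J\<close> acts as \<open>card R\<close> and every word as a product of the
  parameters.\<close>

lemma card_hexagon:
  assumes "n = 6"
  shows "of_nat (card R) = \<mu>0 * (1 + of_nat (a * b) + (of_nat (a * b))\<^sup>2 :: complex)"
proof -
  let ?K = "(1 + of_nat a) * (1 + of_nat b + of_nat a * of_nat b
      + of_nat b * of_nat a * of_nat b + of_nat a * of_nat b * of_nat a * of_nat b
      + of_nat b * of_nat a * of_nat b * of_nat a * of_nat b) :: complex"
  obtain x where x: "x \<in> R" using R_ne by blast
  define f where "f = allsum R (ind x)"
  have f: "f \<in> supp R" unfolding f_def by (rule supp_intros(6))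
  have f0: "f x = 1" using x fin_R by (simp add: f_def allsum_def ind_def)
  have Af: "A f = scl (of_nat a) f" and Bf: "B f = scl (of_nat b) f"
    unfolding f_def using A_allsum B_allsum supp_intros(5)[OF x] by blast+
  have "allsum R f = scl (of_nat (card R)) f"
    unfolding f_def by (rule allsum_allsum)
  moreover have "allsum R f = scl ?K f"
  proof -
    let ?g = "scl (1 + of_nat a) f"
    have 1: "f + A f = ?g" unfolding Af by (simp add: scl_simps)
    have "allsum R f = (\<Sum>i<6. wop (alternating False i) ?g)"
      using allsum_words[OF f] unfolding assms 1 wop_def .
    also have "\<dots> = wop [] ?g + wop [False] ?g
        + wop [True,False] ?g + wop [False,True,False] ?g
        + wop [True,False,True,False] ?g
        + wop [False,True,False,True,False] ?g"
      by (simp add: eval_nat_numeral)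
    also have "\<dots> = scl ?K f"
      by (simp only: wop_simps AB_lin(2,4) Af Bf scl_simps(5)) (simp add: scl_def fun_eq_iff algebra_simps)
    finally show ?thesis .
  qed
  ultimately have "scl (of_nat (card R)) f x = scl ?K f x"
    by simp
  then show ?thesis unfolding scl_def f0 \<mu>0_def by (simp add: power2_eq_square algebra_simps)
qed

lemma tr_wop_double:
  "tr R (wop (us @ [c, c] @ ws)) = of_nat (if c then a else b) * tr R (wop (us @ ws))
    + (of_nat (if c then a else b) - 1) * tr R (wop (us @ [c] @ ws))"
proof -
  let ?q = "of_nat (if c then a else b) :: complex"
  have "tr R (wop (us @ [c, c] @ ws)) = tr R (\<lambda>f. scl ?q (wop (us @ ws) f) + scl (?q - 1) (wop (us @ [c] @ ws) f))"
  proof (rule tr_cong)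
    fix f :: "'a \<Rightarrow> complex" assume f: "f \<in> supp R"
    have "wop [c, c] g = scl ?q g + scl (?q - 1) (wop [c] g)" if "g \<in> supp R" for g
      using that by (cases c) (simp_all add: quadA quadB)
    then show "wop (us @ [c, c] @ ws) f = scl ?q (wop (us @ ws) f) + scl (?q - 1) (wop (us @ [c] @ ws) f)"
      unfolding wop_append by (simp only: supp_wop[OF f] linD[OF lin_wop])
  qed
  then show ?thesis by (simp only: tr_simps)
qed

lemma tr_id: "tr R (wop []) = of_nat (card R)"
  using fin_R by (simp add: tr_def ind_def)

lemma trace_M: "tr R M = of_nat (card R)"
proof -
  have "tr R M = tr R (\<lambda>f. wop [] f + wop [False] f + wop [True] f + wop [True, False] f)"
    by (rule tr_cong) (rule M_eq_wop)
  also have "\<dots> = tr R (wop []) + tr R (wop [False]) + tr R (wop [True]) + tr R (wop [True, False])"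
    by (simp only: tr_simps)
  finally show ?thesis using trace_id[of "[False]"] trace_id[of "[True]"] trace_id[of "[True, False]"] n3
    unfolding tr_id by simp
qed

text \<open>Of the sixteen words in the expansion only the empty word, \<open>[False, False]\<close>
  and \<open>[True, True]\<close> have nonzero trace. The longest word has four letters, below
  \<open>n = 6\<close>.\<close>

lemma trace_M_M:
  assumes "n = 6"
  shows "tr R (\<lambda>f. M (M f)) = of_nat (card R) * (1 + of_nat a + of_nat b)"
proof -
  let ?W = "\<lambda>f. wop [] f + wop [False] f + wop [True] f + wop [True, False] f
    + (wop [False] f + wop [False, False] f + wop [False, True] f + wop [False, True, False] f)
    + (wop [True] f + wop [True, False] f + wop [True, True] f + wop [True, True, False] f)
    + (wop [True, False] f + wop [True, False, False] f + wop [True, False, True] f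
       + wop [True, False, True, False] f)"
  have "M (M f) = ?W f" for f
    unfolding M_eq_wop[of "M f"] unfolding M_eq_wop[of f] by (simp add: AB_lin add_ac)
  then have "tr R (\<lambda>f. M (M f)) = tr R ?W" by (intro tr_cong)
  also have "\<dots> = of_nat (card R) * (1 + of_nat a + of_nat b)"
    using tr_wop_double[of "[]" False "[]"] tr_wop_double[of "[]" True "[]"]
      tr_wop_double[of "[]" True "[False]"] tr_wop_double[of "[True]" False "[]"]
      trace_id[of "[False]"] trace_id[of "[True]"] trace_id[of "[True, False]"]
      trace_id[of "[False, True]"] trace_id[of "[False, True, False]"] trace_id[of "[True, False, True]"]
      trace_id[of "[True, False, True, False]"] assms
    unfolding tr_simps tr_id append.simps by (simp del: wop_simps add: algebra_simps)
  finally show ?thesis .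
qed

lemma good_square:
  assumes "n = 6" "good m" "r\<^sup>2 = of_nat (a * b)"
  shows "m = of_nat a + of_nat b + r \<or> m = of_nat a + of_nat b - r"
proof -
  define c where "c = m - of_nat a - of_nat b"
  have "cheb c (of_nat (a * b)) 2 = 0"
    using good_cheb(1)[OF assms(2)] assms(1) by (simp add: c_def)
  then have "c * c - r\<^sup>2 = 0" unfolding assms(3) by (simp add: numeral_2_eq_2)
  then have "(c - r) * (c + r) = 0" by (simp add: power2_eq_square algebra_simps)
  then have "c = r \<or> c = - r" by (auto simp: add_eq_0_iff)
  then show ?thesis by (auto simp: c_def algebra_simps)
qed

text \<open>The Feit--Higman argument: the multiplicities of the eigenvalues of \<open>M\<close> are integers.\<close>
lemma hexagon_square:
  assumes "n = 6"
  shows "\<exists>r::nat. r\<^sup>2 = a * b"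
proof -
  define r where "r = sqrt (real (a * b))"
  have r2: "r\<^sup>2 = real (a * b)" unfolding r_def by (intro real_sqrt_pow2) simp
  have r0: "0 < r" unfolding r_def using thick by simp
  have rc: "(of_real r)\<^sup>2 = (of_nat (a * b) :: complex)"
    using r2 by (metis of_real_of_nat_eq of_real_power)
  define s where "s = real a + real b"
  \<comment> \<open>This polynomial kills \<open>0\<close> and the eigenvalue \<open>s + r\<close>,
    so the trace of \<open>p(M)\<close> isolates the multiplicity of \<open>s - r\<close>, weighted
    by \<open>w\<close>, the value of \<open>p\<close> there.\<close>
  define p where "p = [:0, - of_real (s + r), 1::complex:]"
  have p: "poly p x = x * (x - of_real s - of_real r)" for x by (simp add: p_def algebra_simps)
  obtain zs where zs: "sum_list zs = tr R (\<lambda>f. (\<lambda>f. f) (pop M p f)) - poly p \<mu>0"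
    "\<forall>z\<in>set zs. z = 0 \<or> (\<exists>m. good m \<and> z ^ 1 = poly p m ^ 1)"
    using trace_pop_decomposition[of "\<lambda>f. f" 1 p] lin_intros(1) p by auto
  define w where "w = (of_real ((s - r) * (- 2 * r)) :: complex)"
  have "z = 0 \<or> z = w" if zin: "z \<in> set zs" for z
  proof -
    have "z = 0 \<or> (\<exists>m. good m \<and> z = poly p m)" using bspec[OF zs(2) zin] by simp
    then show ?thesis
    proof (elim disjE exE conjE)
      fix m assume m: "good m" "z = poly p m"
      from good_square[OF assms m(1) rc] show ?thesis
      proof
        assume mm: "m = of_nat a + of_nat b + of_real r"
        show ?thesis unfolding m(2) p mm s_def by (rule disjI1) simp
      next
        assume mm: "m = of_nat a + of_nat b - of_real r"
        show ?thesis unfolding m(2) p mm s_def w_def by (rule disjI2) (simp add: algebra_simps)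
      qed
    qed simp
  qed
  then obtain c where c: "sum_list zs = of_nat c * w" using sum_list_two_valued by blast
  have "tr R (\<lambda>f. pop M p f) = tr R (\<lambda>f. scl (- of_real (s + r)) (M f) + M (M f))"
    by (rule tr_cong) (simp add: p_def pop_pCons[OF linM] lin_0[OF linM] linD[OF linM] lin_diff[OF linM] lin_minus[OF linM] scl_simps)
  also have "\<dots> = - of_real (s + r) * tr R M + tr R (\<lambda>f. M (M f))" by (simp only: tr_simps)
  also have "\<dots> = of_nat (card R) * (1 - of_real r)"
    unfolding trace_M trace_M_M[OF assms] by (simp add: s_def algebra_simps)
  finally have cw: "of_nat c * w = of_nat (card R) * (1 - of_real r) - poly p \<mu>0"
    using zs(1) c by simp
  have mu: "\<mu>0 = of_real ((real a + 1) * (real b + 1))" by (simp add: \<mu>0_def)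
  have N: "(of_nat (card R) :: complex) = of_real ((real a + 1) * (real b + 1) * (1 + r\<^sup>2 + (r\<^sup>2)\<^sup>2))"
    unfolding card_hexagon[OF assms] r2 \<mu>0_def by simp
  have "(of_real (real c * ((s - r) * (- 2 * r))) :: complex) =
      of_real ((real a + 1) * (real b + 1) * (1 + r\<^sup>2 + (r\<^sup>2)\<^sup>2) * (1 - r)
       - ((real a + 1) * (real b + 1)) * ((real a + 1) * (real b + 1) - s - r))"
    using cw unfolding w_def p N mu by simp
  then have eq: "real c * ((s - r) * (- 2 * r)) =
      (real a + 1) * (real b + 1) * (1 + r\<^sup>2 + (r\<^sup>2)\<^sup>2) * (1 - r)
       - ((real a + 1) * (real b + 1)) * ((real a + 1) * (real b + 1) - s - r)"
    by (simp only: of_real_eq_iff)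
  define u where "u = (real a + 1) * (real b + 1)"
  have us: "u - s = 1 + r\<^sup>2" by (simp add: u_def s_def r2 algebra_simps)
  have "real c * ((s - r) * (- 2 * r)) = u * (1 + r\<^sup>2 + (r\<^sup>2)\<^sup>2) * (1 - r) - u * (1 + r\<^sup>2 - r)"
    using eq unfolding u_def[symmetric] us .
  also have "\<dots> = - r * (u * r\<^sup>2 * (1 + r\<^sup>2 - r))" by (simp add: power2_eq_square algebra_simps)
  finally have "- r * (2 * real c * (s - r)) = - r * (u * r\<^sup>2 * (1 + r\<^sup>2 - r))"
    by (simp add: algebra_simps)
  then have "2 * real c * (s - r) = u * r\<^sup>2 * (1 + r\<^sup>2 - r)" using r0 by simp
  \<comment> \<open>Once even powers of \<open>r\<close> are read as powers of \<open>a b\<close>,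
    the multiplicity formula is linear in \<open>r\<close> with rational coefficients; so
    \<open>r\<close> is rational unless its coefficient vanishes.\<close>
  then have lineq: "r * (u * r\<^sup>2 - 2 * real c) = u * r\<^sup>2 * (1 + r\<^sup>2) - 2 * real c * s"
    by (simp add: algebra_simps)
  \<comment> \<open>Otherwise the constant term vanishes as well, forcing
    \<open>1 + a b = a + b\<close>, that is \<open>(a - 1) (b - 1) = 0\<close>, against
    thickness.\<close>
  have "u * r\<^sup>2 - 2 * real c \<noteq> 0"
  proof
    assume 0: "u * r\<^sup>2 - 2 * real c = 0"
    then have "u * r\<^sup>2 * (1 + r\<^sup>2 - s) = 0" using lineq by (simp add: algebra_simps)
    moreover have "0 < u" by (simp add: u_def add_pos_nonneg)
    ultimately have "1 + r\<^sup>2 - s = 0" using r0 by simp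
    then have "(real a - 1) * (real b - 1) = 0" by (simp add: r2 s_def algebra_simps)
    then show False using thick by auto
  qed
  then have "r = (u * r\<^sup>2 * (1 + r\<^sup>2) - 2 * real c * s) / (u * r\<^sup>2 - 2 * real c)"
    using lineq by (simp add: field_simps)
  also have "\<dots> \<in> \<rat>" unfolding r2 u_def s_def
    by (intro Rats_divide Rats_diff Rats_mult Rats_add Rats_1 Rats_of_nat Rats_number_of)
  finally have "r \<in> \<rat>" .
  moreover have "algebraic_int r" unfolding r_def
    by (rule algebraic_int_sqrt[OF algebraic_int_of_nat])
  ultimately have "r \<in> \<int>" by (intro rational_algebraic_int_is_int)
  then obtain i where i: "r = of_int i" by (elim Ints_cases)
  have "real ((nat i)\<^sup>2) = real (a * b)" using r2 r0 unfolding i by simp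
  then have "(nat i)\<^sup>2 = a * b" by (simp only: of_nat_eq_iff)
  then show ?thesis by (rule exI)
qed

lemma \<mu>0_shift: "\<mu>0 - of_nat a - of_nat b = 1 + of_nat a * of_nat b"
  by (simp add: \<mu>0_def algebra_simps)

text \<open>The linear \<open>g\<close> vanishes at \<open>a + b + r\<close>; the only other
  possible good eigenvalue \<open>a + b - r\<close> gives
  \<open>m * poly g m = - 2 r (a + b - r)\<close>. Now that \<open>r\<close> is an integer, this is
  a divisor in the integers.\<close>

lemma not_hexagon: "n \<noteq> 6"
proof
  assume n: "n = 6"
  then have ev: "even n" by simp
  obtain r :: nat where r: "r\<^sup>2 = a * b" using hexagon_square[OF n] by blast
  have rc: "(of_nat r)\<^sup>2 = (of_nat (a * b) :: complex)" by (simp only: r[symmetric] of_nat_power)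
  define g where "g = [:- of_nat a - of_nat b - of_nat r, 1::complex:]"
  have g: "poly g x = x - of_nat a - of_nat b - of_nat r" for x by (simp add: g_def)
  have "2 * int r * (int a + int b - int r) dvd (int a + 1) * (int b + 1) * (1 + int a * int b - int r)"
  proof (rule even_dvd[OF ev, of g])
    show "2 * (Polynomial.degree g + 1) < n" unfolding n g_def by simp
    show "\<mu>0 * poly g \<mu>0 = of_int ((int a + 1) * (int b + 1) * (1 + int a * int b - int r))"
      unfolding g \<mu>0_shift by (simp add: \<mu>0_def)
    fix m assume "good m"
    from good_square[OF n this rc]
    show "\<exists>u. m * poly g m = of_int (2 * int r * (int a + int b - int r)) * u \<and> algebraic_int u"
    proof
      assume mm: "m = of_nat a + of_nat b + of_nat r"
      show ?thesis unfolding mm by (intro exI[of _ 0]) (simp add: g)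
    next
      assume mm: "m = of_nat a + of_nat b - of_nat r"
      show ?thesis unfolding mm by (intro exI[of _ "-1"]) (simp add: g algebra_simps)
    qed
  qed
  moreover have "int 2 \<le> int a" "int 2 \<le> int b" "coprime (int a) (int b)"
    using thick even_coprime[OF ev] by simp_all
  moreover have "(int r)\<^sup>2 = int a * int b" unfolding of_nat_power[symmetric] r by simp
  ultimately show False using no_dvd_hexagon[of "int a" "int b" "int r"] by simp
qed

text \<open>The condition is \<open>c (c^2 - 2 a b) = 0\<close>. The quadratic \<open>g\<close>
  kills the irrational-looking roots and leaves \<open>c = 0\<close>, where
  \<open>m * poly g m = - 2 a b (a + b)\<close>, so no squareness of \<open>a b\<close> has to be
  established first.\<close>

lemma not_octagon: "n \<noteq> 8"
proof
  assume n: "n = 8"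
  then have ev: "even n" by simp
  define g where "g = [:- of_nat a - of_nat b, 1::complex:]\<^sup>2 - [:2 * of_nat a * of_nat b:]"
  have g: "poly g x = (x - of_nat a - of_nat b)\<^sup>2 - 2 * of_nat a * of_nat b" for x
    by (simp add: g_def poly_power power2_eq_square algebra_simps)
  have "int (2 * a * b * (a + b)) dvd int ((a + 1) * (b + 1) * (1 + a\<^sup>2 * b\<^sup>2))"
  proof (rule even_dvd[OF ev, of g])
    have "Polynomial.degree g \<le> 2" unfolding g_def by (rule degree_diff_le) (simp_all add: degree_power_eq)
    then show "2 * (Polynomial.degree g + 1) < n" unfolding n by simp
    show "\<mu>0 * poly g \<mu>0 = of_int (int ((a + 1) * (b + 1) * (1 + a\<^sup>2 * b\<^sup>2)))"
      unfolding g \<mu>0_shift by (simp add: \<mu>0_def power2_eq_square algebra_simps)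
    fix m assume m: "good m"
    define c where "c = m - of_nat a - of_nat b"
    have gm: "m * poly g m = (of_nat a + of_nat b + c) * (c * c - 2 * of_nat a * of_nat b)"
      by (simp add: g c_def power2_eq_square)
    have "cheb c (of_nat (a * b)) 3 = 0"
      using good_cheb(1)[OF m] n by (simp add: c_def)
    then have "c * (c * c - 2 * of_nat a * of_nat b) = 0"
      by (simp add: numeral_3_eq_3 algebra_simps)
    then consider "c = 0" | "c * c - 2 * of_nat a * of_nat b = 0" by auto
    then show "\<exists>u. m * poly g m = of_int (int (2 * a * b * (a + b))) * u \<and> algebraic_int u"
    proof cases
      case 1
      show ?thesis unfolding gm 1 by (intro exI[of _ "-1"]) (simp add: algebra_simps)
    next
      case 2
      show ?thesis unfolding gm 2 by (intro exI[of _ 0]) simp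
    qed
  qed
  then have "2 * a * b * (a + b) dvd (a + 1) * (b + 1) * (1 + a\<^sup>2 * b\<^sup>2)" by (simp only: int_dvd_int_iff)
  then show False using no_dvd_octagon[OF thick even_coprime[OF ev]] by simp
qed

text \<open>On a good eigenvalue, \<open>(X - a - b)^j\<close> is divisible by the
  \<open>j\<close>-th power of the square root of \<open>a b\<close>; at \<open>\<mu>0\<close> it is
  \<open>(1 + a b)^j\<close>, prime to \<open>a b\<close>. Squaring gives the divisibility refuted
  in \<open>no_dvd_power_large\<close>.\<close>

lemma n_less_10: "n < 10"
proof (rule ccontr)
  assume n: "\<not> n < 10"
  have ev: "even n" by (rule odd_impossible)
  \<comment> \<open>The largest exponent that the trace condition permits; it reaches
    \<open>3\<close> exactly from \<open>n = 10\<close> on.\<close>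
  define j where "j = n div 2 - 2"
  have j: "3 \<le> j" "2 * (j + 1) < n" using n ev by (auto simp: j_def)
  define r where "r = csqrt (of_nat (a * b))"
  have r2: "r\<^sup>2 = of_nat (a * b)" unfolding r_def by (rule power2_csqrt)
  have algr: "algebraic_int r" unfolding r_def by (rule algebraic_int_csqrt[OF algebraic_int_of_nat])
  define g where "g = [:- of_nat a - of_nat b, 1::complex:] ^ j"
  have "poly [:- of_nat a - of_nat b, 1::complex:] x = x - of_nat a - of_nat b" for x by simp
  then have g: "poly g x = (x - of_nat a - of_nat b) ^ j" for x by (simp only: g_def poly_power)
  have deg: "2 * (Polynomial.degree g + 1) < n" using j(2) by (simp add: g_def degree_power_eq)
  have "\<exists>u. - (\<mu>0 * poly g \<mu>0) = r ^ j * u \<and> algebraic_int u"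
  proof (rule even_decomposition[OF ev deg])
    fix m assume m: "good m"
    obtain y where y: "m = of_nat a + of_nat b + r * y" "algebraic_int y"
      using good_form[OF m r2 disjI1[OF ev]] by blast
    show "\<exists>u. m * poly g m = r ^ j * u \<and> algebraic_int u"
    proof (intro exI[of _ "(of_nat a + of_nat b + r * y) * y ^ j"] conjI)
      show "m * poly g m = r ^ j * ((of_nat a + of_nat b + r * y) * y ^ j)"
        unfolding g y(1) by (simp add: power_mult_distrib)
      show "algebraic_int ((of_nat a + of_nat b + r * y) * y ^ j)"
        by (intro algebraic_int_add algebraic_int_mult algebraic_int_power algebraic_int_of_nat algr y(2))
    qed
  qed
  then obtain u where u: "- (\<mu>0 * (1 + of_nat a * of_nat b) ^ j) = r ^ j * u" "algebraic_int u"
    unfolding g \<mu>0_shift by blast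
  have "(\<mu>0 * (1 + of_nat a * of_nat b) ^ j)\<^sup>2 = (r ^ j * u)\<^sup>2"
    unfolding u(1)[symmetric] by (rule power2_minus[symmetric])
  also have "\<dots> = of_nat (a * b) ^ j * u\<^sup>2"
    unfolding power_mult_distrib r2[symmetric] by (simp only: power_mult[symmetric] mult.commute)
  finally have sq: "(\<mu>0 * (1 + of_nat a * of_nat b) ^ j)\<^sup>2 = of_nat (a * b) ^ j * u\<^sup>2" .
  have "\<mu>0 = of_nat ((a + 1) * (b + 1))" unfolding \<mu>0_def of_nat_mult of_nat_add of_nat_1 ..
  moreover have "1 + of_nat a * of_nat b = (of_nat (1 + a * b) :: complex)"
    unfolding of_nat_mult of_nat_add of_nat_1 ..
  ultimately have "of_nat ((((a + 1) * (b + 1)) * (1 + a * b) ^ j)\<^sup>2) = of_nat ((a * b) ^ j) * u\<^sup>2"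
    using sq by (simp only: of_nat_mult of_nat_power)
  then have "of_int (int ((((a + 1) * (b + 1)) * (1 + a * b) ^ j)\<^sup>2)) = of_int (int ((a * b) ^ j)) * u\<^sup>2"
    by (simp only: of_int_of_nat_eq)
  then have "int ((a * b) ^ j) dvd int ((((a + 1) * (b + 1)) * (1 + a * b) ^ j)\<^sup>2)"
    by (rule dvd_of_algebraic_int[OF algebraic_int_power[OF u(2)]])
  then have "(a * b) ^ j dvd (((a + 1) * (b + 1)) * (1 + a * b) ^ j)\<^sup>2" by (simp only: int_dvd_int_iff)
  then have d: "(a * b) ^ j dvd ((a + 1) * (b + 1))\<^sup>2 * ((1 + a * b) ^ j)\<^sup>2" by (simp only: power_mult_distrib)
  have "coprime (a * b) (1 + a * b)" by simp
  then have "coprime ((a * b) ^ j) (((1 + a * b) ^ j)\<^sup>2)" by simp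
  then have "(a * b) ^ j dvd ((a + 1) * (b + 1))\<^sup>2"
    using d by (simp only: coprime_dvd_mult_left_iff)
  then show False using no_dvd_power_large[OF thick even_coprime[OF ev] j(1)] by simp
qed

theorem quadrangle: "n = 4 \<and> coprime a b"
proof -
  have "even n" by (rule odd_impossible)
  then have "n = 4 \<or> n = 6 \<or> n = 8" using n3 n_less_10 by presburger
  then show ?thesis using not_hexagon not_octagon even_coprime by auto
qed

end

section \<open>Coxeter groups of thick buildings\<close>

lemma (in monoid) word_prod_Nil [simp]: "word_prod G [] = \<one>"
  by (simp add: word_prod_def)

lemma (in monoid) word_prod_Cons [simp]: "word_prod G (x # xs) = x \<otimes> word_prod G xs"
  by (simp add: word_prod_def)

lemma (in monoid) word_prod_closed: "set xs \<subseteq> carrier G \<Longrightarrow> word_prod G xs \<in> carrier G"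
  by (induction xs) auto

lemma (in monoid) word_prod_append:
  "set xs \<subseteq> carrier G \<Longrightarrow> set ys \<subseteq> carrier G \<Longrightarrow>
    word_prod G (xs @ ys) = word_prod G xs \<otimes> word_prod G ys"
  by (induction xs) (auto simp: word_prod_closed m_assoc)

context coxeter_system
begin

abbreviation wp :: "'w list \<Rightarrow> 'w" where "wp \<equiv> word_prod W"
abbreviation len :: "'w \<Rightarrow> nat" where "len \<equiv> word_length W S"

definition reduced :: "'w list \<Rightarrow> bool" where
  "reduced xs \<longleftrightarrow> set xs \<subseteq> S \<and> len (wp xs) = length xs"

lemma gen_closed [simp]: "s \<in> S \<Longrightarrow> s \<in> carrier W"
  by (rule subsetD[OF generators_closed])

lemma wp_closed [simp]: "set xs \<subseteq> S \<Longrightarrow> wp xs \<in> carrier W"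
  using word_prod_closed generators_closed by blast

lemma wp_append: "set xs \<subseteq> S \<Longrightarrow> set ys \<subseteq> S \<Longrightarrow> wp (xs @ ys) = wp xs \<otimes> wp ys"
  using word_prod_append generators_closed by blast

lemma gen_sq [simp]: assumes "s \<in> S" shows "s \<otimes> s = \<one>"
proof -
  have "s [^] (2::nat) = \<one>" using pow_ord_eq_1[of s] generator_ord[OF assms] assms by simp
  then show ?thesis using assms by (simp add: numeral_2_eq_2)
qed

lemma gen_neq_one [simp]: "s \<in> S \<Longrightarrow> s \<noteq> \<one>"
  using generator_ord[of s] ord_eq_1[of s] by auto

lemma gen_inv [simp]: "s \<in> S \<Longrightarrow> inv s = s"
  by (intro inv_equality) auto

lemma gen_cancel [simp]: "s \<in> S \<Longrightarrow> w \<in> carrier W \<Longrightarrow> s \<otimes> (s \<otimes> w) = w"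
  by (simp add: m_assoc[symmetric])

lemma gen_cancel_right [simp]: "s \<in> S \<Longrightarrow> w \<in> carrier W \<Longrightarrow> (w \<otimes> s) \<otimes> s = w"
  by (simp add: m_assoc)

lemma wp_rev: "set xs \<subseteq> S \<Longrightarrow> wp (rev xs) = inv (wp xs)"
  by (induction xs) (auto simp: wp_append inv_mult_group)

lemma word_exists: "w \<in> carrier W \<Longrightarrow> \<exists>xs. set xs \<subseteq> S \<and> wp xs = w"
proof -
  have "w \<in> generate W S \<Longrightarrow> \<exists>xs. set xs \<subseteq> S \<and> wp xs = w"
  proof (induction rule: generate.induct)
    case one
    show ?case by (intro exI[of _ "[]"]) simp
  next
    case (incl h)
    then show ?case by (intro exI[of _ "[h]"]) simp
  next
    case (inv h)
    then show ?case by (intro exI[of _ "[h]"]) simp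
  next
    case (eng g h)
    then obtain xs ys where "set xs \<subseteq> S" "wp xs = g" "set ys \<subseteq> S" "wp ys = h" by blast
    then show ?case by (intro exI[of _ "xs @ ys"]) (simp add: wp_append)
  qed
  then show "w \<in> carrier W \<Longrightarrow> \<exists>xs. set xs \<subseteq> S \<and> wp xs = w" using generate_carrier by simp
qed

text \<open>All relators have even length, so the parity of a word is the sign character. Through
  \<open>presentation\<close> it excludes that multiplication by a generator preserves the
  length.\<close>

lemma coxeter_equiv_parity:
  "coxeter_equiv W S xs ys \<Longrightarrow> even (length xs) \<longleftrightarrow> even (length ys)"
  by (induction rule: coxeter_equiv.induct) (auto simp: length_concat sum_list_replicate)

lemma wp_eq_parity:
  assumes "set xs \<subseteq> S" "set ys \<subseteq> S" "wp xs = wp ys"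
  shows "even (length xs) \<longleftrightarrow> even (length ys)"
proof -
  have "wp (xs @ rev ys) = \<one>" using assms by (simp add: wp_append wp_rev)
  then have "coxeter_equiv W S (xs @ rev ys) []" using presentation assms by simp
  then show ?thesis using coxeter_equiv_parity by fastforce
qed

lemma len_le: "set xs \<subseteq> S \<Longrightarrow> len (wp xs) \<le> length xs"
  unfolding word_length_def by (rule Least_le) blast

lemma reduced_word_exists: assumes "w \<in> carrier W" shows "\<exists>xs. reduced xs \<and> wp xs = w"
proof -
  have "\<exists>n xs. set xs \<subseteq> S \<and> length xs = n \<and> wp xs = w" using word_exists[OF assms] by blast
  then have "\<exists>xs. set xs \<subseteq> S \<and> length xs = len w \<and> wp xs = w"
    unfolding word_length_def by (rule LeastI_ex)
  then show ?thesis unfolding reduced_def by auto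
qed

lemma len_parity: "set xs \<subseteq> S \<Longrightarrow> even (len (wp xs)) \<longleftrightarrow> even (length xs)"
proof -
  assume S: "set xs \<subseteq> S"
  obtain ys where ys: "reduced ys" "wp ys = wp xs" using reduced_word_exists[of "wp xs"] S by auto
  then have "set ys \<subseteq> S" "len (wp xs) = length ys" by (auto simp: reduced_def)
  then show ?thesis using wp_eq_parity[OF S \<open>set ys \<subseteq> S\<close>] ys(2) by simp
qed

lemma len_gen:
  assumes "s \<in> S" "w \<in> carrier W"
  shows "len (s \<otimes> w) = len w + 1 \<or> len w = len (s \<otimes> w) + 1"
proof -
  have le: "len (s \<otimes> v) \<le> len v + 1 \<and> (even (len (s \<otimes> v)) \<longleftrightarrow> odd (len v))" if "v \<in> carrier W" for v
  proof -
    obtain xs where "reduced xs" "wp xs = v" using reduced_word_exists[OF \<open>v \<in> carrier W\<close>] by blast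
    then show ?thesis using len_le[of "s # xs"] len_parity[of "s # xs"] assms(1)
      by (simp add: reduced_def)
  qed
  from le[OF assms(2)] le[of "s \<otimes> w"] assms
  have "len (s \<otimes> w) \<le> len w + 1" "len w \<le> len (s \<otimes> w) + 1" "even (len (s \<otimes> w)) \<longleftrightarrow> odd (len w)"
    by auto
  then show ?thesis by (cases "len w = len (s \<otimes> w)") auto
qed

lemma len_inv: assumes "w \<in> carrier W" shows "len (inv w) = len w"
proof -
  have "len (inv v) \<le> len v" if "v \<in> carrier W" for v
  proof -
    obtain xs where "reduced xs" "wp xs = v" using reduced_word_exists[OF \<open>v \<in> carrier W\<close>] by blast
    then show ?thesis using len_le[of "rev xs"] by (simp add: reduced_def wp_rev)
  qed
  from this[OF assms] this[of "inv w"] show ?thesis using assms by simp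
qed

lemma len_gen_right:
  assumes "s \<in> S" "w \<in> carrier W"
  shows "len (w \<otimes> s) = len w + 1 \<or> len w = len (w \<otimes> s) + 1"
proof -
  have "len (w \<otimes> s) = len (s \<otimes> inv w)"
    using len_inv[of "w \<otimes> s"] assms by (simp add: inv_mult_group)
  then show ?thesis using len_gen[of s "inv w"] len_inv assms by simp
qed

lemma len_one [simp]: "len \<one> = 0"
  using len_le[of "[]"] by simp

lemma len_eq_0: "w \<in> carrier W \<Longrightarrow> len w = 0 \<Longrightarrow> w = \<one>"
  using reduced_word_exists[of w] by (auto simp: reduced_def)

lemma reduced_Nil [simp]: "reduced []"
  by (simp add: reduced_def)

lemma len_mult_le:
  assumes "u \<in> carrier W" "w \<in> carrier W"
  shows "len (u \<otimes> w) \<le> len u + len w"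
proof -
  obtain xs ys where "reduced xs" "wp xs = u" "reduced ys" "wp ys = w"
    using reduced_word_exists[OF assms(1)] reduced_word_exists[OF assms(2)] by auto
  then show ?thesis using len_le[of "xs @ ys"] by (simp add: reduced_def wp_append)
qed

lemma reduced_append:
  assumes "reduced (xs @ ys)" shows "reduced xs" "reduced ys"
proof -
  have S: "set xs \<subseteq> S" "set ys \<subseteq> S" using assms by (auto simp: reduced_def)
  have "len (wp xs \<otimes> wp ys) = length xs + length ys"
    using assms S by (simp add: reduced_def wp_append)
  then show "reduced xs" "reduced ys"
    using len_mult_le[of "wp xs" "wp ys"] len_le[OF S(1)] len_le[OF S(2)] S
    by (simp_all add: reduced_def)
qed

lemma reduced_rev: "reduced xs \<Longrightarrow> reduced (rev xs)"
  by (simp add: reduced_def wp_rev len_inv)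

lemma reduced_set: "reduced xs \<Longrightarrow> set xs \<subseteq> S"
  by (simp add: reduced_def)

lemma reduced_Cons_iff:
  "reduced (s # xs) \<longleftrightarrow> s \<in> S \<and> reduced xs \<and> len (s \<otimes> wp xs) = len (wp xs) + 1"
proof
  assume "reduced (s # xs)"
  then show "s \<in> S \<and> reduced xs \<and> len (s \<otimes> wp xs) = len (wp xs) + 1"
    using reduced_append(2)[of "[s]" xs] by (simp add: reduced_def)
qed (simp add: reduced_def)

lemma reduced_snoc_iff:
  "reduced (xs @ [s]) \<longleftrightarrow> s \<in> S \<and> reduced xs \<and> len (wp xs \<otimes> s) = len (wp xs) + 1"
proof (cases "set xs \<subseteq> S \<and> s \<in> S")
  case True
  then have "wp (xs @ [s]) = wp xs \<otimes> s" by (simp add: wp_append)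
  then show ?thesis using reduced_append(1)[of xs "[s]"] True by (auto simp: reduced_def)
qed (auto simp: reduced_def)

lemma len_gen_one: "s \<in> S \<Longrightarrow> len s = 1"
  using len_gen[of s \<one>] by simp

end

locale thick_bldg = building W S Ch \<delta>
  for W :: "('w, 'b) monoid_scheme" (structure) and S and Ch :: "'c set" and \<delta> +
  assumes thick: "thick_building W S Ch \<delta>"
begin

fun gallery :: "'c \<Rightarrow> 'w list \<Rightarrow> 'c \<Rightarrow> bool" where
  "gallery C [] D \<longleftrightarrow> C = D \<and> C \<in> Ch"
| "gallery C (s # xs) D \<longleftrightarrow> C \<in> Ch \<and> (\<exists>C'\<in>Ch. \<delta> C C' = s \<and> gallery C' xs D)"

lemma dist_refl [simp]: "C \<in> Ch \<Longrightarrow> \<delta> C C = \<one>"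
  by (simp add: dist_one_iff)

lemma adj_sym: assumes "C \<in> Ch" "D \<in> Ch" "s \<in> S" "\<delta> C D = s" shows "\<delta> D C = s"
proof -
  have "\<delta> C C = s \<otimes> \<delta> D C \<or> \<delta> C C = \<delta> D C"
    by (rule dist_step[OF assms(2,1,1,3,4)])
  moreover have "\<delta> D C \<noteq> \<one>" using assms gen_neq_one dist_one_iff by metis
  ultimately have "s \<otimes> \<delta> D C = \<one>" using assms(1) by auto
  then have "inv s = \<delta> D C"
    using assms dist_closed by (metis gen_closed inv_equality inv_inv inv_closed)
  then show ?thesis using assms(3) by simp
qed

lemma gallery_chambers: "gallery C xs D \<Longrightarrow> C \<in> Ch \<and> D \<in> Ch"
  by (induction xs arbitrary: C) auto

text \<open>The axiom \<open>dist_step_ex\<close> can be followed letter by letter along any word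
  over \<open>S\<close>; it is the converse, \<open>dist_of_gallery\<close>, that rests on
  reducedness.\<close>

lemma gallery_of_dist:
  "set xs \<subseteq> S \<Longrightarrow> C \<in> Ch \<Longrightarrow> D \<in> Ch \<Longrightarrow> \<delta> C D = wp xs \<Longrightarrow> gallery C xs D"
proof (induction xs arbitrary: C)
  case Nil
  then show ?case using dist_one_iff by simp
next
  case (Cons s xs)
  then obtain C' where C': "C' \<in> Ch" "\<delta> C' C = s" "\<delta> C' D = s \<otimes> \<delta> C D"
    using dist_step_ex[of C D s] by auto
  have "\<delta> C' D = wp xs" using C'(3) Cons.prems by simp
  then have "gallery C' xs D" using Cons.IH[of C'] C' Cons.prems by simp
  moreover have "\<delta> C C' = s" using adj_sym[of C' C s] C' Cons.prems by simp
  ultimately show ?case using C'(1) Cons.prems by auto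
qed

lemma dist_of_gallery: "gallery C xs D \<Longrightarrow> reduced xs \<Longrightarrow> \<delta> C D = wp xs"
proof (induction xs arbitrary: C)
  case (Cons s xs)
  then obtain C' where C': "C' \<in> Ch" "\<delta> C C' = s" "gallery C' xs D" by auto
  have s: "s \<in> S" "reduced xs" "len (s \<otimes> wp xs) = len (wp xs) + 1"
    using Cons.prems(2) by (auto simp: reduced_Cons_iff)
  have "\<delta> C' D = wp xs" using Cons.IH C' s by simp
  then show ?case
    using dist_step_up[of C' D C s] C' s gallery_chambers[OF Cons.prems(1)] by simp
qed auto

lemma gallery_append: "gallery C (xs @ ys) D \<longleftrightarrow> (\<exists>E. gallery C xs E \<and> gallery E ys D)"
  by (induction xs arbitrary: C) (auto dest: gallery_chambers)

lemma gallery_rev: "gallery C xs D \<Longrightarrow> set xs \<subseteq> S \<Longrightarrow> gallery D (rev xs) C"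
proof (induction xs arbitrary: C)
  case (Cons s xs)
  then obtain C' where C': "C' \<in> Ch" "\<delta> C C' = s" "gallery C' xs D" "C \<in> Ch" by auto
  have "gallery C' [s] C" using adj_sym[of C C' s] C' Cons.prems by auto
  then show ?case using Cons C' by (auto simp: gallery_append)
qed auto

lemma dist_inv: assumes "C \<in> Ch" "D \<in> Ch" shows "\<delta> D C = inv (\<delta> C D)"
proof -
  obtain xs where xs: "reduced xs" "wp xs = \<delta> C D"
    using reduced_word_exists[OF dist_closed[OF assms]] by blast
  then have "gallery D (rev xs) C"
    using gallery_rev gallery_of_dist[of xs C D] assms reduced_set by simp
  then have "\<delta> D C = wp (rev xs)" using dist_of_gallery reduced_rev xs by blast
  then show ?thesis using xs wp_rev reduced_set by metis
qed

lemma dist_step_right: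
  assumes "C \<in> Ch" "D \<in> Ch" "D' \<in> Ch" "s \<in> S" "\<delta> D D' = s"
  shows "\<delta> C D' = \<delta> C D \<otimes> s \<or> \<delta> C D' = \<delta> C D"
proof -
  have "\<delta> D' D = s" using adj_sym assms by blast
  then have "\<delta> D' C = s \<otimes> \<delta> D C \<or> \<delta> D' C = \<delta> D C" using dist_step[of D C D' s] assms by blast
  then show ?thesis using dist_inv[of D' C] dist_inv[of D C] assms dist_closed[of C D] dist_closed[of D C]
      dist_inv[of C D] inv_mult_group[of s "\<delta> D C"] dist_inv[of C D'] by (metis gen_closed gen_inv)
qed

lemma dist_step_up_right:
  assumes "C \<in> Ch" "D \<in> Ch" "D' \<in> Ch" "s \<in> S" "\<delta> D D' = s"
    "len (\<delta> C D \<otimes> s) = len (\<delta> C D) + 1"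
  shows "\<delta> C D' = \<delta> C D \<otimes> s"
proof -
  have cl: "\<delta> C D \<in> carrier W" by (rule dist_closed[OF assms(1,2)])
  have "\<delta> D' D = s" using adj_sym assms by blast
  moreover have "len (s \<otimes> \<delta> D C) = len (\<delta> D C) + 1"
    using dist_inv[OF assms(1,2)] assms(4,6) cl len_inv[of "\<delta> C D \<otimes> s"] len_inv[OF cl]
    by (simp add: inv_mult_group)
  ultimately have "\<delta> D' C = s \<otimes> \<delta> D C" using dist_step_up[of D C D' s] assms by blast
  then show ?thesis using dist_inv[of D' C] dist_inv[of C D] assms cl by (simp add: inv_mult_group)
qed

lemma adj_trans:
  assumes "C \<in> Ch" "D \<in> Ch" "E \<in> Ch" "s \<in> S" "\<delta> C D = s" "\<delta> D E = s" "C \<noteq> E"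
  shows "\<delta> C E = s"
  using dist_step[of D E C s] assms dist_one_iff[of C E] by auto

lemma chamber_at_dist: "D \<in> Ch \<Longrightarrow> set xs \<subseteq> S \<Longrightarrow> \<exists>C\<in>Ch. \<delta> C D = wp xs"
proof (induction xs)
  case (Cons s xs)
  then obtain C where C: "C \<in> Ch" "\<delta> C D = wp xs" by auto
  then show ?case using dist_step_ex[of C D s] Cons.prems by auto
qed (auto intro!: bexI[of _ D])

lemma third_chamber:
  assumes "C \<in> Ch" "C1 \<in> Ch" "s \<in> S" "\<delta> C C1 = s"
  shows "\<exists>C'\<in>Ch. \<delta> C C' = s \<and> \<delta> C' C1 = s \<and> C' \<noteq> C \<and> C' \<noteq> C1"
proof -
  obtain T where T: "T \<subseteq> panel W Ch \<delta> s C" "card T = 3"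
    using thick assms unfolding thick_building_def by blast
  have "\<not> T \<subseteq> {C, C1}"
  proof
    assume "T \<subseteq> {C, C1}"
    then have "card T \<le> card {C, C1}" by (intro card_mono) auto
    also have "\<dots> \<le> 2" by (simp add: card_insert_if)
    finally show False using T(2) by simp
  qed
  then obtain C' where C': "C' \<in> T" "C' \<noteq> C" "C' \<noteq> C1" by blast
  then have "C' \<in> Ch" "\<delta> C C' = s" using T(1) assms(1) dist_one_iff unfolding panel_def by auto
  moreover have "\<delta> C' C1 = s"
    using adj_trans[of C' C C1 s] adj_sym[of C C' s] assms C' calculation by auto
  ultimately show ?thesis using C' by blast
qed

text \<open>Walk along the gallery while the distance from \<open>C'\<close> is \<open>s\<close>
  times the prefix. At the first step \<open>t\<close> where it stalls, comparison with the
  distances from \<open>C0\<close> leaves \<open>s \<otimes> wp ps = wp ps \<otimes> t\<close>, and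
  this equation deletes \<open>t\<close> from the word.\<close>

lemma exchange_gallery:
  assumes "s \<in> S" "C0 \<in> Ch" "C' \<in> Ch" "\<delta> C' C0 = s"
  shows "reduced (ps @ qs) \<Longrightarrow> gallery C0 ps E \<Longrightarrow> gallery E qs D \<Longrightarrow> \<delta> C' E = s \<otimes> wp ps \<Longrightarrow>
    \<delta> C' D \<noteq> s \<otimes> wp (ps @ qs) \<Longrightarrow>
    \<exists>us t vs. ps @ qs = us @ t # vs \<and> s \<otimes> wp (ps @ qs) = wp (us @ vs)"
proof (induction qs arbitrary: ps E)
  case (Cons t qs)
  have S: "set ps \<subseteq> S" "t \<in> S" "set qs \<subseteq> S" using reduced_set[OF Cons.prems(1)] by auto
  obtain E' where E': "E' \<in> Ch" "\<delta> E E' = t" "gallery E' qs D" "E \<in> Ch" using Cons.prems(3) by auto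
  have g: "gallery C0 (ps @ [t]) E'" using Cons.prems(2) E' by (auto simp: gallery_append)
  have "\<delta> C' E' = \<delta> C' E \<otimes> t \<or> \<delta> C' E' = \<delta> C' E"
    by (rule dist_step_right[OF assms(3) E'(4,1) S(2) E'(2)])
  then show ?case
  proof
    assume "\<delta> C' E' = \<delta> C' E \<otimes> t"
    then have "\<delta> C' E' = s \<otimes> wp (ps @ [t])"
      using Cons.prems(4) S assms(1) by (simp add: wp_append m_assoc)
    then show ?thesis using Cons.IH[of "ps @ [t]" E'] Cons.prems(1,5) g E'(3) by simp
  next
    assume eq: "\<delta> C' E' = \<delta> C' E"
    have "reduced (ps @ [t])" using reduced_append(1)[of "ps @ [t]" qs] Cons.prems(1) by simp
    then have "\<delta> C0 E' = wp ps \<otimes> t" using dist_of_gallery[OF g] S by (simp add: wp_append)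
    then have "\<delta> C' E' = s \<otimes> (wp ps \<otimes> t) \<or> \<delta> C' E' = wp ps \<otimes> t"
      using dist_step[OF assms(2) E'(1) assms(3,1,4)] by simp
    moreover have "s \<otimes> (wp ps \<otimes> t) \<noteq> s \<otimes> wp ps"
    proof
      assume "s \<otimes> (wp ps \<otimes> t) = s \<otimes> wp ps"
      then have "wp ps \<otimes> t = wp ps" using S assms(1) l_cancel by simp
      then show False using S gen_neq_one[OF S(2)] r_cancel_one by simp
    qed
    ultimately have "s \<otimes> wp ps = wp ps \<otimes> t" using eq Cons.prems(4) by auto
    then have "s \<otimes> (wp ps \<otimes> t) = wp ps" using S assms(1) gen_cancel[of s "wp ps"] by simp
    then have "s \<otimes> wp (ps @ t # qs) = wp (ps @ qs)"
      using S assms(1) by (simp add: wp_append m_assoc[symmetric])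
    then show ?thesis by blast
  qed
qed simp

text \<open>By thickness, some chamber \<open>C'\<close> \<open>s\<close>-adjacent to \<open>C0\<close> is at the same distance from \<open>D\<close> as \<open>C0\<close>.
  A minimal gallery from \<open>C0\<close> to \<open>D\<close>, viewed from \<open>C'\<close>, has to stutter, and it does so at the
  letter to be deleted.\<close>
lemma exchange:
  assumes red: "reduced xs" and s: "s \<in> S" and desc: "len (s \<otimes> wp xs) < len (wp xs)"
  shows "\<exists>us t vs. xs = us @ t # vs \<and> s \<otimes> wp xs = wp (us @ vs)"
proof -
  have S: "set xs \<subseteq> S" by (rule reduced_set[OF red])
  obtain D where D: "D \<in> Ch" using chambers_nonempty by blast
  obtain C0 where C0: "C0 \<in> Ch" "\<delta> C0 D = wp xs" using chamber_at_dist[OF D S] by blast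
  obtain C1 where C1: "C1 \<in> Ch" "\<delta> C1 C0 = s" "\<delta> C1 D = s \<otimes> wp xs"
    using dist_step_ex[OF C0(1) D s] C0(2) by auto
  obtain C' where C': "C' \<in> Ch" "\<delta> C1 C' = s" "\<delta> C' C0 = s"
    using third_chamber[OF C1(1) C0(1) s C1(2)] by blast
  have "len (s \<otimes> (s \<otimes> wp xs)) = len (s \<otimes> wp xs) + 1"
    using len_gen[OF s, of "wp xs"] desc S s by simp
  then have "\<delta> C' D = s \<otimes> (s \<otimes> wp xs)"
    using dist_step_up[OF C1(1) D C'(1) s adj_sym[OF C1(1) C'(1) s C'(2)]] C1(3) by simp
  then have "\<delta> C' D = wp xs" using S s by simp
  moreover have "s \<otimes> wp xs \<noteq> wp xs" using desc by auto
  moreover have "gallery C0 xs D" by (rule gallery_of_dist[OF S C0(1) D C0(2)])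
  ultimately show ?thesis
    using exchange_gallery[OF s C0(1) C'(1,3), of "[]" xs C0 D] red C0(1) C'(3) s by simp
qed

lemma exchange_right:
  assumes red: "reduced xs" and s: "s \<in> S" and desc: "len (wp xs \<otimes> s) < len (wp xs)"
  shows "\<exists>us t vs. xs = us @ t # vs \<and> wp xs \<otimes> s = wp (us @ vs)"
proof -
  have S: "set xs \<subseteq> S" by (rule reduced_set[OF red])
  have eq: "s \<otimes> wp (rev xs) = inv (wp xs \<otimes> s)" using S s by (simp add: wp_rev inv_mult_group)
  have "len (s \<otimes> wp (rev xs)) < len (wp (rev xs))"
    unfolding eq using desc S s by (simp add: wp_rev len_inv)
  then obtain us t vs where u: "rev xs = us @ t # vs" "s \<otimes> wp (rev xs) = wp (us @ vs)"
    using exchange[OF reduced_rev[OF red] s] by blast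
  have xs: "xs = rev vs @ t # rev us" using u(1) by (metis append_assoc append_Cons append_Nil rev.simps(2) rev_append rev_rev_ident)
  have cl: "wp xs \<otimes> s \<in> carrier W" using S s by simp
  have "inv (wp xs \<otimes> s) = wp (us @ vs)" using u(2) eq by simp
  then have "wp xs \<otimes> s = inv (wp (us @ vs))" using inv_inv[OF cl] by simp
  also have "\<dots> = wp (rev (us @ vs))" using wp_rev[of "us @ vs"] S xs by auto
  finally show ?thesis using xs by auto
qed

text \<open>Prepend one letter at a time. The exchange condition deletes a letter of
  \<open>xs @ ys\<close> in favour of the new \<open>s\<close>; it cannot lie in \<open>xs\<close>,
  because \<open>s # xs\<close> is reduced, so it is taken from \<open>ys\<close>.\<close>

lemma prefix_of_full_descent:
  assumes w: "w \<in> carrier W" "\<And>s. s \<in> S \<Longrightarrow> len (s \<otimes> w) < len w"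
  shows "reduced xs \<Longrightarrow> \<exists>ys. reduced (xs @ ys) \<and> wp (xs @ ys) = w"
proof (induction xs)
  case Nil
  then show ?case using reduced_word_exists[OF w(1)] by auto
next
  case (Cons s xs)
  have s: "s \<in> S" "reduced xs" using Cons.prems by (auto simp: reduced_Cons_iff)
  obtain ys where ys: "reduced (xs @ ys)" "wp (xs @ ys) = w" using Cons.IH[OF s(2)] by blast
  have S: "set xs \<subseteq> S" "set ys \<subseteq> S" using reduced_set[OF ys(1)] by auto
  obtain us t vs where u: "xs @ ys = us @ t # vs" "s \<otimes> w = wp (us @ vs)"
    using exchange[OF ys(1) s(1)] w(2)[OF s(1)] ys(2) by auto
  have Su: "set us \<subseteq> S" "set vs \<subseteq> S" using reduced_set[OF ys(1)] unfolding u(1) by auto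
  show ?case
  proof (cases "length us < length xs")
    case True
    then obtain r where r: "xs = us @ r" "r @ ys = t # vs"
      using u(1) by (auto simp: append_eq_append_conv2)
    then have "r \<noteq> []" using True by auto
    then obtain vs' where vs': "xs = us @ t # vs'" "vs = vs' @ ys"
      using r by (cases r) auto
    have Sv: "set vs' \<subseteq> S" using Su vs' by auto
    have "(s \<otimes> wp xs) \<otimes> wp ys = wp (us @ vs') \<otimes> wp ys"
      using u(2) ys(2) s(1) S Su Sv unfolding vs'(2) by (simp add: wp_append m_assoc)
    then have "s \<otimes> wp xs = wp (us @ vs')" using r_cancel S Su Sv s(1) by simp
    then have "len (wp (s # xs)) \<le> length (us @ vs')" using len_le[of "us @ vs'"] Su Sv by simp
    then show ?thesis using Cons.prems vs'(1) by (simp add: reduced_def)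
  next
    case False
    then obtain us' where us': "us = xs @ us'" "ys = us' @ t # vs"
      using u(1) by (auto simp: append_eq_append_conv2)
    have "w = s \<otimes> wp (us @ vs)" unfolding u(2)[symmetric] using s(1) w(1) by simp
    then have weq: "w = wp ((s # xs) @ (us' @ vs))" using us'(1) by simp
    moreover have "reduced ((s # xs) @ (us' @ vs))"
      using ys weq s(1) S Su us' unfolding reduced_def by auto
    ultimately show ?thesis by (intro exI[of _ "us' @ vs"]) simp
  qed
qed

lemma longest_descent:
  assumes "longest_element W S w" "s \<in> S"
  shows "len (s \<otimes> w) < len w" "len (w \<otimes> s) < len w"
proof -
  have w: "w \<in> carrier W" using assms by (simp add: longest_element_def)
  have "len (s \<otimes> w) \<le> len w" "len (w \<otimes> s) \<le> len w"
    using assms w by (auto simp: longest_element_def)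
  then show "len (s \<otimes> w) < len w" "len (w \<otimes> s) < len w"
    using len_gen[OF assms(2) w] len_gen_right[OF assms(2) w] by linarith+
qed

lemma longest_unique:
  assumes "longest_element W S w" "longest_element W S v"
  shows "w = v"
proof -
  have w: "w \<in> carrier W" and v: "v \<in> carrier W" using assms by (auto simp: longest_element_def)
  obtain xs where xs: "reduced xs" "wp xs = v" using reduced_word_exists[OF v] by blast
  obtain ys where ys: "reduced (xs @ ys)" "wp (xs @ ys) = w"
    using prefix_of_full_descent[OF w longest_descent(1)[OF assms(1)] xs(1)] by blast
  have "len w \<le> len v" using assms w v by (simp add: longest_element_def)
  then have "ys = []" using ys xs by (auto simp: reduced_def)
  then show ?thesis using ys xs by simp
qed

end

section \<open>Anisotropic automorphisms\<close>

text \<open>A single \<open>w0\<close> can be fixed for all chambers since the longest element is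
  unique (\<open>longest_unique\<close>).\<close>

locale anisotropic_bldg = thick_bldg W S Ch \<delta>
  for W :: "('w, 'b) monoid_scheme" (structure) and S and Ch :: "'c set" and \<delta> +
  fixes \<theta> :: "'c \<Rightarrow> 'c" and \<sigma> :: "'w \<Rightarrow> 'w" and w0 :: 'w
  assumes finite_Ch: "finite Ch"
    and bij_\<theta>: "bij_betw \<theta> Ch Ch" and bij_\<sigma>: "bij_betw \<sigma> S S"
    and \<theta>_adj: "\<lbrakk>C \<in> Ch; D \<in> Ch; s \<in> S\<rbrakk> \<Longrightarrow> \<delta> C D = s \<longleftrightarrow> \<delta> (\<theta> C) (\<theta> D) = \<sigma> s"
    and longest_w0: "longest_element W S w0"
    and dist_\<theta>: "C \<in> Ch \<Longrightarrow> \<delta> C (\<theta> C) = w0"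
begin

lemma one_not_gen [simp]: "\<one> \<notin> S"
  using gen_neq_one by blast

lemma w0_closed [simp]: "w0 \<in> carrier W"
  using longest_w0 by (simp add: longest_element_def)

lemma len_le_w0: "w \<in> carrier W \<Longrightarrow> len w \<le> len w0"
  using longest_w0 by (simp add: longest_element_def)

lemma \<theta>_closed: "C \<in> Ch \<Longrightarrow> \<theta> C \<in> Ch"
  using bij_\<theta> bij_betwE by blast

lemma \<sigma>_closed: "s \<in> S \<Longrightarrow> \<sigma> s \<in> S"
  using bij_\<sigma> bij_betwE by blast

text \<open>Anisotropy forces \<open>\<theta>\<close> to induce opposition on the types.\<close>
lemma w0_conj: assumes "s \<in> S" shows "s \<otimes> w0 = w0 \<otimes> \<sigma> s"
proof -
  obtain C where C: "C \<in> Ch" using chambers_nonempty by blast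
  obtain D where D: "D \<in> Ch" "\<delta> D C = s" "\<delta> D (\<theta> C) = s \<otimes> w0"
    using dist_step_ex[OF C \<theta>_closed[OF C] assms] dist_\<theta>[OF C] by auto
  have "\<delta> (\<theta> C) (\<theta> D) = \<sigma> s"
    using \<theta>_adj[OF C D(1) assms] adj_sym[OF D(1) C assms D(2)] by simp
  then have "\<delta> D (\<theta> D) = s \<otimes> w0 \<otimes> \<sigma> s \<or> \<delta> D (\<theta> D) = s \<otimes> w0"
    using dist_step_right[OF D(1) \<theta>_closed[OF C] \<theta>_closed[OF D(1)] \<sigma>_closed[OF assms]] D(3) by simp
  moreover have "s \<otimes> w0 \<noteq> w0" using longest_descent(1)[OF longest_w0 assms] by auto
  ultimately have "s \<otimes> w0 \<otimes> \<sigma> s = w0" using dist_\<theta>[OF D(1)] by auto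
  then have "w0 \<otimes> \<sigma> s = s \<otimes> w0 \<otimes> \<sigma> s \<otimes> \<sigma> s" by simp
  also have "\<dots> = s \<otimes> w0" using assms \<sigma>_closed[OF assms] by simp
  finally show ?thesis by simp
qed

text \<open>The sphere around \<open>C\<close> of a given Weyl distance; it is used for arbitrary
  elements of \<open>W\<close>, and for a generator it is the panel without
  \<open>C\<close>.\<close>

definition adj :: "'w \<Rightarrow> 'c \<Rightarrow> 'c set" where "adj s C = {D \<in> Ch. \<delta> C D = s}"

lemma finite_adj [simp]: "finite (adj s C)"
  unfolding adj_def using finite_Ch by simp

lemma adj_panel_cases:
  assumes "C \<in> Ch" "s \<in> S" "D \<in> insert C (adj s C)" "E \<in> insert C (adj s C)" "D \<noteq> E"
  shows "\<delta> D E = s"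
proof -
  have D: "D \<in> Ch" "D = C \<or> \<delta> C D = s" and E: "E \<in> Ch" "E = C \<or> \<delta> C E = s"
    using assms by (auto simp: adj_def)
  show ?thesis
    using D E assms adj_sym[of C D s] adj_trans[of D C E s] by metis
qed

lemma opposite_panel_dist:
  assumes "C \<in> Ch" "E \<in> Ch" "\<delta> C E = w" "s \<in> S" "s' \<in> S" "s \<otimes> w = w \<otimes> s'"
    and "C' \<in> insert C (adj s C)" "E' \<in> insert E (adj s' E)"
  shows "\<delta> C' E' = w \<or> \<delta> C' E' = s \<otimes> w"
proof -
  have w: "w \<in> carrier W" using dist_closed assms by blast
  have C': "C' \<in> Ch" "C' = C \<or> \<delta> C' C = s" using assms adj_sym[of C C' s] by (auto simp: adj_def)
  have E': "E' \<in> Ch" "E' = E \<or> \<delta> E E' = s'" using assms by (auto simp: adj_def)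
  have 1: "\<delta> C' E = w \<or> \<delta> C' E = s \<otimes> w" using C' dist_step[of C E C' s] assms by auto
  have "\<delta> C' E' = \<delta> C' E \<or> \<delta> C' E' = \<delta> C' E \<otimes> s'"
    using E' dist_step_right[of C' E E' s'] C' assms by auto
  moreover have "(s \<otimes> w) \<otimes> s' = w" unfolding assms(6) using w assms(5) by simp
  ultimately show ?thesis using 1 assms(6) by auto
qed

text \<open>Two chambers of the panel at the short distance \<open>s \<otimes> w\<close> are
  impossible: they are \<open>s\<close>-adjacent to each other, and \<open>dist_step_up\<close>
  would put one of them at distance \<open>w\<close>. This is uniqueness of the projection to a
  panel.\<close>

lemma opposite_panel_unique:
  assumes "C \<in> Ch" "E' \<in> Ch" "s \<in> S" "w \<in> carrier W" "len (s \<otimes> w) < len w"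
    "C1 \<in> insert C (adj s C)" "C2 \<in> insert C (adj s C)" "\<delta> C1 E' = s \<otimes> w" "\<delta> C2 E' = s \<otimes> w"
  shows "C1 = C2"
proof (rule ccontr)
  assume "C1 \<noteq> C2"
  then have "\<delta> C1 C2 = s" by (rule adj_panel_cases[OF assms(1,3,6,7)])
  moreover have "C1 \<in> Ch" "C2 \<in> Ch" using assms by (auto simp: adj_def)
  moreover have "len (s \<otimes> (s \<otimes> w)) = len (s \<otimes> w) + 1"
    using len_gen[OF assms(3,4)] assms by simp
  ultimately have "\<delta> C1 E' = s \<otimes> (s \<otimes> w)" using dist_step_up[of C2 E' C1 s] assms by simp
  then show False using assms by auto
qed

lemma opposite_inv:
  assumes w: "w \<in> carrier W" and S: "s \<in> S" "s' \<in> S" and eq: "s \<otimes> w = w \<otimes> s'"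
    and desc: "len (s \<otimes> w) < len w"
  shows "s' \<otimes> inv w = inv w \<otimes> s" "len (s' \<otimes> inv w) < len (inv w)"
proof -
  have 1: "inv (w \<otimes> s') = s' \<otimes> inv w" using inv_mult_group[of w s'] w S by simp
  have 2: "inv (s \<otimes> w) = inv w \<otimes> s" using inv_mult_group[of s w] w S by simp
  show "s' \<otimes> inv w = inv w \<otimes> s" unfolding 1[symmetric] 2[symmetric] eq ..
  show "len (s' \<otimes> inv w) < len (inv w)"
    unfolding 1[symmetric] using desc len_inv[OF w] len_inv[of "w \<otimes> s'"] w S unfolding eq by simp
qed

text \<open>Send each chamber of the panel of \<open>E\<close> to its projection on the panel of
  \<open>C\<close>. Uniqueness of projections in the opposite direction makes this
  injective.\<close>

lemma opposite_panel_card_le: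
  assumes "C \<in> Ch" "E \<in> Ch" "\<delta> C E = w" "s \<in> S" "s' \<in> S" "s \<otimes> w = w \<otimes> s'" "len (s \<otimes> w) < len w"
  shows "card (adj s' E) \<le> card (adj s C)"
proof -
  have w: "w \<in> carrier W" using dist_closed assms by blast
  have ex: "\<exists>C'\<in>insert C (adj s C). \<delta> C' E' = s \<otimes> w" if E': "E' \<in> insert E (adj s' E)" for E'
  proof (cases "\<delta> C E' = s \<otimes> w")
    case False
    then have CE: "\<delta> C E' = w" using opposite_panel_dist[OF assms(1-6) _ E', of C] by simp
    have "E' \<in> Ch" using E' assms by (auto simp: adj_def)
    then obtain C' where "C' \<in> Ch" "\<delta> C' C = s" "\<delta> C' E' = s \<otimes> w"
      using dist_step_ex[OF assms(1) _ assms(4), of E'] CE by auto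
    then show ?thesis using adj_sym[of C' C s] assms by (auto simp: adj_def)
  qed auto
  define g where "g E' = (SOME C'. C' \<in> insert C (adj s C) \<and> \<delta> C' E' = s \<otimes> w)" for E'
  have g: "g E' \<in> insert C (adj s C) \<and> \<delta> (g E') E' = s \<otimes> w" if "E' \<in> insert E (adj s' E)" for E'
    unfolding g_def by (rule someI_ex) (use ex[OF that] in blast)
  note inv = opposite_inv[OF w assms(4-7)]
  have inv1: "\<delta> E1 C1 = s' \<otimes> inv w"
    if "\<delta> C1 E1 = s \<otimes> w" "C1 \<in> Ch" "E1 \<in> Ch" for C1 E1
    using dist_inv[of C1 E1] that w assms(4) inv(1) inv_mult_group[of s w] by simp
  have "inj_on g (insert E (adj s' E))"
  proof (rule inj_onI)
    fix E1 E2 assume E: "E1 \<in> insert E (adj s' E)" "E2 \<in> insert E (adj s' E)" "g E1 = g E2"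
    have Ch: "E1 \<in> Ch" "E2 \<in> Ch" "g E1 \<in> Ch" using E g[OF E(1)] assms by (auto simp: adj_def)
    show "E1 = E2"
      by (rule opposite_panel_unique[OF assms(2) Ch(3) assms(5) inv_closed[OF w] inv(2) E(1,2)])
        (use g[OF E(1)] g[OF E(2)] E(3) Ch inv1 in auto)
  qed
  then have "card (insert E (adj s' E)) \<le> card (insert C (adj s C))"
    using g by (intro card_inj_on_le[of g]) auto
  moreover have "E \<notin> adj s' E" "C \<notin> adj s C" using assms by (auto simp: adj_def)
  ultimately show ?thesis by simp
qed

lemma opposite_panel_card:
  assumes "C \<in> Ch" "E \<in> Ch" "\<delta> C E = w" "s \<in> S" "s' \<in> S" "s \<otimes> w = w \<otimes> s'" "len (s \<otimes> w) < len w"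
  shows "card (adj s C) = card (adj s' E)"
proof (rule antisym)
  have w: "w \<in> carrier W" using dist_closed assms by blast
  show "card (adj s' E) \<le> card (adj s C)" by (rule opposite_panel_card_le[OF assms])
  show "card (adj s C) \<le> card (adj s' E)"
    using opposite_panel_card_le[OF assms(2,1) _ assms(5,4) opposite_inv[OF w assms(4-7)]] dist_inv[OF assms(1,2)] assms(3) by simp
qed

text \<open>Two chambers in a common panel have a common opposite chamber, namely one whose projection to
  the panel is a third chamber.\<close>
lemma card_adj_step:
  assumes "C \<in> Ch" "D \<in> Ch" "t \<in> S" "\<delta> C D = t" "s \<in> S"
  shows "card (adj s C) = card (adj s D)"
proof -
  obtain F where F: "F \<in> Ch" "\<delta> C F = t" "\<delta> F D = t"
    using third_chamber[OF assms(1-4)] by blast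
  obtain xs where xs: "set xs \<subseteq> S" "wp xs = inv (t \<otimes> w0)"
    using word_exists[of "inv (t \<otimes> w0)"] assms by auto
  obtain E where E: "E \<in> Ch" "\<delta> E F = wp xs" using chamber_at_dist[OF F(1) xs(1)] by blast
  have FE: "\<delta> F E = t \<otimes> w0" using dist_inv[OF E(1) F(1)] E(2) xs(2) assms by simp
  have up: "len (t \<otimes> \<delta> F E) = len (\<delta> F E) + 1"
    unfolding FE using len_gen[OF assms(3) w0_closed] longest_descent(1)[OF longest_w0 assms(3)] assms by simp
  have "\<delta> C E = w0"
    using dist_step_up[OF F(1) E(1) assms(1,3) F(2) up] FE assms by simp
  moreover have "\<delta> D E = w0"
    using dist_step_up[OF F(1) E(1) assms(2,3) adj_sym[OF F(1) assms(2,3) F(3)] up] FE assms by simp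
  ultimately show ?thesis
    using opposite_panel_card[OF assms(1) E(1) _ assms(5) \<sigma>_closed[OF assms(5)] w0_conj[OF assms(5)]]
      opposite_panel_card[OF assms(2) E(1) _ assms(5) \<sigma>_closed[OF assms(5)] w0_conj[OF assms(5)]]
      longest_descent(1)[OF longest_w0 assms(5)] by simp
qed

lemma card_adj_const:
  assumes "C \<in> Ch" "D \<in> Ch" "s \<in> S"
  shows "card (adj s C) = card (adj s D)"
proof -
  have "gallery C xs D \<Longrightarrow> set xs \<subseteq> S \<Longrightarrow> card (adj s C) = card (adj s D)" for xs
  proof (induction xs arbitrary: C)
    case (Cons t xs)
    then obtain C' where C': "C' \<in> Ch" "\<delta> C C' = t" "gallery C' xs D" "C \<in> Ch" by auto
    then show ?case using card_adj_step[of C C' t s] Cons assms(3) by simp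
  qed simp
  moreover obtain xs where "set xs \<subseteq> S" "wp xs = \<delta> C D"
    using word_exists[OF dist_closed[OF assms(1,2)]] by blast
  ultimately show ?thesis using gallery_of_dist[of xs C D] assms by simp
qed

definition q :: "'w \<Rightarrow> nat" where "q s = card (adj s (SOME C. C \<in> Ch))"

lemma card_adj: "C \<in> Ch \<Longrightarrow> s \<in> S \<Longrightarrow> card (adj s C) = q s"
  unfolding q_def using card_adj_const[of C "SOME C. C \<in> Ch" s] chambers_nonempty some_in_eq by blast

lemma q_ge_2: assumes "s \<in> S" shows "2 \<le> q s"
proof -
  obtain C where C: "C \<in> Ch" using chambers_nonempty by blast
  obtain T where T: "T \<subseteq> panel W Ch \<delta> s C" "card T = 3"
    using thick C assms unfolding thick_building_def by blast
  have "panel W Ch \<delta> s C \<subseteq> insert C (adj s C)"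
    using C dist_one_iff by (auto simp: panel_def adj_def)
  then have "card T \<le> card (insert C (adj s C))" using T(1) by (intro card_mono) auto
  also have "\<dots> \<le> Suc (card (adj s C))" by (simp add: card_insert_if)
  finally show ?thesis using T(2) card_adj[OF C assms] by simp
qed

end

section \<open>Residues of rank two\<close>

locale aniso_pair = anisotropic_bldg W S Ch \<delta> \<theta> \<sigma> w0
  for W :: "('w, 'b) monoid_scheme" (structure) and S and Ch :: "'c set" and \<delta> \<theta> \<sigma> w0 +
  fixes s t :: 'w
  assumes s: "s \<in> S" and t: "t \<in> S" and st: "s \<noteq> t"
begin

definition gen :: "bool \<Rightarrow> 'w" where "gen c = (if c then s else t)"
definition aw :: "bool \<Rightarrow> nat \<Rightarrow> 'w list" where "aw c i = map gen (alternating c i)"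

lemma gen_S [simp]: "gen c \<in> S" using s t by (simp add: gen_def)

lemma gen_eq_iff [simp]: "gen c = gen d \<longleftrightarrow> c = d" using st by (auto simp: gen_def)

lemma gens: "{s, t} = range gen" by (auto simp: gen_def intro: range_eqI[of _ _ True] range_eqI[of _ _ False])

lemma aw_0 [simp]: "aw c 0 = []" by (simp add: aw_def)

lemma aw_snoc: "aw c (Suc i) = aw (\<not> c) i @ [gen c]" by (simp add: aw_def)

lemma aw_Cons: "aw c (Suc i) = gen (if even i then c else \<not> c) # aw c i"
  unfolding aw_def alternating_Cons by simp

lemma length_aw [simp]: "length (aw c i) = i" by (simp add: aw_def)

lemma set_aw: "set (aw c i) \<subseteq> {s, t}" unfolding gens aw_def by auto

lemma set_aw_S [simp]: "set (aw c i) \<subseteq> S" unfolding aw_def by auto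

text \<open>After deletion of an inner letter its two neighbours are equal and cancel, which
  shortens the word once more.\<close>

lemma aw_triple: "aw c i = us @ x # y # z # vs \<Longrightarrow> x = z"
proof (induction us arbitrary: i)
  case Nil
  then obtain k where i: "i = Suc (Suc (Suc k))"
    by (metis length_aw length_Cons append_Nil)
  show ?case using Nil unfolding i aw_Cons[of c] by (cases "even k") auto
next
  case (Cons u us)
  then obtain k where "i = Suc k" by (cases i) auto
  then show ?case using Cons.prems Cons.IH[of k] by (auto simp: aw_Cons)
qed

lemma reduced_aw_Suc: "reduced (aw c (Suc i)) \<Longrightarrow> reduced (aw c i) \<and> reduced (aw (\<not> c) i)"
  using reduced_append(1)[of "aw (\<not> c) i" "[gen c]"] reduced_append(2)[of "[_]" "aw c i"]
  by (metis aw_snoc aw_Cons append_Cons append_Nil)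

lemma reduced_aw_le: "reduced (aw c i) \<Longrightarrow> i \<le> len w0"
  using len_le_w0[of "wp (aw c i)"] by (simp add: reduced_def)

text \<open>This is the order of \<open>s t\<close>, as \<open>ord_eq_n\<close> shows; the
  description by reduced words is the one that the exchange condition can handle. Lengths are
  bounded by that of \<open>w0\<close>, so the maximum exists.\<close>

definition n :: nat where "n = Max {i. \<exists>c. reduced (aw c i)}"

lemma finite_reduced_aw: "finite {i. \<exists>c. reduced (aw c i)}"
  by (rule finite_subset[of _ "{..len w0}"]) (auto dest: reduced_aw_le)

lemma reduced_le_n: "reduced (aw c i) \<Longrightarrow> i \<le> n"
  unfolding n_def by (rule Max_ge[OF finite_reduced_aw]) blast

lemma n_attained: "\<exists>c. reduced (aw c n)"
proof -
  have "0 \<in> {i. \<exists>c. reduced (aw c i)}" by simp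
  then have "{i. \<exists>c. reduced (aw c i)} \<noteq> {}" by blast
  from Max_in[OF finite_reduced_aw this] show ?thesis by (simp add: n_def)
qed

lemma n_ge_2: "2 \<le> n"
proof -
  have "len (s \<otimes> t) \<noteq> 0"
  proof
    assume "len (s \<otimes> t) = 0"
    then have "s \<otimes> t = \<one>" using len_eq_0[of "s \<otimes> t"] s t by simp
    then have "inv t = s" using inv_equality[of s t] s t by simp
    then show False using st t by simp
  qed
  then have "reduced (aw False 2)"
    using len_parity[of "[s, t]"] len_le[of "[s, t]"] s t
    by (auto simp: aw_def gen_def reduced_def numeral_2_eq_2 le_Suc_eq)
  then show ?thesis by (rule reduced_le_n)
qed

text \<open>The longest alternating words \<open>\<dots>st\<close> and \<open>\<dots>ts\<close> agree: deleting an inner letter of an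
  alternating word creates a repetition.\<close>
lemma aw_flip:
  assumes red: "reduced (aw c n)"
  shows "wp (aw c n) = wp (aw (\<not> c) n) \<and> reduced (aw (\<not> c) n)"
proof -
  obtain k where k: "n = Suc k" using n_ge_2 by (cases n) auto
  define r where "r = gen (\<not> c)"
  have r: "r \<in> S" by (simp add: r_def)
  define w where "w = wp (aw c n)"
  have w: "w \<in> carrier W" "len w = n" using red by (simp_all add: w_def reduced_def)
  have "\<not> reduced (aw c n @ [r])"
    using reduced_le_n[of "\<not> c" "Suc n"] by (auto simp: aw_snoc r_def)
  then have desc: "len w = len (w \<otimes> r) + 1"
    using len_gen_right[OF r w(1)] red r by (auto simp: reduced_snoc_iff w_def)
  then obtain us x vs where u: "aw c n = us @ x # vs" "w \<otimes> r = wp (us @ vs)"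
    using exchange_right[OF red r] unfolding w_def by auto
  have S: "set us \<subseteq> S" "x \<in> S" "set vs \<subseteq> S"
    using reduced_set[OF red] unfolding u(1) by auto
  have "w = wp (aw (\<not> c) n)"
  proof (cases "vs = []")
    case True
    then have "us = aw (\<not> c) k" "x = gen c" using u(1) unfolding k aw_snoc by auto
    then have "w = wp us \<otimes> x" using S u(1) True by (simp add: w_def wp_append)
    then have "wp us \<otimes> (x \<otimes> r) = wp us" using u(2) True S r by (simp add: m_assoc)
    then have "x \<otimes> r = \<one>" using S r r_cancel_one by simp
    then have "inv r = x" using inv_equality[of x r] S r by simp
    then have "r = x" using r by simp
    then show ?thesis using \<open>x = gen c\<close> by (simp add: r_def)
  next
    case vs: False
    show ?thesis
    proof (cases "us = []")
      case True
      then have "vs = aw c k" using u(1) unfolding k aw_Cons by simp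
      then have "w \<otimes> r = wp (aw c k)" using u(2) True by simp
      then have "w \<otimes> r \<otimes> r = wp (aw c k) \<otimes> r" by simp
      then have "w = wp (aw c k @ [r])" using w r by (simp add: wp_append)
      then show ?thesis unfolding k aw_snoc r_def by simp
    next
      case False
      then obtain us' y where us: "us = us' @ [y]" by (metis rev_exhaust)
      obtain z vs' where vsz: "vs = z # vs'" using vs by (cases vs) auto
      have "y = z" using aw_triple[of c n us' y x z vs'] u(1) us vsz by simp
      then have "wp (us @ vs) = wp (us' @ vs')"
        using S unfolding us vsz by (simp add: wp_append m_assoc)
      then have "len (w \<otimes> r) \<le> length (us' @ vs')"
        using u(2) len_le[of "us' @ vs'"] S unfolding us vsz by simp
      moreover have "n = length (us' @ vs') + 3"
        using arg_cong[OF u(1), of length] unfolding us vsz by simp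
      ultimately show ?thesis using desc w(2) by simp
    qed
  qed
  then show ?thesis using w by (simp add: w_def reduced_def)
qed

lemma reduced_aw_n: "reduced (aw c n)"
proof -
  obtain d where "reduced (aw d n)" using n_attained by blast
  then show ?thesis using aw_flip[of d] by (cases c; cases d) auto
qed

definition wJ :: 'w where "wJ = wp (aw True n)"

lemma wJ_eq: "wp (aw c n) = wJ"
  using aw_flip[OF reduced_aw_n, of True] by (cases c) (auto simp: wJ_def)

lemma reduced_aw: "i \<le> n \<Longrightarrow> reduced (aw c i)"
proof (induction rule: inc_induct)
  case base
  show ?case by (rule reduced_aw_n)
next
  case (step i)
  then show ?case using reduced_aw_Suc by blast
qed

lemma len_aw: "i \<le> n \<Longrightarrow> len (wp (aw c i)) = i"
  using reduced_aw[of i c] by (simp add: reduced_def)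

lemma wp_aw_neq:
  assumes "0 < i" "i < n"
  shows "wp (aw True i) \<noteq> wp (aw False i)"
proof
  assume eq: "wp (aw True i) = wp (aw False i)"
  obtain k where k: "i = Suc k" using assms(1) by (cases i) auto
  have "wp (aw False (Suc i)) = wp (aw True i) \<otimes> gen False" by (simp add: aw_snoc wp_append)
  also have "\<dots> = wp (aw True k) \<otimes> gen False \<otimes> gen False" unfolding eq by (simp add: k aw_snoc wp_append)
  also have "\<dots> = wp (aw True k)" by simp
  finally have "len (wp (aw False (Suc i))) \<le> k" using len_le[of "aw True k"] by simp
  then show False using len_aw[of "Suc i" False] assms k by simp
qed

lemma wp_aw_inj:
  assumes "wp (aw c i) = wp (aw d j)" "i < n" "j \<le> n"
  shows "i = j \<and> (0 < i \<longrightarrow> c = d)"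
proof -
  have "i = j" using len_aw[of i c] len_aw[of j d] assms by simp
  then show ?thesis using wp_aw_neq[of i] assms by (cases c; cases d) auto
qed

definition U :: "'w set" where "U = {wp xs |xs. set xs \<subseteq> {s, t}}"

lemma U_closed: "u \<in> U \<Longrightarrow> u \<in> carrier W"
proof -
  assume "u \<in> U"
  then obtain xs where "u = wp xs" "set xs \<subseteq> {s, t}" by (auto simp: U_def)
  moreover then have "set xs \<subseteq> S" using s t by auto
  ultimately show ?thesis by simp
qed

lemma U_mult: "u \<in> U \<Longrightarrow> gen c \<otimes> u \<in> U"
proof -
  assume "u \<in> U"
  then obtain xs where "u = wp xs" "set xs \<subseteq> {s, t}" by (auto simp: U_def)
  then show ?thesis unfolding U_def by (intro CollectI exI[of _ "gen c # xs"]) (auto simp: gen_def)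
qed

lemma U_mult_right: "u \<in> U \<Longrightarrow> u \<otimes> gen c \<in> U"
proof -
  assume "u \<in> U"
  then obtain xs where "u = wp xs" "set xs \<subseteq> {s, t}" by (auto simp: U_def)
  moreover then have "wp (xs @ [gen c]) = u \<otimes> gen c" using s t by (subst wp_append) auto
  ultimately show ?thesis unfolding U_def
    by (intro CollectI exI[of _ "xs @ [gen c]"]) (auto simp: gen_def)
qed

lemma aw_in_U: "wp (aw c i) \<in> U"
  unfolding U_def using set_aw by blast

text \<open>Appending a letter to an alternating word prolongs it or cancels its last letter. At
  length \<open>n\<close>, where it can no longer grow, the word is first replaced by the other
  alternating word for \<open>wJ\<close>, and then the letter cancels.\<close>

lemma U_aw: assumes "u \<in> U" shows "\<exists>c i. i \<le> n \<and> u = wp (aw c i)"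
proof -
  have "set xs \<subseteq> {s, t} \<Longrightarrow> \<exists>c i. i \<le> n \<and> wp xs = wp (aw c i)" for xs
  proof (induction xs rule: rev_induct)
    case Nil
    show ?case by (intro exI[of _ True] exI[of _ 0]) simp
  next
    case (snoc x xs)
    then obtain c i where ci: "i \<le> n" "wp xs = wp (aw c i)" by auto
    obtain d where d: "x = gen d" using snoc.prems unfolding gens by auto
    have "set xs \<subseteq> S" using snoc.prems s t by auto
    then have eq: "wp (xs @ [x]) = wp (aw c i) \<otimes> gen d" using ci(2) d by (simp add: wp_append)
    have snoc_d: "wp (aw d (Suc k)) \<otimes> gen d = wp (aw (\<not> d) k)" for k
      by (simp add: aw_snoc wp_append)
    consider (zero) "i = 0" | (same) k where "i = Suc k" "c = d" | (up) "c = (\<not> d)" "i < n"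
      | (top) "c = (\<not> d)" "i = n" using ci(1) by (cases "c = d"; cases i; cases "i = n") auto
    then show ?case
    proof cases
      case zero
      then show ?thesis using eq n_ge_2 by (intro exI[of _ d] exI[of _ 1]) (simp add: aw_snoc)
    next
      case same
      then show ?thesis using eq snoc_d ci(1) by (intro exI[of _ "\<not> d"] exI[of _ k]) simp
    next
      case up
      then show ?thesis using eq by (intro exI[of _ d] exI[of _ "Suc i"]) (simp add: aw_snoc wp_append)
    next
      case top
      obtain k where k: "n = Suc k" using n_ge_2 by (cases n) auto
      have "wp (aw c i) = wp (aw d (Suc k))" using top wJ_eq k by metis
      then show ?thesis using eq snoc_d k by (intro exI[of _ "\<not> d"] exI[of _ k]) simp
    qed
  qed
  then show ?thesis using assms unfolding U_def by auto
qed

text \<open>The power \<open>(s t)^i\<close> is an alternating word of length \<open>2 * i\<close>.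
  Cutting it in the middle and inverting one half shows that it is trivial exactly when the two
  alternating words of length \<open>i\<close> agree, which happens for \<open>i = n\<close> and for
  no smaller positive \<open>i\<close>.\<close>

lemma ord_eq_n: "ord (s \<otimes> t) = n"
proof -
  have stc: "s \<otimes> t \<in> carrier W" using s t by simp
  have pow: "(s \<otimes> t) [^] i = wp (aw False (2 * i))" for i :: nat
  proof (induction i)
    case (Suc i)
    have "aw False (2 * Suc i) = aw False (2 * i) @ [s, t]" by (simp add: aw_snoc gen_def)
    then show ?case using Suc s t by (simp add: wp_append)
  qed simp
  have split: "wp (aw c (i + j)) = wp (aw (if even j then c else \<not> c) i) \<otimes> wp (aw c j)" for c i j
  proof (induction j arbitrary: c)
    case (Suc j)
    then show ?case by (simp add: aw_snoc wp_append m_assoc)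
  qed simp
  have rev: "rev (aw c i) = aw (if even i then \<not> c else c) i" for c i
  proof (induction i arbitrary: c)
    case (Suc i)
    have "rev (aw c (Suc i)) = gen c # rev (aw (\<not> c) i)" by (simp add: aw_snoc)
    also have "\<dots> = gen c # aw (if even i then c else \<not> c) i" using Suc.IH[of "\<not> c"] by simp
    also have "\<dots> = aw (if even i then c else \<not> c) (Suc i)" unfolding aw_Cons by (cases "even i") auto
    finally show ?case by simp
  qed simp
  have one: "(s \<otimes> t) [^] i = \<one> \<longleftrightarrow> wp (aw True i) = wp (aw False i)" for i :: nat
  proof -
    define d where "d \<longleftrightarrow> odd i"
    have rev': "rev (aw (\<not> d) i) = aw False i"
      using rev[of "\<not> d" i] by (cases "even i") (simp_all add: d_def)
    have "wp (aw False (2 * i)) = wp (aw d i) \<otimes> wp (aw False i)"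
      using split[of False i i] by (simp add: mult_2 d_def)
    also have "wp (aw False i) = inv (wp (aw (\<not> d) i))"
      unfolding rev'[symmetric] by (rule wp_rev) simp
    finally have "(s \<otimes> t) [^] i = \<one> \<longleftrightarrow> wp (aw d i) \<otimes> inv (wp (aw (\<not> d) i)) = \<one>" unfolding pow by simp
    also have "\<dots> \<longleftrightarrow> wp (aw d i) = wp (aw (\<not> d) i)"
      using inv_solve_right'[of \<one> "wp (aw d i)" "wp (aw (\<not> d) i)"] by auto
    finally show ?thesis by (cases d) auto
  qed
  have "(s \<otimes> t) [^] n = \<one>" unfolding one wJ_eq ..
  then have dvd: "ord (s \<otimes> t) dvd n" using pow_eq_id[OF stc] by simp
  then have pos: "0 < ord (s \<otimes> t)" using n_ge_2 by (auto intro!: gr0I)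
  have "\<not> ord (s \<otimes> t) < n"
    using one[of "ord (s \<otimes> t)"] pow_ord_eq_1[OF stc] wp_aw_neq[OF pos] by auto
  then show ?thesis using dvd_imp_le[OF dvd] n_ge_2 by simp
qed

end

text \<open>By pigeonhole two restricted powers coincide, and injectivity cancels the smaller one;
  this gives a period common to all points.\<close>

lemma funpow_period:
  assumes "finite R" "inj_on f R" "f ` R \<subseteq> R"
  shows "\<exists>k>0. \<forall>x\<in>R. (f ^^ k) x = x"
proof -
  have closed: "(f ^^ i) x \<in> R" if "x \<in> R" for i x
    using that assms(3) by (induction i) auto
  have inj: "(f ^^ i) x = (f ^^ i) y \<longleftrightarrow> x = y" if "x \<in> R" "y \<in> R" for i x y
    using that closed inj_onD[OF assms(2)] by (induction i) auto
  let ?F = "\<lambda>i. restrict (f ^^ i) R"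
  have "range ?F \<subseteq> R \<rightarrow>\<^sub>E R" using closed by (auto simp: PiE_iff)
  then have "finite (range ?F)" using finite_PiE[OF assms(1), of "\<lambda>_. R"] assms(1) by (auto intro: finite_subset)
  then have "\<not> inj ?F" using finite_imageD[of ?F UNIV] infinite_UNIV_nat by blast
  then obtain i j where ij: "i < j" "?F i = ?F j"
    unfolding inj_def by (metis linorder_neqE_nat)
  have "(f ^^ (j - i)) x = x" if x: "x \<in> R" for x
  proof -
    have "(f ^^ i) x = (f ^^ j) x" using fun_cong[OF ij(2), of x] x by simp
    also have "\<dots> = (f ^^ (i + (j - i))) x" using ij(1) by simp
    also have "\<dots> = (f ^^ i) ((f ^^ (j - i)) x)" by (simp only: funpow_add o_apply)
    finally show ?thesis using inj[OF x closed[OF x]] by simp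
  qed
  then show ?thesis using ij(1) by (intro exI[of _ "j - i"]) simp
qed

lemma successively_neq_alternating:
  "successively (\<noteq>) cs \<Longrightarrow> \<exists>c. cs = alternating c (length cs)"
proof (induction cs rule: rev_induct)
  case (snoc d cs)
  then have "successively (\<noteq>) cs" "cs \<noteq> [] \<longrightarrow> last cs \<noteq> d" by (auto simp: successively_append_iff)
  then obtain c where c: "cs = alternating c (length cs)" using snoc.IH by blast
  show ?case
  proof (cases cs)
    case (Cons x xs)
    then have "last cs = c" using c by (metis alternating.simps(2) last_snoc length_Cons)
    then have "c = (\<not> d)" using \<open>cs \<noteq> [] \<longrightarrow> last cs \<noteq> d\<close> Cons by auto
    then show ?thesis using c by (intro exI[of _ d]) simp
  qed (intro exI[of _ d], simp)
qed simp

context anisotropic_bldg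
begin

text \<open>The geometric form of the Hecke relation \<open>T_r T_w = T_{r w}\<close> for increasing
  length: the larger sphere is a disjoint union of smaller spheres around the
  \<open>r\<close>-neighbours.\<close>

lemma adj_mult:
  assumes "C \<in> Ch" "r \<in> S" "w \<in> carrier W" "len (r \<otimes> w) = len w + 1"
  shows "adj (r \<otimes> w) C = (\<Union>C'\<in>adj r C. adj w C')"
    and "C1 \<in> adj r C \<Longrightarrow> C2 \<in> adj r C \<Longrightarrow> C1 \<noteq> C2 \<Longrightarrow> adj w C1 \<inter> adj w C2 = {}"
proof -
  show "adj (r \<otimes> w) C = (\<Union>C'\<in>adj r C. adj w C')"
  proof (intro Set.set_eqI iffI)
    fix D assume "D \<in> adj (r \<otimes> w) C"
    then have D: "D \<in> Ch" "\<delta> C D = r \<otimes> w" by (auto simp: adj_def)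
    obtain C' where C': "C' \<in> Ch" "\<delta> C' C = r" "\<delta> C' D = r \<otimes> (r \<otimes> w)"
      using dist_step_ex[OF assms(1) D(1) assms(2)] D(2) by auto
    then show "D \<in> (\<Union>C'\<in>adj r C. adj w C')"
      using adj_sym[OF C'(1) assms(1,2) C'(2)] assms D by (auto simp: adj_def)
  next
    fix D assume "D \<in> (\<Union>C'\<in>adj r C. adj w C')"
    then obtain C' where C': "C' \<in> Ch" "\<delta> C C' = r" "D \<in> Ch" "\<delta> C' D = w" by (auto simp: adj_def)
    then show "D \<in> adj (r \<otimes> w) C"
      using dist_step_up[OF C'(1,3) assms(1,2) C'(2)] assms by (simp add: adj_def)
  qed
  show "adj w C1 \<inter> adj w C2 = {}" if "C1 \<in> adj r C" "C2 \<in> adj r C" "C1 \<noteq> C2"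
  proof (rule ccontr)
    assume "adj w C1 \<inter> adj w C2 \<noteq> {}"
    then obtain D where D: "D \<in> Ch" "\<delta> C1 D = w" "\<delta> C2 D = w" by (auto simp: adj_def)
    have C12: "C1 \<in> Ch" "C2 \<in> Ch" using that by (auto simp: adj_def)
    have "\<delta> C1 C2 = r" using adj_panel_cases[OF assms(1,2)] that by blast
    then have "\<delta> C1 D = r \<otimes> w"
      using dist_step_up[OF C12(2) D(1) C12(1) assms(2)] D(3) assms(4) by simp
    then show False using D(2) assms(4) by simp
  qed
qed

lemma adj_eq_panel:
  assumes "C \<in> Ch" "r \<in> S" "C' \<in> adj r C"
  shows "adj r C' = insert C (adj r C - {C'})"
proof -
  have C': "C' \<in> Ch" "\<delta> C C' = r" "\<delta> C' C = r" using assms adj_sym[of C C' r] by (auto simp: adj_def)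
  have "r \<noteq> \<one>" using assms(2) by (rule gen_neq_one)
  then have "C' \<notin> adj r C'" using C'(1) by (simp add: adj_def)
  show ?thesis
  proof (intro Set.set_eqI iffI)
    fix D assume D: "D \<in> adj r C'"
    then have "D = C \<or> \<delta> C D = r"
      using adj_panel_cases[OF C'(1) assms(2), of C D] C' assms(1) by (auto simp: adj_def)
    then show "D \<in> insert C (adj r C - {C'})" using D \<open>C' \<notin> adj r C'\<close> by (auto simp: adj_def)
  next
    fix D assume D: "D \<in> insert C (adj r C - {C'})"
    have "\<delta> C' D = r"
    proof (cases "D = C")
      case False
      then show ?thesis using D adj_panel_cases[OF assms(1,2), of C' D] assms(3) by auto
    qed (simp add: C'(3))
    then show "D \<in> adj r C'" using D assms by (auto simp: adj_def)
  qed
qed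

lemma adj_sym_iff: "C \<in> Ch \<Longrightarrow> D \<in> Ch \<Longrightarrow> r \<in> S \<Longrightarrow> D \<in> adj r C \<longleftrightarrow> C \<in> adj r D"
  using adj_sym[of C D r] adj_sym[of D C r] by (auto simp: adj_def)

end

lemma (in group) cancel_left:
  "x \<otimes> y = x \<otimes> z \<Longrightarrow> x \<in> carrier G \<Longrightarrow> y \<in> carrier G \<Longrightarrow> z \<in> carrier G \<Longrightarrow> y = z"
  by simp

lemma (in group) cancel_right:
  "y \<otimes> x = z \<otimes> x \<Longrightarrow> x \<in> carrier G \<Longrightarrow> y \<in> carrier G \<Longrightarrow> z \<in> carrier G \<Longrightarrow> y = z"
  by simp

context aniso_pair
begin

definition base :: 'c where "base = (SOME C. C \<in> Ch)"
definition R :: "'c set" where "R = {D \<in> Ch. \<delta> base D \<in> U}"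

lemma base_Ch: "base \<in> Ch"
  unfolding base_def using chambers_nonempty some_in_eq by blast

lemma R_Ch: "D \<in> R \<Longrightarrow> D \<in> Ch" by (simp add: R_def)

lemma finite_R [simp]: "finite R" unfolding R_def using finite_Ch by simp

lemma one_U: "\<one> \<in> U" unfolding U_def by (intro CollectI exI[of _ "[]"]) simp

lemma base_R: "base \<in> R" using base_Ch one_U by (simp add: R_def)

lemma adj_R: assumes "D \<in> R" "E \<in> adj (gen c) D" shows "E \<in> R"
  using dist_step_right[of base D E "gen c"] assms base_Ch U_mult_right[of "\<delta> base D" c]
  by (auto simp: R_def adj_def)

lemma gallery_U: "gallery C xs D \<Longrightarrow> set xs \<subseteq> {s, t} \<Longrightarrow> \<delta> C D \<in> U"
proof (induction xs arbitrary: C)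
  case Nil
  then show ?case using one_U by auto
next
  case (Cons x xs)
  then obtain C' where C': "C' \<in> Ch" "\<delta> C C' = x" "gallery C' xs D" "C \<in> Ch" by auto
  obtain c where c: "x = gen c" using Cons.prems(2) unfolding gens by auto
  have "\<delta> C' D \<in> U" using Cons.IH[OF C'(3)] Cons.prems by simp
  then show ?case
    using dist_step[of C' D C x] C' c gallery_chambers[OF C'(3)] U_mult[of "\<delta> C' D" c] by auto
qed

lemma dist_R: assumes "D \<in> R" "E \<in> R" shows "\<delta> D E \<in> U"
proof -
  obtain xs ys where x: "wp xs = \<delta> base D" "set xs \<subseteq> {s, t}" and y: "wp ys = \<delta> base E" "set ys \<subseteq> {s, t}"
    using assms unfolding R_def U_def by auto
  have S: "set xs \<subseteq> S" "set ys \<subseteq> S" using x y s t by auto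
  have "gallery D (rev xs @ ys) E"
    unfolding gallery_append
    using gallery_rev[OF gallery_of_dist[OF S(1) base_Ch R_Ch[OF assms(1)]] S(1)]
      gallery_of_dist[OF S(2) base_Ch R_Ch[OF assms(2)]] x(1) y(1) by auto
  then show ?thesis by (rule gallery_U) (use x y in auto)
qed

lemma R_closed: assumes "D \<in> R" "E \<in> Ch" "\<delta> D E \<in> U" shows "E \<in> R"
proof -
  obtain xs ys where x: "wp xs = \<delta> base D" "set xs \<subseteq> {s, t}" and y: "wp ys = \<delta> D E" "set ys \<subseteq> {s, t}"
    using assms unfolding R_def U_def by auto
  have S: "set xs \<subseteq> S" "set ys \<subseteq> S" using x y s t by auto
  have "gallery base (xs @ ys) E"
    unfolding gallery_append
    using gallery_of_dist[OF S(1) base_Ch R_Ch[OF assms(1)]]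
      gallery_of_dist[OF S(2) R_Ch[OF assms(1)] assms(2)] x(1) y(1) by auto
  then have "\<delta> base E \<in> U" by (rule gallery_U) (use x y in auto)
  then show ?thesis using assms(2) by (simp add: R_def)
qed

text \<open>The action of conjugation by \<open>wJ\<close> on the two letters: trivial for even
  \<open>n\<close>, the exchange for odd \<open>n\<close>.\<close>

definition fl :: "bool \<Rightarrow> bool" where "fl c = (if even n then c else \<not> c)"

lemma wJ_closed [simp]: "wJ \<in> carrier W" by (simp add: wJ_def)

lemma wJ_conj: "gen c \<otimes> wJ = wJ \<otimes> gen (fl c)"
proof -
  obtain k where k: "n = Suc k" using n_ge_2 by (cases n) auto
  define d where "d = (if even k then c else \<not> c)"
  have d: "gen c = gen (if even k then d else \<not> d)" by (simp add: d_def)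
  have "wJ = gen c \<otimes> wp (aw d k)"
    using wJ_eq[of d] unfolding k aw_Cons d[symmetric] by simp
  then have 1: "gen c \<otimes> wJ = wp (aw d k)" by simp
  have "wJ = wp (aw d k) \<otimes> gen (\<not> d)"
    using wJ_eq[of "\<not> d"] unfolding k aw_snoc by (simp add: wp_append)
  then have 2: "wJ \<otimes> gen (\<not> d) = wp (aw d k)" by simp
  have "fl c = (\<not> d)" by (simp add: fl_def d_def k)
  then show ?thesis using 1 2 by simp
qed

lemma len_wJ: "len wJ = n" using len_aw[of n True] by (simp add: wJ_def)

lemma wJ_descent: "len (gen c \<otimes> wJ) < len wJ"
proof -
  obtain k where k: "n = Suc k" using n_ge_2 by (cases n) auto
  have eq: "wJ = wp (aw (\<not> fl c) k) \<otimes> gen (fl c)"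
    using wJ_eq[of "fl c"] unfolding k aw_snoc by (simp add: wp_append)
  have "gen c \<otimes> wJ = wJ \<otimes> gen (fl c)" by (rule wJ_conj)
  also have "\<dots> = wp (aw (\<not> fl c) k)" by (subst eq) simp
  finally show ?thesis using len_aw[of k "\<not> fl c"] len_wJ k by simp
qed

text \<open>For odd \<open>n\<close> opposite panels of the residue have different types, and
  opposite panels have equally many chambers.\<close>

lemma q_odd: assumes "odd n" shows "q s = q t"
proof -
  obtain C where C: "C \<in> Ch" "\<delta> C base = wJ"
    using chamber_at_dist[OF base_Ch, of "aw True n"] by (auto simp: wJ_def)
  have "s \<otimes> wJ = wJ \<otimes> t" using wJ_conj[of True] assms by (simp add: fl_def gen_def)
  moreover have "len (s \<otimes> wJ) < len wJ" using wJ_descent[of True] by (simp add: gen_def)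
  ultimately have "card (adj s C) = card (adj t base)"
    by (rule opposite_panel_card[OF C(1) base_Ch C(2) s t])
  then show ?thesis using card_adj C(1) base_Ch s t by simp
qed

text \<open>Every reduced word is the beginning of one for \<open>w0\<close>. Both alternating words
  of length \<open>n\<close> represent \<open>wJ\<close>, so one completion \<open>ys\<close> serves
  both.\<close>

lemma w0_factor: "\<exists>ys. \<forall>c. reduced (aw c n @ ys) \<and> wp (aw c n @ ys) = w0"
proof -
  obtain ys where ys: "reduced (aw True n @ ys)" "wp (aw True n @ ys) = w0"
    using prefix_of_full_descent[OF w0_closed longest_descent(1)[OF longest_w0] reduced_aw_n] by blast
  have S: "set ys \<subseteq> S" using reduced_set[OF ys(1)] by simp
  have eq: "wp (aw c n @ ys) = w0" for c using ys(2) S wJ_eq by (simp add: wp_append)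
  have "reduced (aw c n @ ys)" for c
    using ys eq[of c] S unfolding reduced_def by simp
  then show ?thesis using eq by blast
qed

definition ws :: "'w list" where "ws = (SOME ys. \<forall>c. reduced (aw c n @ ys) \<and> wp (aw c n @ ys) = w0)"
definition v :: 'w where "v = wp ws"

lemma ws: "reduced (aw c n @ ws)" "wp (aw c n @ ws) = w0"
  using someI_ex[OF w0_factor] unfolding ws_def by auto

lemma ws_S [simp]: "set ws \<subseteq> S" using reduced_set[OF ws(1)[of True]] by simp

lemma v_closed [simp]: "v \<in> carrier W" by (simp add: v_def)

lemma wJv: "wJ \<otimes> v = w0"
  using ws(2)[of True] by (simp add: wp_append wJ_def v_def)

lemma reduced_aw_ws: "i \<le> n \<Longrightarrow> reduced (aw c i @ ws)"
proof (induction rule: inc_induct)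
  case base
  show ?case by (rule ws(1))
next
  case (step i)
  then show ?case using reduced_append(2)[of "[_]" "aw c i @ ws"] unfolding aw_Cons by (metis append_Cons append_Nil)
qed

text \<open>Cut a minimal gallery from \<open>D\<close> to \<open>F\<close> after its alternating
  part. Since every alternating word of length at most \<open>n\<close> followed by
  \<open>ws\<close> is reduced, distances from the whole residue to \<open>F\<close> factor through
  the cutting point, the projection of \<open>F\<close>.\<close>

lemma gate:
  assumes "D \<in> R" "F \<in> Ch" "\<delta> D F = w0"
  shows "\<exists>E\<in>R. \<forall>D'\<in>R. \<delta> D' F = \<delta> D' E \<otimes> v"
proof -
  have "gallery D (aw True n @ ws) F"
    using gallery_of_dist[of "aw True n @ ws" D F] assms R_Ch ws(2) by simp
  then obtain E where E: "gallery D (aw True n) E" "gallery E ws F" unfolding gallery_append by blast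
  have ER: "E \<in> R" using R_closed[OF assms(1)] gallery_U[OF E(1) set_aw] gallery_chambers[OF E(1)] by blast
  show ?thesis
  proof (intro bexI[of _ E] ballI ER)
    fix D' assume D': "D' \<in> R"
    obtain c i where ci: "i \<le> n" "\<delta> D' E = wp (aw c i)" using U_aw[OF dist_R[OF D' ER]] by blast
    have "gallery D' (aw c i) E" by (rule gallery_of_dist) (use ci D' ER R_Ch in auto)
    then have "gallery D' (aw c i @ ws) F" using E(2) unfolding gallery_append by blast
    then have "\<delta> D' F = wp (aw c i @ ws)" using dist_of_gallery reduced_aw_ws[OF ci(1)] by blast
    then show "\<delta> D' F = \<delta> D' E \<otimes> v" using ci(2) by (simp add: wp_append v_def)
  qed
qed

text \<open>The projection of \<open>\<theta> D\<close> to the residue \<open>R\<close>.\<close>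
definition vt :: "'c \<Rightarrow> 'c" where
  "vt D = (SOME E. E \<in> R \<and> (\<forall>D'\<in>R. \<delta> D' (\<theta> D) = \<delta> D' E \<otimes> v))"

lemma vt: assumes "D \<in> R" shows "vt D \<in> R" "D' \<in> R \<Longrightarrow> \<delta> D' (\<theta> D) = \<delta> D' (vt D) \<otimes> v"
proof -
  have "\<exists>E. E \<in> R \<and> (\<forall>D'\<in>R. \<delta> D' (\<theta> D) = \<delta> D' E \<otimes> v)"
    using gate[OF assms \<theta>_closed[OF R_Ch[OF assms]] dist_\<theta>[OF R_Ch[OF assms]]] by blast
  from someI_ex[OF this] show "vt D \<in> R" "D' \<in> R \<Longrightarrow> \<delta> D' (\<theta> D) = \<delta> D' (vt D) \<otimes> v"
    unfolding vt_def by blast+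
qed

lemma dist_vt: assumes "D \<in> R" shows "\<delta> D (vt D) = wJ"
proof -
  have "\<delta> D (vt D) \<otimes> v = wJ \<otimes> v"
    using vt(2)[OF assms assms] dist_\<theta>[OF R_Ch[OF assms]] wJv by simp
  then show ?thesis using U_closed[OF dist_R[OF assms vt(1)[OF assms]]] by simp
qed

text \<open>The distance from \<open>vt D\<close> to \<open>\<theta> D'\<close> is computed twice:
  through \<open>vt D'\<close>, and by one length-increasing step from \<open>\<theta> D\<close>.
  The results agree because \<open>v\<close> carries the type \<open>\<sigma> (gen c)\<close> to
  \<open>gen (fl c)\<close>.\<close>

lemma vt_adj:
  assumes D: "D \<in> R" "D' \<in> R" "\<delta> D D' = gen c"
  shows "\<delta> (vt D) (vt D') = gen (fl c)"
proof -
  let ?r = "\<sigma> (gen c)"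
  have Ch: "D \<in> Ch" "D' \<in> Ch" "vt D \<in> Ch" "vt D' \<in> Ch" using D vt(1) R_Ch by auto
  have uU: "\<delta> (vt D) (vt D') \<in> carrier W" by (rule dist_closed[OF Ch(3,4)])
  have r: "?r \<in> S" by (rule \<sigma>_closed) simp
  have th: "\<delta> (\<theta> D) (\<theta> D') = ?r" using \<theta>_adj[OF Ch(1,2), of "gen c"] D(3) by simp
  have e1: "\<delta> (vt D) (\<theta> D) = v" using vt(2)[OF D(1) vt(1)[OF D(1)]] Ch by simp
  have e2: "\<delta> (vt D) (\<theta> D') = \<delta> (vt D) (vt D') \<otimes> v" by (rule vt(2)[OF D(2) vt(1)[OF D(1)]])
  \<comment> \<open>Conjugation by \<open>w0 = wJ v\<close> and by \<open>wJ\<close> are both known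
    on generators; cancelling \<open>wJ\<close> leaves that by \<open>v\<close>.\<close>
  have "wJ \<otimes> (gen (fl c) \<otimes> v) = wJ \<otimes> (v \<otimes> ?r)"
  proof -
    have "wJ \<otimes> (gen (fl c) \<otimes> v) = gen c \<otimes> wJ \<otimes> v" unfolding wJ_conj by (simp add: m_assoc)
    also have "\<dots> = gen c \<otimes> w0" using m_assoc[of "gen c" wJ v] wJv by simp
    also have "\<dots> = w0 \<otimes> ?r" by (rule w0_conj) simp
    also have "\<dots> = wJ \<otimes> (v \<otimes> ?r)" using m_assoc[of wJ v ?r] r wJv by simp
    finally show ?thesis .
  qed
  then have "gen (fl c) \<otimes> v = v \<otimes> ?r"
    by (rule cancel_left) (use r in simp_all)
  then have vr: "v \<otimes> ?r = gen (fl c) \<otimes> v" by (rule HOL.sym)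
  have "reduced (aw (fl c) 1 @ ws)" by (rule reduced_aw_ws) (use n_ge_2 in simp)
  then have up: "len (v \<otimes> ?r) = len v + 1"
    unfolding vr by (simp add: aw_snoc reduced_Cons_iff v_def)
  have "\<delta> (vt D) (\<theta> D') = v \<otimes> ?r"
    using dist_step_up_right[OF Ch(3) \<theta>_closed[OF Ch(1)] \<theta>_closed[OF Ch(2)] r th] e1 up by simp
  then have "\<delta> (vt D) (vt D') \<otimes> v = gen (fl c) \<otimes> v" using e2 vr by simp
  then show ?thesis by (rule cancel_right) (use uU in simp_all)
qed

lemma vt_gallery:
  "D \<in> R \<Longrightarrow> gallery D (map gen cs) D' \<Longrightarrow> D' \<in> R \<and> gallery (vt D) (map gen (map fl cs)) (vt D')"
proof (induction cs arbitrary: D)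
  case Nil
  then have "D = D'" by simp
  then show ?case using Nil vt(1)[of D] R_Ch[of "vt D"] by simp
next
  case (Cons c cs)
  then obtain E where E: "E \<in> Ch" "\<delta> D E = gen c" "gallery E (map gen cs) D'" by auto
  have ER: "E \<in> R" using adj_R[OF Cons.prems(1)] E by (simp add: adj_def)
  show ?case using Cons.IH[OF ER E(3)] vt_adj[OF Cons.prems(1) ER E(2)]
      R_Ch[OF vt(1)[OF Cons.prems(1)]] R_Ch[OF vt(1)[OF ER]] by auto
qed

lemma map_fl_alternating: "map fl (alternating c i) = alternating (fl c) i"
  by (induction i arbitrary: c) (auto simp: fl_def)

lemma vt_dist:
  assumes "D \<in> R" "D' \<in> R" "\<delta> D D' = wp (aw c i)" "i \<le> n"
  shows "\<delta> (vt D) (vt D') = wp (aw (fl c) i)"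
proof -
  have "gallery D (aw c i) D'"
    by (rule gallery_of_dist[OF set_aw_S R_Ch[OF assms(1)] R_Ch[OF assms(2)] assms(3)])
  then have "gallery D (map gen (alternating c i)) D'" by (simp only: aw_def)
  then have "gallery (vt D) (aw (fl c) i) (vt D')"
    using vt_gallery[OF assms(1), of "alternating c i" D'] unfolding map_fl_alternating aw_def by simp
  then show ?thesis using dist_of_gallery reduced_aw[OF assms(4)] by blast
qed

lemma inj_vt: "inj_on vt R"
proof (rule inj_onI)
  fix D D' assume D: "D \<in> R" "D' \<in> R" "vt D = vt D'"
  obtain c i where ci: "i \<le> n" "\<delta> D D' = wp (aw c i)" using U_aw[OF dist_R[OF D(1,2)]] by blast
  have "wp (aw (fl c) i) = \<one>" using vt_dist[OF D(1,2) ci(2,1)] D(3) R_Ch[OF vt(1)[OF D(2)]] by simp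
  then have "i = 0" using len_aw[OF ci(1), of "fl c"] by simp
  then show "D = D'" using ci(2) dist_one_iff[OF R_Ch[OF D(1)] R_Ch[OF D(2)]] by simp
qed

lemma bij_vt: "bij_betw vt R R"
proof -
  have "vt ` R \<subseteq> R" using vt(1) by blast
  then show ?thesis using endo_inj_surj[OF finite_R _ inj_vt] inj_vt by (simp add: bij_betw_def)
qed

lemma vt_adj_iff:
  assumes "D \<in> R" "D' \<in> R"
  shows "\<delta> (vt D) (vt D') = gen (fl c) \<longleftrightarrow> \<delta> D D' = gen c"
proof
  assume a: "\<delta> (vt D) (vt D') = gen (fl c)"
  obtain d i where di: "i \<le> n" "\<delta> D D' = wp (aw d i)" using U_aw[OF dist_R[OF assms]] by blast
  have "wp (aw (fl d) i) = gen (fl c)" using vt_dist[OF assms di(2,1)] a by simp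
  moreover then have "i = 1" using len_aw[OF di(1), of "fl d"] len_gen_one[of "gen (fl c)"] by simp
  ultimately have "fl d = fl c" by (simp add: aw_snoc)
  then show "\<delta> D D' = gen c" using di(2) \<open>i = 1\<close> by (cases "even n") (auto simp: aw_snoc fl_def)
qed (rule vt_adj[OF assms])

section \<open>The Hecke algebra of a residue\<close>

definition hop :: "'w \<Rightarrow> ('c \<Rightarrow> complex) \<Rightarrow> 'c \<Rightarrow> complex" where
  "hop r f = (\<lambda>C. if C \<in> R then \<Sum>D\<in>adj r C. f D else 0)"

text \<open>Pullback along \<open>vt\<close>, so that diagonal entries of \<open>vop\<close> after a
  word compare \<open>vt C\<close> with \<open>C\<close>.\<close>

definition vop :: "('c \<Rightarrow> complex) \<Rightarrow> 'c \<Rightarrow> complex" where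
  "vop f = (\<lambda>C. if C \<in> R then f (vt C) else 0)"

abbreviation hword :: "bool list \<Rightarrow> ('c \<Rightarrow> complex) \<Rightarrow> 'c \<Rightarrow> complex" where
  "hword cs \<equiv> foldr (\<lambda>c. if c then hop s else hop t) cs"

lemma hword_Cons: "hword (c # cs) f = hop (gen c) (hword cs f)"
  by (simp add: gen_def)

lemma lin_hop: "lin (hop r)"
  by (auto simp: lin_def hop_def scl_def fun_eq_iff sum.distrib sum_distrib_left)

lemma supp_hop: "hop r f \<in> supp R"
  by (simp add: hop_def supp_def)

text \<open>From a neighbour \<open>C'\<close> in the panel one returns to \<open>C\<close> or
  reaches another neighbour: the double sum counts \<open>C\<close> once per \<open>C'\<close> and
  every other chamber of the panel once less.\<close>

lemma hop_hop:
  assumes "f \<in> supp R"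
  shows "hop (gen c) (hop (gen c) f) = scl (of_nat (q (gen c))) f + scl (of_nat (q (gen c)) - 1) (hop (gen c) f)"
proof
  fix C
  show "hop (gen c) (hop (gen c) f) C
      = (scl (of_nat (q (gen c))) f + scl (of_nat (q (gen c)) - 1) (hop (gen c) f)) C"
  proof (cases "C \<in> R")
    case True
    let ?A = "adj (gen c) C"
    have C: "C \<in> Ch" by (rule R_Ch[OF True])
    have "\<one> \<noteq> gen c" using gen_neq_one[OF gen_S] by (rule not_sym)
    then have "C \<notin> ?A" using C by (simp add: adj_def)
    have inner: "(\<Sum>D\<in>adj (gen c) C'. f D) = f C + ((\<Sum>D\<in>?A. f D) - f C')" if "C' \<in> ?A" for C'
      unfolding adj_eq_panel[OF C gen_S that]
      using \<open>C \<notin> ?A\<close> that by (simp add: sum_diff1)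
    have "hop (gen c) (hop (gen c) f) C = (\<Sum>C'\<in>?A. \<Sum>D\<in>adj (gen c) C'. f D)"
      using True adj_R[OF True] by (simp add: hop_def)
    also have "\<dots> = (\<Sum>C'\<in>?A. f C + ((\<Sum>D\<in>?A. f D) - f C'))"
      by (rule sum.cong[OF HOL.refl inner])
    also have "\<dots> = of_nat (card ?A) * f C + (of_nat (card ?A) * (\<Sum>D\<in>?A. f D) - (\<Sum>D\<in>?A. f D))"
      by (simp add: sum.distrib sum_subtractf)
    finally show ?thesis
      using True card_adj[OF C gen_S] by (simp add: scl_def hop_def algebra_simps)
  next
    case False
    then show ?thesis using assms by (simp add: hop_def scl_def supp_def)
  qed
qed

lemma hop_allsum: "hop (gen c) (allsum R f) = scl (of_nat (q (gen c))) (allsum R f)"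
proof
  fix C
  show "hop (gen c) (allsum R f) C = scl (of_nat (q (gen c))) (allsum R f) C"
  proof (cases "C \<in> R")
    case True
    have "(\<Sum>D\<in>adj (gen c) C. allsum R f D) = (\<Sum>D\<in>adj (gen c) C. \<Sum>y\<in>R. f y)"
      by (rule sum.cong) (auto simp: allsum_def dest: adj_R[OF True])
    then show ?thesis using True card_adj[OF R_Ch[OF True] gen_S]
      by (simp add: hop_def allsum_def scl_def)
  qed (simp add: hop_def allsum_def scl_def)
qed

lemma sum_hop: "(\<Sum>C\<in>R. hop (gen c) f C) = of_nat (q (gen c)) * (\<Sum>C\<in>R. f C)"
proof -
  have "(\<Sum>C\<in>R. hop (gen c) f C) = (\<Sum>C\<in>R. \<Sum>D\<in>R. if D \<in> adj (gen c) C then f D else 0)"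
  proof (rule sum.cong[OF HOL.refl])
    fix C assume C: "C \<in> R"
    have "R \<inter> adj (gen c) C = adj (gen c) C" using adj_R[OF C] by blast
    then show "hop (gen c) f C = (\<Sum>D\<in>R. if D \<in> adj (gen c) C then f D else 0)"
      using C by (simp add: hop_def sum.inter_restrict[symmetric])
  qed
  also have "\<dots> = (\<Sum>D\<in>R. \<Sum>C\<in>R. if C \<in> adj (gen c) D then f D else 0)"
    by (subst sum.swap, intro sum.cong HOL.refl) (simp add: adj_sym_iff[OF R_Ch R_Ch gen_S])
  also have "\<dots> = (\<Sum>D\<in>R. of_nat (q (gen c)) * f D)"
  proof (rule sum.cong[OF HOL.refl])
    fix D assume D: "D \<in> R"
    have "R \<inter> adj (gen c) D = adj (gen c) D" using adj_R[OF D] by blast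
    then show "(\<Sum>C\<in>R. if C \<in> adj (gen c) D then f D else 0) = of_nat (q (gen c)) * f D"
      using card_adj[OF R_Ch[OF D] gen_S[of c]] by (simp add: sum.inter_restrict[symmetric])
  qed
  finally show ?thesis by (simp add: sum_distrib_left)
qed

lemma allsum_hop: "allsum R (hop (gen c) f) = scl (of_nat (q (gen c))) (allsum R f)"
  by (auto simp: allsum_def scl_def fun_eq_iff sum_hop)

text \<open>For a reduced word the iterated neighbour sums never count a chamber twice, by
  \<open>adj_mult\<close>, and run over one sphere.\<close>

lemma hword_sum:
  assumes "reduced (map gen cs)" "C \<in> R" "f \<in> supp R"
  shows "hword cs f C = (\<Sum>D\<in>adj (wp (map gen cs)) C. f D)"
  using assms(1,2)
proof (induction cs arbitrary: C)
  case Nil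
  have "adj \<one> C = {C}" using R_Ch[OF Nil(2)] dist_one_iff by (auto simp: adj_def)
  then show ?case by simp
next
  case (Cons c cs)
  have red: "reduced (map gen cs)" "len (gen c \<otimes> wp (map gen cs)) = len (wp (map gen cs)) + 1"
    using Cons.prems(1) by (simp_all add: reduced_Cons_iff)
  have w: "wp (map gen cs) \<in> carrier W" using reduced_set[OF red(1)] by simp
  note mult = adj_mult[OF R_Ch[OF Cons.prems(2)] gen_S w red(2)]
  have "hword (c # cs) f C = (\<Sum>C'\<in>adj (gen c) C. hword cs f C')"
    unfolding hword_Cons using Cons.prems(2) by (simp add: hop_def)
  also have "\<dots> = (\<Sum>C'\<in>adj (gen c) C. \<Sum>D\<in>adj (wp (map gen cs)) C'. f D)"
    by (rule sum.cong[OF HOL.refl Cons.IH[OF red(1) adj_R[OF Cons.prems(2)]]])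
  also have "\<dots> = (\<Sum>D\<in>(\<Union>C'\<in>adj (gen c) C. adj (wp (map gen cs)) C'). f D)"
    by (rule sum.UNION_disjoint[symmetric]) (use mult(2) in auto)
  finally show ?case unfolding mult(1)[symmetric] by simp
qed

text \<open>The elements are sorted by the last letter of their alternating word: no letter or
  \<open>t\<close> with length below \<open>n\<close>, or \<open>s\<close> with positive length. The
  element \<open>wJ\<close>, which has both forms, is counted with \<open>s\<close>, so that the
  second family is the first multiplied by \<open>s\<close> on the right.\<close>

lemma U_split: "U = (\<lambda>i. wp (aw False i)) ` {..<n} \<union> (\<lambda>i. wp (aw True (Suc i))) ` {..<n}"
proof (intro equalityI subsetI)
  fix u assume "u \<in> U"
  then obtain c i where ci: "i \<le> n" "u = wp (aw c i)" using U_aw by blast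
  consider "i = 0" | "i = n" | "0 < i" "i < n" using ci(1) by linarith
  then show "u \<in> (\<lambda>i. wp (aw False i)) ` {..<n} \<union> (\<lambda>i. wp (aw True (Suc i))) ` {..<n}"
  proof cases
    case 1
    then have "u = wp (aw False 0)" using ci(2) by simp
    then show ?thesis using n_ge_2 by (intro UnI1 image_eqI[of _ _ 0]) auto
  next
    case 2
    obtain k where k: "n = Suc k" using n_ge_2 by (cases n) auto
    have "u = wp (aw True (Suc k))" using ci(2) 2 wJ_eq[of c] wJ_eq[of True] k by simp
    then show ?thesis using k by (intro UnI2 image_eqI[of _ _ k]) auto
  next
    case 3
    show ?thesis
    proof (cases c)
      case False
      then show ?thesis using ci(2) 3 by (intro UnI1 image_eqI[of _ _ i]) auto
    next
      case True
      obtain k where "i = Suc k" using 3 by (cases i) auto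
      then show ?thesis using ci(2) 3 True by (intro UnI2 image_eqI[of _ _ k]) auto
    qed
  qed
next
  fix u assume "u \<in> (\<lambda>i. wp (aw False i)) ` {..<n} \<union> (\<lambda>i. wp (aw True (Suc i))) ` {..<n}"
  then show "u \<in> U" using aw_in_U by auto
qed

lemma sum_U: "(\<Sum>u\<in>U. g u) = (\<Sum>i<n. g (wp (aw False i)) + g (wp (aw True (Suc i))) :: complex)"
proof -
  have inj1: "inj_on (\<lambda>i. wp (aw False i)) {..<n}"
  proof (rule inj_onI)
    fix i j assume "i \<in> {..<n}" "j \<in> {..<n}" "wp (aw False i) = wp (aw False j)"
    then have "i < n" "j < n" "len (wp (aw False (i))) = len (wp (aw False (j)))" by simp_all
    moreover have "len (wp (aw False (i))) = i" by (rule len_aw) (use \<open>i < n\<close> in simp)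
    moreover have "len (wp (aw False (j))) = j" by (rule len_aw) (use \<open>j < n\<close> in simp)
    ultimately show "i = j" by linarith
  qed
  have inj2: "inj_on (\<lambda>i. wp (aw True (Suc i))) {..<n}"
  proof (rule inj_onI)
    fix i j assume "i \<in> {..<n}" "j \<in> {..<n}" "wp (aw True (Suc i)) = wp (aw True (Suc j))"
    then have "i < n" "j < n" "len (wp (aw True (Suc i))) = len (wp (aw True (Suc j)))" by simp_all
    moreover have "len (wp (aw True (Suc i))) = Suc i" by (rule len_aw) (use \<open>i < n\<close> in simp)
    moreover have "len (wp (aw True (Suc j))) = Suc j" by (rule len_aw) (use \<open>j < n\<close> in simp)
    ultimately show "i = j" by linarith
  qed
  have "wp (aw False i) \<noteq> wp (aw True (Suc j))" if "i < n" "j < n" for i j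
  proof
    assume "wp (aw False i) = wp (aw True (Suc j))"
    from wp_aw_inj[OF this that(1)] that(2) show False by auto
  qed
  then have "(\<lambda>i. wp (aw False i)) ` {..<n} \<inter> (\<lambda>i. wp (aw True (Suc i))) ` {..<n} = {}"
    by blast
  then show ?thesis
    unfolding U_split
    by (subst sum.union_disjoint) (simp_all add: sum.reindex[OF inj1] sum.reindex[OF inj2] sum.distrib)
qed

lemma finite_U: "finite U" unfolding U_split by simp

lemma sum_R:
  assumes "C \<in> R"
  shows "(\<Sum>D\<in>R. f D) = (\<Sum>u\<in>U. \<Sum>D\<in>adj u C. f D :: complex)"
proof -
  have "R = (\<Union>u\<in>U. adj u C)"
  proof (intro equalityI subsetI)
    fix D assume "D \<in> R"
    then show "D \<in> (\<Union>u\<in>U. adj u C)" using dist_R[OF assms] R_Ch by (auto simp: adj_def)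
  next
    fix D assume "D \<in> (\<Union>u\<in>U. adj u C)"
    then show "D \<in> R" using R_closed[OF assms, of D] by (auto simp: adj_def)
  qed
  then have "(\<Sum>D\<in>R. f D) = (\<Sum>D\<in>(\<Union>u\<in>U. adj u C). f D)" by simp
  also have "\<dots> = (\<Sum>u\<in>U. \<Sum>D\<in>adj u C. f D)"
    by (rule sum.UNION_disjoint) (auto simp: finite_U finite_Ch adj_def)
  finally show ?thesis .
qed

text \<open>The residue is the disjoint union of the spheres over \<open>U\<close>, and each sphere
  sum is a Hecke word. The split of \<open>U\<close> factors \<open>1 + hop s\<close> out on the
  right.\<close>

lemma allsum_hwords:
  assumes f: "f \<in> supp R"
  shows "allsum R f = (\<Sum>i<n. hword (alternating False i) (f + hop s f))"
proof
  fix C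
  have ev: "(\<Sum>i\<in>I. g i) x = (\<Sum>i\<in>I. g i x)" for g :: "nat \<Rightarrow> 'c \<Rightarrow> complex" and I x
    by (induction I rule: infinite_finite_induct) auto
  have linh: "lin (hword cs)" for cs
  proof (induction cs)
    case (Cons c cs)
    show ?case unfolding hword_Cons by (rule lin_intros(2)[OF lin_hop Cons])
  qed (simp add: lin_intros(1))
  have split: "hword (alternating False i) (f + hop s f)
      = hword (alternating False i) f + hword (alternating True (Suc i)) f" for i
    unfolding linD(1)[OF linh] by simp
  show "allsum R f C = (\<Sum>i<n. hword (alternating False i) (f + hop s f)) C"
  proof (cases "C \<in> R")
    case True
    have "allsum R f C = (\<Sum>u\<in>U. \<Sum>D\<in>adj u C. f D)"
      using sum_R[OF True] True by (simp add: allsum_def)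
    also have "\<dots> = (\<Sum>i<n. (\<Sum>D\<in>adj (wp (aw False i)) C. f D) + (\<Sum>D\<in>adj (wp (aw True (Suc i))) C. f D))"
      by (rule sum_U)
    also have "\<dots> = (\<Sum>i<n. hword (alternating False i) (f + hop s f) C)"
    proof (rule sum.cong[OF HOL.refl])
      fix i assume "i \<in> {..<n}"
      then have "reduced (aw False i)" "reduced (aw True (Suc i))" by (simp_all add: reduced_aw)
      then have "hword (alternating False i) f C = (\<Sum>D\<in>adj (wp (aw False i)) C. f D)"
        "hword (alternating True (Suc i)) f C = (\<Sum>D\<in>adj (wp (aw True (Suc i))) C. f D)"
        unfolding aw_def by (auto intro!: hword_sum[OF _ True f] simp del: alternating.simps)
      then show "(\<Sum>D\<in>adj (wp (aw False i)) C. f D) + (\<Sum>D\<in>adj (wp (aw True (Suc i))) C. f D)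
          = hword (alternating False i) (f + hop s f) C"
        unfolding split plus_fun_apply by simp
    qed
    finally show ?thesis by (simp only: ev)
  next
    case False
    have "hword cs (g :: 'c \<Rightarrow> complex) \<in> supp R" if "g \<in> supp R" for g cs
    proof (cases cs)
      case (Cons c ds)
      show ?thesis unfolding Cons hword_Cons by (rule supp_hop)
    qed (simp add: that)
    then have "hword (alternating False i) (f + hop s f) C = 0" for i
      using False supp_intros(2)[OF f supp_hop] by (simp add: supp_def)
    then show ?thesis using False by (simp add: ev allsum_def)
  qed
qed

text \<open>The diagonal entry at \<open>C\<close> is nonzero only if \<open>C\<close> lies in the
  sphere of the word around \<open>g C\<close>; this is applied to \<open>vt\<close> and to the
  identity.\<close>

lemma trace_hword:
  assumes "reduced (map gen cs)" "\<And>C. C \<in> R \<Longrightarrow> g C \<in> R" "\<And>C. C \<in> R \<Longrightarrow> \<delta> (g C) C \<noteq> wp (map gen cs)"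
  shows "tr R (\<lambda>f C. if C \<in> R then hword cs f (g C) else 0) = 0"
proof -
  have "hword cs (ind C) (g C) = 0" if C: "C \<in> R" for C
  proof -
    have "hword cs (ind C) (g C) = (\<Sum>D\<in>adj (wp (map gen cs)) (g C). ind C D)"
      by (rule hword_sum[OF assms(1) assms(2)[OF C] supp_intros(5)[OF C]])
    also have "\<dots> = 0"
      using assms(3)[OF C] by (intro sum.neutral) (auto simp: ind_def adj_def)
    finally show ?thesis .
  qed
  then show ?thesis unfolding tr_def by simp
qed

lemma hecke:
  assumes n3: "3 \<le> n"
  shows "\<exists>k. hecke_anisotropic R (hop s) (hop t) (q s) (q t) n vop k"
proof -
  have gs: "s = gen True" "t = gen False" by (simp_all add: gen_def)
  obtain k where k: "0 < k" "\<forall>x\<in>R. (vt ^^ k) x = x"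
    using funpow_period[OF finite_R inj_vt] vt(1) by blast
  interpret hecke_module R "hop s" "hop t" "q s" "q t" n
  proof unfold_locales
    show "finite R" by (rule finite_R)
    show "R \<noteq> {}" using base_R by blast
    show "lin (hop s)" "lin (hop t)" by (rule lin_hop)+
    show "hop s f \<in> supp R" "hop t f \<in> supp R" for f by (rule supp_hop)+
    show "hop s (hop s f) = scl (of_nat (q s)) f + scl (of_nat (q s) - 1) (hop s f)" if "f \<in> supp R" for f
      using hop_hop[OF that, of True] by (simp only: gen_def if_True)
    show "hop t (hop t f) = scl (of_nat (q t)) f + scl (of_nat (q t) - 1) (hop t f)" if "f \<in> supp R" for f
      using hop_hop[OF that, of False] by (simp only: gen_def if_False)
    show "hop s (allsum R f) = scl (of_nat (q s)) (allsum R f)" for f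
      using hop_allsum[of True f] by (simp only: gen_def if_True)
    show "hop t (allsum R f) = scl (of_nat (q t)) (allsum R f)" for f
      using hop_allsum[of False f] by (simp only: gen_def if_False)
    show "allsum R (hop s f) = scl (of_nat (q s)) (allsum R f)" for f
      using allsum_hop[of True f] by (simp only: gen_def if_True)
    show "allsum R (hop t f) = scl (of_nat (q t)) (allsum R f)" for f
      using allsum_hop[of False f] by (simp only: gen_def if_False)
    show "2 \<le> q s" "2 \<le> q t" by (rule q_ge_2[OF s] q_ge_2[OF t])+
    show "3 \<le> n" by (rule n3)
    show "allsum R f = (\<Sum>i<n. hword (alternating False i) (f + hop s f))" if "f \<in> supp R" for f
      by (rule allsum_hwords[OF that])
  qed
  have wopeq: "wop cs f = hword cs f" for cs f by (simp add: wop_def)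
  have red: "reduced (map gen cs) \<and> len (wp (map gen cs)) = length cs"
    if "successively (\<noteq>) cs" "length cs < n" for cs
  proof -
    from successively_neq_alternating[OF that(1)] obtain c where "cs = alternating c (length cs)" ..
    then have "map gen cs = aw c (length cs)" unfolding aw_def by (rule arg_cong)
    then show ?thesis using reduced_aw[of "length cs" c] that(2) by (simp add: reduced_def)
  qed
  have vopi: "(vop ^^ i) f C = f ((vt ^^ i) C)" if "f \<in> supp R" "C \<in> R" for i f C
  proof -
    have closed: "(vt ^^ i) C \<in> R" if "C \<in> R" for i C
      using that vt(1) by (induction i) auto
    show ?thesis using that(2)
    proof (induction i arbitrary: C)
      case (Suc i)
      have "(vop ^^ Suc i) f C = (vop ^^ i) f (vt C)" using Suc.prems by (simp add: vop_def)
      also have "\<dots> = f ((vt ^^ i) (vt C))" by (rule Suc.IH[OF vt(1)[OF Suc.prems]])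
      also have "(vt ^^ i) (vt C) = (vt ^^ Suc i) C" by (simp only: funpow_Suc_right o_apply)
      finally show ?case .
    qed simp
  qed
  have vop_supp: "vop f \<in> supp R" for f by (simp add: vop_def supp_def)
  have vopi_supp: "(vop ^^ i) f \<in> supp R" if "f \<in> supp R" for i f
    using that vop_supp by (cases i) simp_all
  have comm: "vop (hop (gen c) f) = hop (gen (fl c)) (vop f)" for c f
  proof
    fix C
    show "vop (hop (gen c) f) C = hop (gen (fl c)) (vop f) C"
    proof (cases "C \<in> R")
      case C: True
      have ff: "fl (fl c) = c" by (simp add: fl_def)
      \<comment> \<open>Substitution along this bijection of neighbourhoods is the commutation rule
        for the operators.\<close>
      have "bij_betw vt (adj (gen (fl c)) C) (adj (gen c) (vt C))"
      proof (rule bij_betw_imageI)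
        show "inj_on vt (adj (gen (fl c)) C)"
          by (rule inj_on_subset[OF inj_vt]) (use adj_R[OF C] in blast)
        show "vt ` adj (gen (fl c)) C = adj (gen c) (vt C)"
        proof (intro equalityI subsetI)
          fix D assume "D \<in> vt ` adj (gen (fl c)) C"
          then obtain E where E: "E \<in> adj (gen (fl c)) C" "D = vt E" by blast
          have ER: "E \<in> R" by (rule adj_R[OF C E(1)])
          have "\<delta> (vt C) (vt E) = gen c" using vt_adj[OF C ER, of "fl c"] E(1) ff by (simp add: adj_def)
          then show "D \<in> adj (gen c) (vt C)" using E(2) R_Ch[OF vt(1)[OF ER]] by (simp add: adj_def)
        next
          fix D assume D: "D \<in> adj (gen c) (vt C)"
          have DR: "D \<in> R" by (rule adj_R[OF vt(1)[OF C] D])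
          then obtain E where E: "E \<in> R" "D = vt E" using bij_vt unfolding bij_betw_def by blast
          have "\<delta> C E = gen (fl c)"
            using vt_adj_iff[OF C E(1), of "fl c"] D E(2) ff by (simp add: adj_def)
          then show "D \<in> vt ` adj (gen (fl c)) C" using E R_Ch by (auto simp: adj_def)
        qed
      qed
      then have "(\<Sum>E\<in>adj (gen (fl c)) C. f (vt E)) = (\<Sum>D\<in>adj (gen c) (vt C). f D)"
        by (rule sum.reindex_bij_betw)
      moreover have "(\<Sum>E\<in>adj (gen (fl c)) C. vop f E) = (\<Sum>E\<in>adj (gen (fl c)) C. f (vt E))"
        by (rule sum.cong) (auto simp: vop_def dest: adj_R[OF C])
      ultimately show ?thesis using C vt(1)[OF C] by (simp add: vop_def hop_def)
    qed (simp add: vop_def hop_def)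
  qed
  have "hecke_anisotropic R (hop s) (hop t) (q s) (q t) n vop k"
  proof unfold_locales
    show "lin vop" by (auto simp: lin_def vop_def scl_def fun_eq_iff)
    show "vop f \<in> supp R" for f by (rule vop_supp)
    show "(vop ^^ k) f = f" if f: "f \<in> supp R" for f
    proof
      fix C show "(vop ^^ k) f C = f C"
        using vopi[OF f, of C k] k(2) f vopi_supp[OF f, of k] by (cases "C \<in> R") (auto simp: supp_def)
    qed
    show "0 < k" by (rule k(1))
    show "allsum R (vop f) = allsum R f" for f
    proof -
      have "(\<Sum>C\<in>R. vop f C) = (\<Sum>C\<in>R. f (vt C))" by (rule sum.cong) (simp_all add: vop_def)
      also have "\<dots> = (\<Sum>C\<in>R. f C)" by (rule sum.reindex_bij_betw[OF bij_vt])
      finally show ?thesis unfolding allsum_def by (rule arg_cong)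
    qed
    fix cs :: "bool list" assume cs: "successively (\<noteq>) cs" "length cs < n"
    \<comment> \<open>The distance has length \<open>n\<close>, the word is shorter.\<close>
    have "\<delta> (vt C) C \<noteq> wp (map gen cs)" if C: "C \<in> R" for C
    proof -
      have "\<delta> (vt C) C = inv wJ" using dist_inv[OF R_Ch[OF C] R_Ch[OF vt(1)[OF C]]] dist_vt[OF C] by simp
      then have "len (\<delta> (vt C) C) = n" using len_inv[OF wJ_closed] len_wJ by simp
      then show ?thesis using red[OF cs] cs(2) by auto
    qed
    then have "tr R (\<lambda>f C. if C \<in> R then hword cs f (vt C) else 0) = 0"
      using trace_hword[of cs vt] red[OF cs] vt(1) by blast
    then show "tr R (\<lambda>f. vop (wop cs f)) = 0" by (simp add: vop_def wopeq)
  next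
    fix cs :: "bool list" assume cs: "successively (\<noteq>) cs" "cs \<noteq> []" "length cs < n"
    have "\<delta> C C \<noteq> wp (map gen cs)" if C: "C \<in> R" for C
      using red[OF cs(1,3)] cs(2) R_Ch[OF C] by (metis dist_refl len_one length_0_conv)
    then have "tr R (\<lambda>f C. if C \<in> R then hword cs f C else 0) = 0"
      using trace_hword[of cs "\<lambda>C. C"] red[OF cs(1,3)] by blast
    then show "tr R (wop cs) = 0" by (simp add: tr_def wopeq)
  next
    show "vop (hop s f) = hop s (vop f)" "vop (hop t f) = hop t (vop f)" if "even n" for f
      using comm[of True f] comm[of False f] that by (simp_all add: fl_def flip: gs)
    show "vop (hop s f) = hop t (vop f)" "vop (hop t f) = hop s (vop f)" if "odd n" for f
      using comm[of True f] comm[of False f] that by (simp_all add: fl_def flip: gs)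
    show "q s = q t" if "odd n" by (rule q_odd[OF that])
  qed
  then show ?thesis by blast
qed

lemma pair_quadrangle: "3 \<le> n \<Longrightarrow> n = 4 \<and> coprime (q s) (q t)"
  using hecke hecke_anisotropic.quadrangle by blast

end

section \<open>The rank of the building\<close>

lemma (in monoid) word_prod_replicate:
  assumes "set xs \<subseteq> carrier G"
  shows "word_prod G (concat (replicate k xs)) = word_prod G xs [^] k"
proof (induction k)
  case (Suc k)
  have "set (concat (replicate k xs)) \<subseteq> carrier G" using assms by auto
  then have "word_prod G (concat (replicate (Suc k) xs)) = word_prod G xs \<otimes> word_prod G xs [^] k"
    using Suc word_prod_append[OF assms] by simp
  also have "\<dots> = word_prod G xs [^] Suc k" by (rule nat_pow_Suc2[OF word_prod_closed[OF assms], symmetric])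
  finally show ?case .
qed simp

lemma foldr_replicate: "foldr f (concat (replicate k xs)) = foldr f xs ^^ k"
  by (induction k) (auto simp: fun_eq_iff)

context coxeter_system
begin

text \<open>The universal property of the presentation, stated on words: maps satisfying the Coxeter
  relations give equivalent words the same composite.\<close>

lemma relations_respected:
  fixes f :: "'w \<Rightarrow> 'm \<Rightarrow> 'm"
  assumes "\<And>s t. s \<in> S \<Longrightarrow> t \<in> S \<Longrightarrow> (f s \<circ> f t) ^^ ord (s \<otimes> t) = id"
    and "coxeter_equiv W S xs ys"
  shows "foldr f xs = foldr f ys"
  using assms(2)
proof (induction rule: coxeter_equiv.induct)
  case (relator s t xs ys)
  have "foldr f (concat (replicate (ord (s \<otimes> t)) [s, t])) = (f s \<circ> f t) ^^ ord (s \<otimes> t)"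
    unfolding foldr_replicate by simp
  also have "\<dots> = id" by (rule assms(1)[OF relator(1,2)])
  finally have *: "foldr f (concat (replicate (ord (s \<otimes> t)) [s, t])) z = z" for z by simp
  show ?case by (rule ext) (simp only: foldr_append o_apply *)
qed simp_all

lemma ord_commute: "s \<in> S \<Longrightarrow> t \<in> S \<Longrightarrow> ord (t \<otimes> s) = ord (s \<otimes> t)"
  using ord_inv[of "s \<otimes> t"] by (simp add: inv_mult_group)

text \<open>The affine Weyl group of type \<open>C\<^sub>2\<close> acts on \<open>\<int>\<^sup>2\<close> with unbounded orbits.\<close>
lemma no_path_of_fours:
  assumes fin: "finite (carrier W)"
    and S: "s \<in> S" "t \<in> S" "u \<in> S" "s \<noteq> t" "t \<noteq> u" "s \<noteq> u"
    and ord4: "ord (s \<otimes> t) = 4" "ord (t \<otimes> u) = 4"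
    and ords: "\<And>x y. x \<in> S \<Longrightarrow> y \<in> S \<Longrightarrow> x \<noteq> y \<Longrightarrow> ord (x \<otimes> y) = 2 \<or> ord (x \<otimes> y) = 4"
  shows False
proof -
  \<comment> \<open>The reflections in the lines \<open>y = 0\<close>, \<open>x = y\<close> and
    \<open>x = 1/2\<close>; all other generators act trivially. The relations hold because all
    orders of products of distinct generators are even, and fourth powers are trivial even for a
    pair \<open>s\<close>, \<open>u\<close> of order four.\<close>
  define f :: "'w \<Rightarrow> int \<times> int \<Rightarrow> int \<times> int" where
    "f r = (if r = s then (\<lambda>(x, y). (x, - y)) else if r = t then (\<lambda>(x, y). (y, x))
      else if r = u then (\<lambda>(x, y). (1 - x, y)) else id)" for r
  have rel: "(f x \<circ> f y) ^^ ord (x \<otimes> y) = id" if xy: "x \<in> S" "y \<in> S" for x y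
  proof (cases "x = y")
    case True
    then have "ord (x \<otimes> y) = 1" using xy ord_eq_1[of "x \<otimes> y"] by simp
    then show ?thesis using True by (auto simp: f_def fun_eq_iff)
  next
    case False
    have 4: "(f x \<circ> f y) ^^ 4 = id" using S(4-6)
      by (auto simp: f_def fun_eq_iff eval_nat_numeral)
    show ?thesis
    proof (cases "ord (x \<otimes> y) = 4")
      case True
      then show ?thesis using 4 by simp
    next
      case n4: False
      then have 2: "ord (x \<otimes> y) = 2" using ords[OF xy False] by blast
      have "{x, y} \<noteq> {s, t}" "{x, y} \<noteq> {t, u}"
        using n4 ord4 ord_commute S(1-3) by (auto simp: doubleton_eq_iff)
      then show ?thesis unfolding 2 using S(4-6) False
        by (auto simp: f_def fun_eq_iff eval_nat_numeral doubleton_eq_iff)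
    qed
  qed
  \<comment> \<open>The letters \<open>t s t\<close> give the reflection
    \<open>x \<mapsto> - x\<close>; with \<open>u\<close> this is the translation by
    \<open>(1, 0)\<close>, which has infinite order.\<close>
  define w where "w = [u, t, s, t]"
  have w: "set w \<subseteq> S" using S by (simp add: w_def)
  define k where "k = ord (wp w)"
  have k: "0 < k" using ord_ge_1[OF fin wp_closed[OF w]] by (simp add: k_def)
  have sub: "set (concat (replicate k w)) \<subseteq> S" using w by auto
  have "wp (concat (replicate k w)) = wp w [^] k"
    by (rule word_prod_replicate) (use w generators_closed in blast)
  also have "\<dots> = \<one>" unfolding k_def by (rule pow_ord_eq_1[OF wp_closed[OF w]])
  finally have "coxeter_equiv W S (concat (replicate k w)) []" by (rule presentation[OF sub])
  from relations_respected[OF rel this] have "foldr f w ^^ k = id"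
    by (simp add: foldr_replicate id_def)
  then have "(foldr f w ^^ k) (0, 0) = (0, 0)" by simp
  moreover have "(foldr f w ^^ i) (0, 0) = (int i, 0)" for i
    by (induction i) (use S(4-6) in \<open>auto simp: w_def f_def\<close>)
  ultimately show False using k by simp
qed

end

context anisotropic_bldg
begin

lemma ord_pair:
  assumes "s \<in> S" "t \<in> S" "s \<noteq> t"
  shows "ord (s \<otimes> t) = 2 \<or> ord (s \<otimes> t) = 4 \<and> coprime (q s) (q t)"
proof -
  interpret p: aniso_pair W S Ch \<delta> \<theta> \<sigma> w0 s t by unfold_locales (rule assms)+
  show ?thesis using p.ord_eq_n p.n_ge_2 p.pair_quadrangle by (cases "p.n = 2") auto
qed

text \<open>All edges of the diagram have label four, so no two edges form a path through three
  distinct generators. A connected diagram with an edge is then that edge alone.\<close>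

lemma rank_two:
  assumes fin: "finite (carrier W)" and irr: "irreducible_coxeter W S" and card: "2 \<le> card S"
  shows "\<exists>a b. S = {a, b} \<and> a \<noteq> b \<and> ord (a \<otimes> b) = 4 \<and> coprime (q a) (q b)"
proof -
  let ?D = "coxeter_diagram W S"
  have D_sym: "(y, x) \<in> ?D" if "(x, y) \<in> ?D" for x y
    using that ord_commute by (auto simp: coxeter_diagram_def)
  have D_ord: "x \<in> S" "y \<in> S" "x \<noteq> y" "ord (x \<otimes> y) = 4" "coprime (q x) (q y)" if "(x, y) \<in> ?D" for x y
    using that ord_pair[of x y] by (auto simp: coxeter_diagram_def)
  have one: "x = z" if "(x, y) \<in> ?D" "(y, z) \<in> ?D" for x y z
  proof (rule ccontr)
    assume "x \<noteq> z"
    from no_path_of_fours[OF fin D_ord(1,2)[OF that(1)] D_ord(2)[OF that(2)] D_ord(3)[OF that(1)]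
        D_ord(3)[OF that(2)] this D_ord(4)[OF that(1)] D_ord(4)[OF that(2)]] ord_pair
    show False by blast
  qed
  have "\<not> S \<subseteq> {x}" for x using card card_mono[of "{x}" S] by fastforce
  moreover obtain a where a: "a \<in> S" using irr by (auto simp: irreducible_coxeter_def)
  ultimately obtain c where c: "c \<in> S" "c \<noteq> a" by blast
  have "(a, c) \<in> ?D\<^sup>*" using irr a c by (simp add: irreducible_coxeter_def)
  then obtain b where b: "(a, b) \<in> ?D" using c(2) by (metis converse_rtranclE)
  have "r \<in> {a, b}" if "r \<in> S" for r
  proof -
    have "(a, r) \<in> ?D\<^sup>*" using irr a that by (simp add: irreducible_coxeter_def)
    then show ?thesis
    proof (induction rule: rtrancl_induct)
      case (step x y)
      then show ?case using one[of b a y] one[of a b y] D_sym[OF b] b by blast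
    qed simp
  qed
  then have "S = {a, b}" using D_ord(1,2)[OF b] by blast
  then show ?thesis using D_ord(3-5)[OF b] by blast
qed

end

section \<open>The generalised quadrangle\<close>

lemma successively_alternating: "successively (\<noteq>) (alternating c i)"
proof (induction i)
  case (Suc i)
  then show ?case by (cases i) (simp_all add: alternating_Cons del: alternating.simps(2))
qed simp

lemma successively_neq_last:
  fixes c :: bool
  shows "successively (\<noteq>) (c # cs) \<Longrightarrow> last (c # cs) = c \<longleftrightarrow> even (length cs)"
proof (induction cs arbitrary: c)
  case (Cons a cs)
  then have "successively (\<noteq>) (a # cs)" "a = (\<not> c)" by auto
  with Cons.IH[OF this(1)] show ?case by auto
qed simp

locale aniso_quadrangle = aniso_pair W S Ch \<delta> \<theta> \<sigma> w0 s t
  for W :: "('w, 'b) monoid_scheme" (structure) and S and Ch :: "'c set" and \<delta> \<theta> \<sigma> w0 s t +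
  assumes S_eq: "S = {s, t}" and n4: "n = 4"
begin

definition pnl :: "bool \<Rightarrow> 'c \<Rightarrow> 'c set" where "pnl c C = panel W Ch \<delta> (gen c) C"
text \<open>Points are the panels of type \<open>t\<close> and lines those of type \<open>s\<close>,
  since moving within an \<open>s\<close>-panel changes the point on a fixed line. The Boolean index
  treats both kinds uniformly, which halves the arguments.\<close>

definition vtx :: "bool \<Rightarrow> 'c \<Rightarrow> 'c set + 'c set" where
  "vtx c C = (if c then Inr (pnl c C) else Inl (pnl c C))"

definition points :: "'c set set" where "points = pnl False ` Ch"
definition lines :: "'c set set" where "lines = pnl True ` Ch"
definition inc :: "('c set \<times> 'c set) set" where "inc = (\<lambda>C. (pnl False C, pnl True C)) ` Ch"

abbreviation V where "V \<equiv> points <+> lines"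
abbreviation E where "E \<equiv> incidence_edges inc"

lemma pnl_adj: "C \<in> Ch \<Longrightarrow> pnl c C = insert C (adj (gen c) C)"
  by (auto simp: pnl_def panel_def adj_def dist_one_iff)

lemma pnl_eq:
  assumes "C \<in> Ch" "D \<in> Ch"
  shows "pnl c C = pnl c D \<longleftrightarrow> C = D \<or> \<delta> C D = gen c"
proof
  assume "pnl c C = pnl c D"
  then have "D \<in> pnl c C" using pnl_adj[OF assms(2)] by simp
  then show "C = D \<or> \<delta> C D = gen c" using pnl_adj[OF assms(1)] by (auto simp: adj_def)
next
  assume "C = D \<or> \<delta> C D = gen c"
  then show "pnl c C = pnl c D"
  proof
    assume "\<delta> C D = gen c"
    then have D: "D \<in> adj (gen c) C" using assms by (simp add: adj_def)
    show ?thesis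
      unfolding pnl_adj[OF assms(1)] pnl_adj[OF assms(2)] adj_eq_panel[OF assms(1) gen_S D]
      using D by blast
  qed simp
qed

lemma vtx_eq:
  "C \<in> Ch \<Longrightarrow> D \<in> Ch \<Longrightarrow> vtx c C = vtx d D \<longleftrightarrow> c = d \<and> (C = D \<or> \<delta> C D = gen c)"
  using pnl_eq[of C D] by (auto simp: vtx_def)

lemma vtx_type: "vtx c C = vtx d D \<Longrightarrow> c = d"
  by (auto simp: vtx_def split: if_splits)

lemma chamber_eq:
  assumes "C \<in> Ch" "D \<in> Ch" "vtx c C = vtx c D" "vtx (\<not> c) C = vtx (\<not> c) D"
  shows "C = D"
proof -
  have "gen c \<noteq> gen (\<not> c)" by simp
  then show ?thesis using assms vtx_eq[OF assms(1,2)] by metis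
qed

lemma V_iff: "u \<in> V \<longleftrightarrow> (\<exists>c. \<exists>C\<in>Ch. u = vtx c C)"
proof -
  have "V = (\<Union>c. vtx c ` Ch)"
    unfolding UNIV_bool by (auto simp: points_def lines_def vtx_def)
  then show ?thesis by auto
qed

lemma vtx_V: "C \<in> Ch \<Longrightarrow> vtx c C \<in> V"
  using V_iff by blast

lemma E_iff: "(x, y) \<in> E \<longleftrightarrow> (\<exists>c. \<exists>C\<in>Ch. x = vtx c C \<and> y = vtx (\<not> c) C)"
proof
  assume "(x, y) \<in> E"
  then consider C where "C \<in> Ch" "x = Inl (pnl False C)" "y = Inr (pnl True C)"
    | C where "C \<in> Ch" "y = Inl (pnl False C)" "x = Inr (pnl True C)"
    unfolding incidence_edges_def inc_def by blast
  then show "\<exists>c. \<exists>C\<in>Ch. x = vtx c C \<and> y = vtx (\<not> c) C"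
  proof cases
    case 1
    then show ?thesis by (intro exI[of _ False] bexI[of _ C]) (simp_all add: vtx_def)
  next
    case 2
    then show ?thesis by (intro exI[of _ True] bexI[of _ C]) (simp_all add: vtx_def)
  qed
next
  assume "\<exists>c. \<exists>C\<in>Ch. x = vtx c C \<and> y = vtx (\<not> c) C"
  then show "(x, y) \<in> E" unfolding incidence_edges_def inc_def vtx_def by (auto split: if_splits)
qed

lemma edge:
  assumes "F \<in> Ch" "x = vtx c F" "y = vtx (\<not> c) F"
  shows "(x, y) \<in> E"
  using assms E_iff by blast

lemma inj_flag: "inj_on (\<lambda>C. (pnl False C, pnl True C)) Ch"
  by (rule inj_onI) (auto intro!: chamber_eq[of _ _ False] simp: vtx_def)

lemma flag_building: "is_flag_building S Ch \<delta> points lines inc"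
proof -
  let ?\<phi> = "\<lambda>C. (pnl False C, pnl True C)"
  have "{(x, y) \<in> points \<times> lines. (x, y) \<in> inc} = ?\<phi> ` Ch"
    by (auto simp: inc_def points_def lines_def)
  then have bij: "bij_betw ?\<phi> Ch {(x, y) \<in> points \<times> lines. (x, y) \<in> inc}"
    using inj_flag by (simp add: bij_betw_def)
  have dist: "\<delta> C D = gen c \<longleftrightarrow> pnl (\<not> c) C \<noteq> pnl (\<not> c) D \<and> pnl c C = pnl c D"
    if C: "C \<in> Ch" "D \<in> Ch" for C D c
  proof -
    have "gen (\<not> c) \<noteq> gen c" "gen c \<noteq> \<one>" by (simp_all add: gen_neq_one[OF gen_S])
    then show ?thesis unfolding pnl_eq[OF C] using dist_one_iff[OF C] by metis
  qed
  have "(\<delta> C D = s \<longleftrightarrow> pnl False C \<noteq> pnl False D \<and> pnl True C = pnl True D) \<and>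
      (\<delta> C D = t \<longleftrightarrow> pnl False C = pnl False D \<and> pnl True C \<noteq> pnl True D)"
    if C: "C \<in> Ch" "D \<in> Ch" for C D
    using dist[OF C, of True] dist[OF C, of False] by (auto simp: gen_def)
  then show ?thesis
    unfolding is_flag_building_def
    by (intro exI[of _ s] exI[of _ t] exI[of _ ?\<phi>]) (use S_eq st bij in simp)
qed

lemma card_flags:
  assumes C: "C \<in> Ch"
  shows "card (pnl (\<not> c) ` pnl c C) = q (gen c) + 1"
proof -
  have sub: "pnl c C \<subseteq> Ch" by (auto simp: pnl_def panel_def)
  have mem: "pnl c D = pnl c C" if "D \<in> pnl c C" for D
    using that pnl_eq[OF C, of D c] pnl_adj[OF C, of c] by (auto simp: adj_def C)
  have "inj_on (pnl (\<not> c)) (pnl c C)"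
  proof (rule inj_onI)
    fix D D' assume D: "D \<in> pnl c C" "D' \<in> pnl c C" "pnl (\<not> c) D = pnl (\<not> c) D'"
    have "pnl c D = pnl c D'" using mem[OF D(1)] mem[OF D(2)] by simp
    then show "D = D'" using D sub by (intro chamber_eq[of D D' c]) (auto simp: vtx_def)
  qed
  then have "card (pnl (\<not> c) ` pnl c C) = card (pnl c C)" by (rule card_image)
  also have "\<dots> = q (gen c) + 1"
  proof -
    have "\<one> \<noteq> gen c" using gen_neq_one[OF gen_S] by (rule not_sym)
    then have "C \<notin> adj (gen c) C" using C by (simp add: adj_def)
    then show ?thesis unfolding pnl_adj[OF C] using card_adj[OF C gen_S] by simp
  qed
  finally show ?thesis .
qed

lemma parameters: "has_parameters points lines inc (q s) (q t)"
proof -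
  have mem: "D \<in> pnl c C \<longleftrightarrow> pnl c D = pnl c C" if "C \<in> Ch" "D \<in> Ch" for c C D
    using pnl_eq[OF that] pnl_adj[OF that(1), of c] that(2) by (auto simp: adj_def)
  have sub: "pnl c C \<subseteq> Ch" for c C by (auto simp: pnl_def panel_def)
  have eq: "{D \<in> Ch. pnl c D = pnl c C} = pnl c C" if "C \<in> Ch" for c C
    using mem[OF that] sub by blast
  have "{x \<in> points. (x, pnl True C) \<in> inc} = pnl False ` {D \<in> Ch. pnl True D = pnl True C}" for C
    by (auto simp: points_def inc_def)
  moreover have "{y \<in> lines. (pnl False C, y) \<in> inc} = pnl True ` {D \<in> Ch. pnl False D = pnl False C}" for C
    by (auto simp: lines_def inc_def)
  ultimately show ?thesis
    using card_flags[of _ True] card_flags[of _ False]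
    by (auto simp: eq has_parameters_def points_def lines_def gen_def)
qed

section \<open>Walks in the incidence graph and galleries: diameter and girth\<close>

abbreviation walk where "walk \<equiv> graph_walk V E"

lemma walk_Cons2: "walk (x # y # p) \<longleftrightarrow> x \<in> V \<and> (x, y) \<in> E \<and> walk (y # p)"
  by (auto simp: graph_walk_def)

lemma walk_single: "walk [u] \<longleftrightarrow> u \<in> V"
  by (simp add: graph_walk_def)

lemma len_dist_triangle:
  assumes "C \<in> Ch" "D \<in> Ch" "F \<in> Ch"
  shows "len (\<delta> C F) \<le> len (\<delta> C D) + len (\<delta> D F)"
proof -
  obtain xs where xs: "reduced xs" "wp xs = \<delta> C D"
    using reduced_word_exists[OF dist_closed[OF assms(1,2)]] by blast
  have "gallery C xs D" using gallery_of_dist xs assms reduced_set by simp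
  then have "len (\<delta> C F) \<le> length xs + len (\<delta> D F)"
    using assms(1) reduced_set[OF xs(1)]
  proof (induction xs arbitrary: C)
    case (Cons r xs)
    then obtain C' where C': "C' \<in> Ch" "\<delta> C C' = r" "gallery C' xs D" by auto
    have "\<delta> C F = r \<otimes> \<delta> C' F \<or> \<delta> C F = \<delta> C' F"
      using dist_step[OF C'(1) assms(3) Cons.prems(2), of r] C'(2) Cons.prems(3) by simp
    then have "len (\<delta> C F) \<le> len (\<delta> C' F) + 1"
      using len_gen[of r "\<delta> C' F"] dist_closed[OF C'(1) assms(3)] Cons.prems(3) by auto
    then show ?case using Cons.IH[OF C'(3,1)] Cons.prems(3) by simp
  qed simp
  then show ?thesis using xs by (simp add: reduced_def)
qed

lemma len_same_vtx: "C \<in> Ch \<Longrightarrow> D \<in> Ch \<Longrightarrow> vtx c C = vtx d D \<Longrightarrow> len (\<delta> C D) \<le> 1"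
  using vtx_eq[of C D c d] len_gen_one[OF gen_S, of c] by auto

text \<open>The edges of the walk are chambers, and consecutive ones share a vertex and so are at
  distance at most one; \<open>C\<close> and \<open>D\<close> are attached at the ends. The parity
  statement is bipartiteness.\<close>

lemma walk_len:
  assumes "D \<in> Ch"
  shows "walk p \<Longrightarrow> C \<in> Ch \<Longrightarrow> hd p = vtx c C \<Longrightarrow> last p = vtx d D \<Longrightarrow>
    len (\<delta> C D) \<le> length p \<and> (c = d \<longleftrightarrow> odd (length p))"
proof (induction p arbitrary: c C rule: induct_list012)
  case 1
  then show ?case by (simp add: graph_walk_def)
next
  case (2 u)
  then have "vtx c C = vtx d D" by simp
  then show ?case using len_same_vtx[OF 2(2) assms, of c d] vtx_type by auto
next
  case (3 u v p)
  then obtain e F where F: "F \<in> Ch" "u = vtx e F" "v = vtx (\<not> e) F" using walk_Cons2 E_iff by metis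
  have "e = c" using F(2) 3(5) vtx_type by auto
  have "len (\<delta> F D) \<le> length (v # p) \<and> ((\<not> e) = d \<longleftrightarrow> odd (length (v # p)))"
    by (rule "3.IH"(2)) (use 3 F walk_Cons2 in auto)
  moreover have "len (\<delta> C F) \<le> 1" using len_same_vtx[OF 3(4) F(1), of c e] F(2) 3(5) by simp
  ultimately show ?case
    using len_dist_triangle[OF 3(4) F(1) assms] \<open>e = c\<close> by auto
qed

text \<open>The walk passes through the panels in which the gallery moves, preceded by the vertex of
  type \<open>c\<close>. The summand \<open>2\<close> allows for this start and for one extra edge
  at the end to reach the prescribed type \<open>d\<close>.\<close>

lemma gallery_walk:
  assumes "D \<in> Ch"
  shows "successively (\<noteq>) (c # cs) \<Longrightarrow> gallery C (map gen cs) D \<Longrightarrow>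
    \<exists>p. walk p \<and> hd p = vtx c C \<and> last p = vtx d D \<and> length p \<le> length cs + 2"
proof (induction cs arbitrary: c C)
  case Nil
  then have CD: "C = D" by simp
  show ?case
  proof (cases "c = d")
    case True
    then show ?thesis using CD vtx_V[OF assms] by (intro exI[of _ "[vtx d D]"]) (simp add: walk_single)
  next
    case False
    then have "(vtx c D, vtx d D) \<in> E" by (intro edge[OF assms]) auto
    then show ?thesis using CD vtx_V[OF assms]
      by (intro exI[of _ "[vtx c D, vtx d D]"]) (simp add: walk_single walk_Cons2)
  qed
next
  case (Cons e cs)
  have e: "e = (\<not> c)" using Cons.prems(1) by auto
  obtain C' where C': "C' \<in> Ch" "\<delta> C C' = gen e" "gallery C' (map gen cs) D" and C: "C \<in> Ch"
    using Cons.prems(2) by auto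
  have "successively (\<noteq>) (e # cs)" using Cons.prems(1) by simp
  from Cons.IH[OF this C'(3)] obtain p where
    p: "walk p" "hd p = vtx e C'" "last p = vtx d D" "length p \<le> length cs + 2" by blast
  obtain v p' where vp: "p = v # p'" using p(1) by (cases p) (auto simp: graph_walk_def)
  have "v = vtx e C" using p(2) vp vtx_eq[OF C C'(1), of e e] C'(2) by simp
  then have "(vtx c C, v) \<in> E" by (intro edge[OF C]) (auto simp: e)
  then show ?case using p vp vtx_V[OF C] by (intro exI[of _ "vtx c C # p"]) (auto simp: walk_Cons2)
qed

text \<open>The longest element has two alternating words, so its first letter can be
  prescribed.\<close>

lemma dist_word:
  assumes "C \<in> Ch" "D \<in> Ch"
  shows "\<exists>cs. successively (\<noteq>) cs \<and> length cs \<le> 4 \<and> \<delta> C D = wp (map gen cs) \<and>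
    (length cs = 4 \<longrightarrow> hd cs = c)"
proof -
  have alt: "successively (\<noteq>) (alternating e i)" for e i by (rule successively_alternating)
  obtain xs where "set xs \<subseteq> {s, t}" "wp xs = \<delta> C D"
    using word_exists[OF dist_closed[OF assms]] S_eq by blast
  then have "\<delta> C D \<in> U" unfolding U_def by force
  from U_aw[OF this] obtain e i where ei: "i \<le> 4" "\<delta> C D = wp (aw e i)" using n4 by auto
  show ?thesis
  proof (cases "i = 4")
    case True
    have "\<delta> C D = wp (aw (\<not> c) 4)" using ei(2) True wJ_eq n4 by simp
    then show ?thesis
      by (intro exI[of _ "alternating (\<not> c) 4"]) (auto simp: alt aw_def eval_nat_numeral)
  next
    case False
    then show ?thesis using ei alt[of e i] by (intro exI[of _ "alternating e i"]) (simp add: aw_def)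
  qed
qed

lemma walk_exists:
  assumes "C \<in> Ch" "D \<in> Ch"
  shows "\<exists>p. walk p \<and> hd p = vtx c C \<and> last p = vtx d D \<and> length p \<le> 5"
proof -
  obtain cs where cs: "successively (\<noteq>) cs" "length cs \<le> 4" "\<delta> C D = wp (map gen cs)"
    "length cs = 4 \<longrightarrow> hd cs = c"
    using dist_word[OF assms] by blast
  have "set (map gen cs) \<subseteq> S" by auto
  then have g: "gallery C (map gen cs) D" by (rule gallery_of_dist[OF _ assms cs(3)])
  show ?thesis
  proof (cases "cs = [] \<or> hd cs \<noteq> c")
    case True
    then have alt: "successively (\<noteq>) (c # cs)" using cs(1) by (cases cs) auto
    \<comment> \<open>A word of length four starts with \<open>c\<close> by choice and so belongs to
      the other case; there the first step keeps the starting vertex and is dropped.\<close>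
    have "length cs \<le> 3" using True cs(2,4) by (cases "length cs = 4") auto
    from gallery_walk[OF assms(2) alt g, of d] obtain p where
      "walk p" "hd p = vtx c C" "last p = vtx d D" "length p \<le> length cs + 2" by blast
    then show ?thesis using \<open>length cs \<le> 3\<close> by (intro exI[of _ p]) simp
  next
    case False
    then obtain ds where ds: "cs = c # ds" by (cases cs) auto
    then obtain C' where C': "C' \<in> Ch" "\<delta> C C' = gen c" "gallery C' (map gen ds) D" using g by auto
    have "vtx c C' = vtx c C" using vtx_eq[OF assms(1) C'(1), of c c] C'(2) by simp
    moreover from gallery_walk[OF assms(2) cs(1)[unfolded ds] C'(3), of d] obtain p where
      "walk p" "hd p = vtx c C'" "last p = vtx d D" "length p \<le> length ds + 2" by blast
    ultimately show ?thesis using cs(2) ds by (intro exI[of _ p]) simp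
  qed
qed

lemma opposite_chambers: "\<exists>C\<in>Ch. \<exists>D\<in>Ch. \<delta> C D = wJ"
  using chamber_at_dist[OF base_Ch, of "aw True n"] base_Ch by (auto simp: wJ_def)

lemma diameter: "graph_diameter V E = 4"
proof (rule antisym)
  show "graph_diameter V E \<le> 4"
    unfolding graph_diameter_def
  proof (intro SUP_least)
    fix u v assume "u \<in> V" "v \<in> V"
    then obtain p where p: "walk p" "hd p = u" "last p = v" "length p \<le> 5"
      using V_iff walk_exists by metis
    have "graph_dist V E u v \<le> enat (length p - 1)"
      unfolding graph_dist_def by (rule INF_lower) (use p in simp)
    also have "\<dots> \<le> enat 4" using p(4) by simp
    finally show "graph_dist V E u v \<le> 4" by (simp add: numeral_eq_enat)
  qed
  obtain C D where CD: "C \<in> Ch" "D \<in> Ch" "\<delta> C D = wJ" using opposite_chambers by blast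
  \<comment> \<open>Vertices of equal type are joined only by walks with an odd number of vertices,
    and opposite chambers require at least four; so there are at least five vertices, hence four
    edges.\<close>
  have "enat 4 \<le> graph_dist V E (vtx True C) (vtx True D)"
    unfolding graph_dist_def
  proof (rule INF_greatest)
    fix p assume "p \<in> {p. walk p \<and> hd p = vtx True C \<and> last p = vtx True D}"
    then have "len wJ \<le> length p" "odd (length p)"
      using walk_len[OF CD(2), of p C True True] CD by auto
    then have "4 \<le> length p" "odd (length p)" using len_wJ n4 by simp_all
    then have "5 \<le> length p" by (cases "length p = 4") auto
    then show "enat 4 \<le> enat (length p - 1)" by simp
  qed
  also have "\<dots> \<le> graph_diameter V E"
    unfolding graph_diameter_def
    by (rule SUP_upper2[OF vtx_V[OF CD(1)] SUP_upper[OF vtx_V[OF CD(2)]]])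
  finally show "4 \<le> graph_diameter V E" by (simp add: numeral_eq_enat)
qed

text \<open>The edges of the walk, read as chambers, form a gallery. Consecutive edges are different
  because no vertex is repeated, and they are adjacent at the vertex between them, so the types
  alternate.\<close>

lemma walk_gallery:
  "walk (x # y # p) \<Longrightarrow> distinct (x # y # p) \<Longrightarrow> F \<in> Ch \<Longrightarrow> x = vtx c F \<Longrightarrow> y = vtx (\<not> c) F \<Longrightarrow>
    \<exists>G\<in>Ch. \<exists>cs. gallery F (map gen cs) G \<and> successively (\<noteq>) (c # cs) \<and> length cs = length p \<and>
      last (x # y # p) = vtx (\<not> last (c # cs)) G \<and> last (butlast (x # y # p)) = vtx (last (c # cs)) G"
proof (induction p arbitrary: x y c F)
  case Nil
  then show ?case by (intro bexI[of _ F] exI[of _ "[]"]) auto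
next
  case (Cons w p u v)
  then have "(v, w) \<in> E" by (simp add: walk_Cons2)
  then obtain d F' where F': "F' \<in> Ch" "v = vtx d F'" "w = vtx (\<not> d) F'" using E_iff by blast
  have d: "d = (\<not> c)" using Cons.prems(5) F'(2) vtx_type by metis
  have "F \<noteq> F'" using Cons.prems(2,4) F'(3) d by auto
  then have FF: "\<delta> F F' = gen d" using vtx_eq[OF Cons.prems(3) F'(1), of d d] Cons.prems(5) F'(2) d by auto
  have "walk (v # w # p)" "distinct (v # w # p)" using Cons.prems(1,2) by (simp_all add: walk_Cons2)
  from Cons.IH[OF this F'] obtain G cs where
    G: "G \<in> Ch" "gallery F' (map gen cs) G" "successively (\<noteq>) (d # cs)" "length cs = length p"
      "last (v # w # p) = vtx (\<not> last (d # cs)) G" "last (butlast (v # w # p)) = vtx (last (d # cs)) G"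
    by blast
  show ?case
  proof (intro bexI[OF _ G(1)] exI[of _ "d # cs"] conjI)
    show "gallery F (map gen (d # cs)) G" using FF F'(1) G(2) Cons.prems(3) by auto
    show "successively (\<noteq>) (c # d # cs)" using G(3) d by auto
    show "length (d # cs) = length (w # p)" using G(4) by simp
    show "last (u # v # w # p) = vtx (\<not> last (c # d # cs)) G" using G(5) by simp
    show "last (butlast (u # v # w # p)) = vtx (last (c # d # cs)) G" using G(6) by simp
  qed
qed

lemma reduced_alternating:
  assumes "successively (\<noteq>) cs" "length cs \<le> 4"
  shows "reduced (map gen cs)"
proof -
  from successively_neq_alternating[OF assms(1)] obtain c where "cs = alternating c (length cs)" ..
  then have "map gen cs = aw c (length cs)" unfolding aw_def by (rule arg_cong)
  then show ?thesis using reduced_aw[of "length cs" c] assms(2) n4 by simp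
qed

lemma gen_commute_neq: "gen c \<otimes> gen (\<not> c) \<noteq> gen (\<not> c) \<otimes> gen c"
proof -
  have "wp (aw True 2) \<noteq> wp (aw False 2)" by (rule wp_aw_neq) (simp_all add: n4)
  then have "gen False \<otimes> gen True \<noteq> gen True \<otimes> gen False"
    by (simp add: aw_def eval_nat_numeral)
  then show ?thesis by (cases c) auto
qed

text \<open>A shorter cycle has an even number of vertices, four or six. Its closing edge
  \<open>H\<close> is adjacent to the first edge \<open>F\<close> and the last edge
  \<open>G\<close>, so \<open>\<delta> F G\<close> has length at most two, which leaves a
  four-cycle. Its two sides then express \<open>\<delta> F G\<close> by both products of the
  generators, which do not commute.\<close>

lemma cycle_length:
  assumes "graph_cycle V E p"
  shows "8 \<le> length p"
proof (rule ccontr)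
  assume short: "\<not> 8 \<le> length p"
  have p: "walk p" "distinct p" "3 \<le> length p" "(last p, hd p) \<in> E"
    using assms by (auto simp: graph_cycle_def)
  then obtain u v w vs where uvw: "p = u # v # w # vs"
    by (auto simp: eval_nat_numeral Suc_le_length_iff)
  obtain c F where F: "F \<in> Ch" "u = vtx c F" "v = vtx (\<not> c) F"
    using p(1) E_iff unfolding uvw walk_Cons2 by blast
  from walk_gallery[OF p(1,2)[unfolded uvw] F] obtain G cs where
    G: "G \<in> Ch" "gallery F (map gen cs) G" "successively (\<noteq>) (c # cs)" "length cs = length (w # vs)"
      "last p = vtx (\<not> last (c # cs)) G" "last (butlast p) = vtx (last (c # cs)) G"
    unfolding uvw[symmetric] by blast
  obtain e H where H': "H \<in> Ch" "last p = vtx e H" "u = vtx (\<not> e) H"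
    using p(4) unfolding E_iff uvw by auto
  define d where "d = (\<not> e)"
  have H: "H \<in> Ch" "last p = vtx (\<not> d) H" "u = vtx d H" using H' by (simp_all add: d_def)
  have d: "d = c" using H(3) F(2) vtx_type by auto
  have last: "last (c # cs) = c" using H(2) G(5) vtx_type d by fastforce
  then have ev: "even (length cs)" using successively_neq_last[OF G(3)] by blast
  have len: "length cs = 2 \<or> length cs = 4"
  proof -
    obtain k where "length cs = 2 * k" using ev by (rule evenE)
    moreover have "0 < length cs" "length cs < 6" using G(4) short uvw by simp_all
    ultimately show ?thesis by presburger
  qed
  have alt: "successively (\<noteq>) cs" using G(3) by (cases cs) auto
  have red: "reduced (map gen cs)" by (rule reduced_alternating) (use alt len in auto)
  have FG: "\<delta> F G = wp (map gen cs)" by (rule dist_of_gallery[OF G(2) red])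
  have FH: "\<delta> F H = gen c"
  proof -
    have "v \<noteq> last p" using p(2) uvw by auto
    then have "F \<noteq> H" using F(3) H(2) d by auto
    then show ?thesis using vtx_eq[OF F(1) H(1), of c c] F(2) H(3) d by auto
  qed
  have HG: "\<delta> H G = gen (\<not> c)"
  proof -
    have "last (butlast p) \<in> set (v # butlast (w # vs))"
      using last_in_set[of "v # butlast (w # vs)"] unfolding uvw by simp
    then have "last (butlast p) \<in> set (v # w # vs)"
      using in_set_butlastD[of _ "w # vs"] by (auto simp del: butlast.simps)
    then have "u \<noteq> last (butlast p)" using p(2) unfolding uvw by auto
    then have "H \<noteq> G" using G(6) last H(3) d by auto
    then show ?thesis using vtx_eq[OF H(1) G(1), of "\<not> c" "\<not> c"] G(5) H(2) d last by auto
  qed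
  have "len (\<delta> F G) \<le> 2"
    using len_dist_triangle[OF F(1) H(1) G(1)] FH HG len_gen_one[OF gen_S] by simp
  then have "length cs = 2" using red len FG by (auto simp: reduced_def)
  then have "cs = [\<not> c, c]"
    using G(3) by (auto simp: eval_nat_numeral length_Suc_conv)
  then have "\<delta> F G = gen (\<not> c) \<otimes> gen c" using FG by simp
  moreover have "gallery F (map gen [c, \<not> c]) G"
    using F(1) G(1) H(1) FH HG by auto
  then have "\<delta> F G = wp (map gen [c, \<not> c])"
    by (rule dist_of_gallery) (rule reduced_alternating, simp_all)
  ultimately show False using gen_commute_neq[of c] by simp
qed

text \<open>The two alternating words for \<open>wJ\<close> give two minimal galleries between
  opposite chambers, with middle chambers \<open>Y True\<close> and \<open>Y False\<close>. The
  cycle runs through the two panels of each of \<open>C\<close>, \<open>Y True\<close>,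
  \<open>D\<close> and \<open>Y False\<close>; together the galleries form an apartment.\<close>

lemma cycle_exists: "\<exists>p. graph_cycle V E p \<and> length p = 8"
proof -
  obtain C D where CD: "C \<in> Ch" "D \<in> Ch" "\<delta> C D = wJ" using opposite_chambers by blast
  have wJ4: "wp (map gen [c, \<not> c, c, \<not> c]) = wJ" for c
    using wJ_eq[of "\<not> c"] n4 by (simp add: aw_def eval_nat_numeral)
  have "\<exists>Y0\<in>Ch. \<exists>Y\<in>Ch. \<exists>Y1\<in>Ch. \<delta> C Y0 = gen c \<and> \<delta> Y0 Y = gen (\<not> c) \<and> \<delta> Y Y1 = gen c \<and> \<delta> Y1 D = gen (\<not> c)" for c
  proof -
    have "gallery C (map gen [c, \<not> c, c, \<not> c]) D"
      by (rule gallery_of_dist) (use CD wJ4[of c] in simp_all)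
    then show ?thesis by auto
  qed
  then have "\<exists>Y0 Y Y1. Y0 \<in> Ch \<and> Y \<in> Ch \<and> Y1 \<in> Ch \<and> \<delta> C Y0 = gen c \<and> \<delta> Y0 Y = gen (\<not> c) \<and>
      \<delta> Y Y1 = gen c \<and> \<delta> Y1 D = gen (\<not> c)" for c by blast
  then obtain Y0 Y Y1 where Y: "Y0 c \<in> Ch" "Y c \<in> Ch" "Y1 c \<in> Ch" "\<delta> C (Y0 c) = gen c"
    "\<delta> (Y0 c) (Y c) = gen (\<not> c)" "\<delta> (Y c) (Y1 c) = gen c" "\<delta> (Y1 c) D = gen (\<not> c)" for c
    by metis
  have CX: "\<delta> C (Y c) = gen c \<otimes> gen (\<not> c)" for c
  proof -
    have "gallery C (map gen [c, \<not> c]) (Y c)" using Y[of c] CD by auto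
    then have "\<delta> C (Y c) = wp (map gen [c, \<not> c])"
      by (rule dist_of_gallery) (rule reduced_alternating, simp_all)
    then show ?thesis by simp
  qed
  have XD: "\<delta> (Y c) D = gen c \<otimes> gen (\<not> c)" for c
  proof -
    have "gallery (Y c) (map gen [c, \<not> c]) D" using Y[of c] CD by auto
    then have "\<delta> (Y c) D = wp (map gen [c, \<not> c])"
      by (rule dist_of_gallery) (rule reduced_alternating, simp_all)
    then show ?thesis by simp
  qed
  have len2: "len (gen c \<otimes> gen (\<not> c)) = 2" for c
    using reduced_alternating[of "[c, \<not> c]"] by (simp add: reduced_def)
  \<comment> \<open>Chambers sharing a vertex are at distance at most one, whereas these pairs are
    at distance two or four.\<close>
  have far: "vtx d C \<noteq> vtx e D" "vtx d C \<noteq> vtx e (Y c)" "vtx d (Y c) \<noteq> vtx e D" for c d e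
    using len_same_vtx[OF CD(1,2), of d e] len_same_vtx[OF CD(1) Y(2), of d e c]
      len_same_vtx[OF Y(2) CD(2), of d c e] CX[of c] XD[of c] len2[of c] CD(3) len_wJ n4 by auto
  have YY: "vtx d (Y True) \<noteq> vtx e (Y False)" for d e
  proof
    assume "vtx d (Y True) = vtx e (Y False)"
    then have "Y True = Y False \<or> \<delta> (Y True) (Y False) = gen d" using vtx_eq[OF Y(2) Y(2)] by blast
    then have "\<delta> C (Y False) = \<delta> C (Y True) \<or> \<delta> C (Y False) = \<delta> C (Y True) \<otimes> gen d"
      using dist_step_right[OF CD(1) Y(2) Y(2) gen_S] by auto
    then show False
    proof
      assume "\<delta> C (Y False) = \<delta> C (Y True)"
      then show False using CX[of True] CX[of False] gen_commute_neq[of True] by simp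
    next
      assume "\<delta> C (Y False) = \<delta> C (Y True) \<otimes> gen d"
      then show False
        using CX[of True] CX[of False] len2[of True] len2[of False]
          len_gen_right[OF gen_S, of "\<delta> C (Y True)" d] dist_closed[OF CD(1) Y(2)] by simp
    qed
  qed
  have type: "vtx True x \<noteq> vtx False y" for x y by (auto dest: vtx_type)
  have e1: "(vtx c C, vtx (\<not> c) (Y c)) \<in> E" "(vtx (\<not> c) (Y c), vtx c C) \<in> E" for c
  proof -
    have "vtx c C = vtx c (Y0 c)" "vtx (\<not> c) (Y c) = vtx (\<not> c) (Y0 c)"
      using vtx_eq[OF CD(1) Y(1), of c c c] vtx_eq[OF Y(1) Y(2), of "\<not> c" c "\<not> c" c] Y(4,5) by simp_all
    then show "(vtx c C, vtx (\<not> c) (Y c)) \<in> E" "(vtx (\<not> c) (Y c), vtx c C) \<in> E"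
      by (auto intro: edge[OF Y(1)[of c]])
  qed
  have e2: "(vtx c (Y c), vtx (\<not> c) D) \<in> E" "(vtx (\<not> c) D, vtx c (Y c)) \<in> E" for c
  proof -
    have "vtx c (Y c) = vtx c (Y1 c)" "vtx (\<not> c) D = vtx (\<not> c) (Y1 c)"
      using vtx_eq[OF Y(2) Y(3), of c c c c] vtx_eq[OF Y(3) CD(2), of "\<not> c" c "\<not> c"] Y(6,7) by simp_all
    then show "(vtx c (Y c), vtx (\<not> c) D) \<in> E" "(vtx (\<not> c) D, vtx c (Y c)) \<in> E"
      by (auto intro: edge[OF Y(3)[of c]])
  qed
  have e3: "F \<in> Ch \<Longrightarrow> (vtx True F, vtx False F) \<in> E" "F \<in> Ch \<Longrightarrow> (vtx False F, vtx True F) \<in> E" for F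
    by (auto intro: edge[of F])
  let ?p = "[vtx True C, vtx False (Y True), vtx True (Y True), vtx False D,
    vtx True D, vtx False (Y False), vtx True (Y False), vtx False C]"
  have "walk ?p"
    using e1[of True] e1[of False] e2[of True] e2[of False] e3 Y(2) CD vtx_V
    by (simp add: graph_walk_def)
  moreover have "distinct ?p"
    using far YY type far[symmetric] YY[symmetric] type[symmetric] by simp
  moreover have "(vtx False C, vtx True C) \<in> E" by (rule e3(2)[OF CD(1)])
  ultimately have "graph_cycle V E ?p" by (simp add: graph_cycle_def)
  then show ?thesis by (intro exI[of _ ?p]) simp
qed

lemma girth: "graph_girth V E = 8"
proof (rule antisym)
  obtain p where p: "graph_cycle V E p" "length p = 8" using cycle_exists by blast
  have "graph_girth V E \<le> enat (length p)" unfolding graph_girth_def by (rule INF_lower) (use p in simp)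
  then show "graph_girth V E \<le> 8" using p(2) by (simp add: numeral_eq_enat)
  have "enat 8 \<le> graph_girth V E"
    unfolding graph_girth_def by (rule INF_greatest) (use cycle_length in simp)
  then show "8 \<le> graph_girth V E" by (simp add: numeral_eq_enat)
qed

lemma quadrangle: "generalised_quadrangle points lines inc"
  unfolding generalised_polygon_def
  using diameter girth by (auto simp: points_def lines_def inc_def numeral_eq_enat)

end

theorem corollary2p16:
  fixes W :: "('w, 'b) monoid_scheme" and S :: "'w set"
    and Ch :: "'c set" and \<delta> :: "'c \<Rightarrow> 'c \<Rightarrow> 'w" and \<theta> :: "'c \<Rightarrow> 'c"
  assumes "building W S Ch \<delta>"
    and "finite Ch"
    and "finite (carrier W)"
    and "thick_building W S Ch \<delta>"
    and "irreducible_coxeter W S"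
    and "card S \<ge> 2"
    and "building_automorphism S Ch \<delta> \<theta>"
    and "anisotropic W S Ch \<delta> \<theta>"
  shows "\<exists>(P :: 'c set set) (L :: 'c set set) I s t.
           is_flag_building S Ch \<delta> P L I \<and>
           finite P \<and> finite L \<and> generalised_quadrangle P L I \<and>
           s \<ge> 2 \<and> t \<ge> 2 \<and> has_parameters P L I s t \<and> coprime s t"
proof -
  interpret thick_bldg W S Ch \<delta>
    by (rule thick_bldg.intro[OF assms(1)]) (unfold_locales, rule assms(4))
  obtain \<sigma> where \<sigma>: "bij_betw \<theta> Ch Ch" "bij_betw \<sigma> S S"
    "\<forall>C\<in>Ch. \<forall>D\<in>Ch. \<forall>s\<in>S. \<delta> C D = s \<longleftrightarrow> \<delta> (\<theta> C) (\<theta> D) = \<sigma> s"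
    using assms(7) unfolding building_automorphism_def by blast
  obtain B where B: "B \<in> Ch" using chambers_nonempty by blast
  \<comment> \<open>The distance at one chamber; uniqueness of the longest element carries it over
    to all others.\<close>
  define w0 where "w0 = \<delta> B (\<theta> B)"
  have opp: "longest_element W S (\<delta> C (\<theta> C))" if "C \<in> Ch" for C
    using assms(8) that by (simp add: anisotropic_def opposite_def)
  interpret anisotropic_bldg W S Ch \<delta> \<theta> \<sigma> w0
  proof unfold_locales
    show "longest_element W S w0" unfolding w0_def by (rule opp[OF B])
    show "\<delta> C (\<theta> C) = w0" if "C \<in> Ch" for C
      unfolding w0_def by (rule longest_unique[OF opp[OF that] opp[OF B]])
  qed (use assms(2) \<sigma> in auto)
  obtain a b where ab: "S = {a, b}" "a \<noteq> b" "ord (a \<otimes>\<^bsub>W\<^esub> b) = 4" "coprime (q a) (q b)"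
    using rank_two[OF assms(3,5,6)] by blast
  interpret p: aniso_pair W S Ch \<delta> \<theta> \<sigma> w0 a b by unfold_locales (use ab in auto)
  interpret p: aniso_quadrangle W S Ch \<delta> \<theta> \<sigma> w0 a b
    by unfold_locales (use ab p.ord_eq_n in auto)
  show ?thesis
    using p.flag_building p.quadrangle p.parameters ab q_ge_2[of a] q_ge_2[of b] finite_Ch
    by (intro exI[of _ p.points] exI[of _ p.lines] exI[of _ p.inc] exI[of _ "q a"] exI[of _ "q b"])
      (simp add: p.points_def p.lines_def)
qed

end
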